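(* Let $E$ and $F$ be nonzero Banach spaces over $\mathbb K\in\{\mathbb R,\mathbb C\}$ and let $n\ge 1$. (a) If $J$ is a subspace of $\mathcal P(^nE,F)$ that contains all finite type $n$-homogeneous polynomials, then $$\mathrm{Ext}\,B_{J^*}\subset \overline{\{e_x\otimes y^*: x\in S_E,\ y^*\in S_{F^*}\}}^{w^*},$$ where $w^*$ denotes the topology $\sigma(J^*,J)$. (b) For $J=\mathcal P_w(^nE,F)$, $$\mathrm{Ext}\,B_{\mathcal P_w(^nE,F)^*}\subset\{e_z\otimes y^*: z\in S_{E^{**}},\ y^*\in S_{F^*}\}.$$
   Context: $\mathcal P(^nE,F)$ is the Banach space of continuous $n$-homogeneous polynomials $P:E\to F$ with norm $\|P\|=\sup_{\|x\|\le1}\|P(x)\|$. $\mathcal P_w(^nE,F)$ is the subspace of polynomials that are weakly continuous on bounded sets: $\|P(x_\alpha)-P(x)\|\to0$ for every bounded net $(x_\alpha)$ in $E$ converging weakly to $x\in E$. Finite type $n$-homogeneous polynomials are those of the form $x\mapsto\sum_{j=1}^N x_j^*(x)^n y_j$ with $x_j^*\in E^*$, $y_j\in F$, $N\in\mathbb N$. For $x\in E$, $y^*\in F^*$, $e_x\otimes y^*$ is the functional $P\mapsto y^*(P(x))$. For $z\in E^{**}$, $y^*\in F^*$, $e_z\otimes y^*$ is the functional $P\mapsto y^*(\overline P(z))$, i.e. $\overline P(z)\in F^{**}$ applied to $y^*$, where $\overline P\in\mathcal P(^nE^{**},F^{**})$ is the Aron-Berner (canonical) extension of $P$. $B_X$,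 $S_X$ are the closed unit ball and unit sphere of $X$, and $\mathrm{Ext}\,B_X$ is the set of extreme points of $B_X$. *)

theory Defs
  imports
    "HOL-Analysis.Analysis"
    "HOL-Library.Function_Algebras"
    "HOL-Library.Multiset"
begin

section \<open>Scalars\<close>

text \<open>Up to isometric isomorphism, the instances of this class are exactly the real and the
  complex numbers.\<close>

class real_or_complex = real_normed_field +
  assumes real_or_complex:
    "\<exists>f :: 'a \<Rightarrow> complex. (\<forall>x y. f (x + y) = f x + f y) \<and> (\<forall>r x. f (r *\<^sub>R x) = r *\<^sub>R f x)
      \<and> (\<forall>x y. f (x * y) = f x * f y) \<and> f 1 = 1
      \<and> (\<forall>x. norm (f x) = norm x) \<and> (range f = \<real> \<or> range f = UNIV)"

instance real :: real_or_complex
  by standard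
    (rule exI[of _ complex_of_real], auto simp: Reals_def scaleR_conv_of_real)

instance complex :: real_or_complex
  by standard (rule exI[of _ id], auto)

text \<open>The type class \<open>real_normed_vector\<close> provides the additive group, the norm and the real
  scaling; multiplication by scalars in \<open>'k\<close> is given by the explicit function \<open>scale\<close>. A Banach
  space over \<open>'k\<close> is such a structure on a type of class \<open>banach\<close>.\<close>

locale normed_space_over = vector_space scale
  for scale :: "'k::real_or_complex \<Rightarrow> 'a::real_normed_vector \<Rightarrow> 'a" +
  assumes norm_scale: "norm (scale c x) = norm c * norm x"
    and scale_of_real: "scale (of_real r) x = r *\<^sub>R x"

section \<open>Normed spaces on a carrier, and duals\<close>

text \<open>Real vector space structure on functions; it makes \<open>extreme_point_of\<close> applicable to sets of
  functionals.\<close>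

instantiation "fun" :: (type, real_vector) real_vector
begin

definition scaleR_fun :: "real \<Rightarrow> ('a \<Rightarrow> 'b) \<Rightarrow> 'a \<Rightarrow> 'b"
  where "scaleR_fun r f = (\<lambda>x. r *\<^sub>R f x)"

instance
  by standard (simp_all add: scaleR_fun_def plus_fun_def fun_eq_iff algebra_simps)

end

record ('k, 'v) normed_sp =
  carr :: "'v set"
  smul :: "'k \<Rightarrow> 'v \<Rightarrow> 'v"
  nrm :: "'v \<Rightarrow> real"

definition unit_ball :: "('k, 'v) normed_sp \<Rightarrow> 'v set"
  where "unit_ball X = {v \<in> carr X. nrm X v \<le> 1}"

definition unit_sphere :: "('k, 'v) normed_sp \<Rightarrow> 'v set"
  where "unit_sphere X = {v \<in> carr X. nrm X v = 1}"

definition whole_space ::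
    "('k \<Rightarrow> 'a \<Rightarrow> 'a) \<Rightarrow> ('k, 'a::real_normed_vector) normed_sp"
  where "whole_space s = \<lparr>carr = UNIV, smul = s, nrm = norm\<rparr>"

text \<open>Topological dual with the operator norm. A functional on \<open>carr X\<close> is represented by the
  function that agrees with it on \<open>carr X\<close> and vanishes elsewhere.\<close>

definition dual :: "('k::real_or_complex, 'v::ab_group_add) normed_sp \<Rightarrow> ('k, 'v \<Rightarrow> 'k) normed_sp"
  where "dual X = \<lparr>
    carr = {\<phi>. (\<forall>u\<in>carr X. \<forall>v\<in>carr X. \<phi> (u + v) = \<phi> u + \<phi> v)
             \<and> (\<forall>c. \<forall>v\<in>carr X. \<phi> (smul X c v) = c * \<phi> v)
             \<and> (\<exists>C. \<forall>v\<in>carr X. norm (\<phi> v) \<le> C * nrm X v)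
             \<and> (\<forall>v. v \<notin> carr X \<longrightarrow> \<phi> v = 0)},
    smul = (\<lambda>c \<phi> v. c * \<phi> v),
    nrm = (\<lambda>\<phi>. SUP v\<in>unit_ball X. norm (\<phi> v))\<rparr>"

text \<open>The topology \<open>\<sigma>(X*, X)\<close> on the dual of \<open>X\<close>: the coarsest topology making all evaluations at
  points of \<open>X\<close> continuous.\<close>

definition weak_star ::
    "('k::real_or_complex, 'v::ab_group_add) normed_sp \<Rightarrow> ('v \<Rightarrow> 'k) topology"
  where "weak_star X = topology_generated_by
    {{\<phi> \<in> carr (dual X). \<phi> v \<in> U} | v U. v \<in> carr X \<and> open U}"

section \<open>Homogeneous polynomials\<close>

text \<open>An \<open>n\<close>-linear map is represented by a function on lists that is relevant only on lists of
  length \<open>n\<close>; it is set to \<open>0\<close> on all other lists so that the representation is unique.\<close>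

definition multilinear ::
    "nat \<Rightarrow> ('k::field \<Rightarrow> 'a::ab_group_add \<Rightarrow> 'a) \<Rightarrow> ('k \<Rightarrow> 'b::ab_group_add \<Rightarrow> 'b)
      \<Rightarrow> ('a list \<Rightarrow> 'b) \<Rightarrow> bool"
  where "multilinear n sE sF A \<longleftrightarrow>
    (\<forall>xs i. length xs = n \<longrightarrow> i < n \<longrightarrow> Vector_Spaces.linear sE sF (\<lambda>u. A (xs[i := u])))
    \<and> (\<forall>xs. length xs \<noteq> n \<longrightarrow> A xs = 0)"

definition polys ::
    "nat \<Rightarrow> ('k::field \<Rightarrow> 'a::real_normed_vector \<Rightarrow> 'a)
      \<Rightarrow> ('k \<Rightarrow> 'b::real_normed_vector \<Rightarrow> 'b) \<Rightarrow> ('a \<Rightarrow> 'b) set"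
  where "polys n sE sF =
    {P. (\<exists>A. multilinear n sE sF A \<and> (\<forall>x. P x = A (replicate n x))) \<and> continuous_on UNIV P}"

text \<open>A set \<open>J\<close> of polynomials with pointwise operations and the polynomial norm.\<close>

definition poly_space ::
    "('k \<Rightarrow> 'b \<Rightarrow> 'b) \<Rightarrow> ('a::real_normed_vector \<Rightarrow> 'b::real_normed_vector) set
      \<Rightarrow> ('k, 'a \<Rightarrow> 'b) normed_sp"
  where "poly_space sF J = \<lparr>
    carr = J,
    smul = (\<lambda>c P x. sF c (P x)),
    nrm = (\<lambda>P. SUP x\<in>cball 0 1. norm (P x))\<rparr>"

definition finite_type_polys ::
    "nat \<Rightarrow> ('k::real_or_complex \<Rightarrow> 'a::real_normed_vector \<Rightarrow> 'a)
      \<Rightarrow> ('k \<Rightarrow> 'b::real_normed_vector \<Rightarrow> 'b) \<Rightarrow> ('a \<Rightarrow> 'b) set"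
  where "finite_type_polys n sE sF =
    {(\<lambda>x. \<Sum>j<N. sF (f j x ^ n) (y j)) | (N::nat) f y.
       \<forall>j<N. f j \<in> carr (dual (whole_space sE))}"

text \<open>Weak continuity on bounded sets. A net in \<open>E\<close> is represented by its filter of tails.\<close>

definition weakly_cont_polys ::
    "nat \<Rightarrow> ('k::real_or_complex \<Rightarrow> 'a::real_normed_vector \<Rightarrow> 'a)
      \<Rightarrow> ('k \<Rightarrow> 'b::real_normed_vector \<Rightarrow> 'b) \<Rightarrow> ('a \<Rightarrow> 'b) set"
  where "weakly_cont_polys n sE sF =
    {P \<in> polys n sE sF. \<forall>\<F> x.
       (\<exists>r. \<forall>\<^sub>F u in \<F>. norm u \<le> r) \<and> (\<forall>f\<in>carr (dual (whole_space sE)). (f \<longlongrightarrow> f x) \<F>)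
       \<longrightarrow> ((\<lambda>u. norm (P u - P x)) \<longlongrightarrow> 0) \<F>}"

section \<open>Aron--Berner extension and evaluation functionals\<close>

definition polar_form ::
    "nat \<Rightarrow> ('k::field \<Rightarrow> 'a::ab_group_add \<Rightarrow> 'a) \<Rightarrow> ('k \<Rightarrow> 'b::ab_group_add \<Rightarrow> 'b)
      \<Rightarrow> ('a \<Rightarrow> 'b) \<Rightarrow> 'a list \<Rightarrow> 'b"
  where "polar_form n sE sF P = (THE A. multilinear n sE sF A
    \<and> (\<forall>xs ys. mset xs = mset ys \<longrightarrow> A xs = A ys) \<and> (\<forall>x. P x = A (replicate n x)))"

text \<open>For a bounded \<open>n\<close>-linear form \<open>B\<close> on \<open>E\<close>, the canonical extension to \<open>E**\<close> is the iterated limit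
  of \<open>B (x\<^sub>1, \<dots>, x\<^sub>n)\<close> along nets in \<open>E\<close> with \<open>x\<^sub>i \<rightarrow> z\<^sub>i\<close> in the weak-star topology of \<open>E**\<close>, the limit over \<open>x\<^sub>n\<close> being taken
  first. Since \<open>B\<close> and its partial limits are continuous and linear in each remaining variable,
  each of these limits is an application of \<open>z\<^sub>i\<close> to an element of \<open>E*\<close>.\<close>

primrec iterated_ext :: "(('a \<Rightarrow> 'k) \<Rightarrow> 'k) list \<Rightarrow> ('a list \<Rightarrow> 'k) \<Rightarrow> 'k"
  where
    "iterated_ext [] B = B []"
  | "iterated_ext (z # zs) B = z (\<lambda>x. iterated_ext zs (\<lambda>xs. B (x # xs)))"

text \<open>The value at \<open>z\<close> is an element of \<open>F**\<close>, hence \<open>0\<close> outside \<open>F*\<close> by the convention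
  in \<open>dual\<close>.\<close>

definition aron_berner ::
    "nat \<Rightarrow> ('k::real_or_complex \<Rightarrow> 'a::real_normed_vector \<Rightarrow> 'a)
      \<Rightarrow> ('k \<Rightarrow> 'b::real_normed_vector \<Rightarrow> 'b)
      \<Rightarrow> ('a \<Rightarrow> 'b) \<Rightarrow> (('a \<Rightarrow> 'k) \<Rightarrow> 'k) \<Rightarrow> ('b \<Rightarrow> 'k) \<Rightarrow> 'k"
  where "aron_berner n sE sF P z = (\<lambda>y. if y \<in> carr (dual (whole_space sF))
    then iterated_ext (replicate n z) (\<lambda>xs. y (polar_form n sE sF P xs)) else 0)"

text \<open>The functionals \<open>e\<^sub>x \<otimes> y*\<close> and \<open>e\<^sub>z \<otimes> y*\<close> on a space \<open>J\<close> of polynomials.\<close>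

definition eval_tensor :: "('a \<Rightarrow> 'b) set \<Rightarrow> 'a \<Rightarrow> ('b \<Rightarrow> 'k::zero) \<Rightarrow> ('a \<Rightarrow> 'b) \<Rightarrow> 'k"
  where "eval_tensor J x y = (\<lambda>P. if P \<in> J then y (P x) else 0)"

definition bidual_eval_tensor ::
    "nat \<Rightarrow> ('k::real_or_complex \<Rightarrow> 'a::real_normed_vector \<Rightarrow> 'a)
      \<Rightarrow> ('k \<Rightarrow> 'b::real_normed_vector \<Rightarrow> 'b) \<Rightarrow> ('a \<Rightarrow> 'b) set
      \<Rightarrow> (('a \<Rightarrow> 'k) \<Rightarrow> 'k) \<Rightarrow> ('b \<Rightarrow> 'k) \<Rightarrow> ('a \<Rightarrow> 'b) \<Rightarrow> 'k"
  where "bidual_eval_tensor n sE sF J z y =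
    (\<lambda>P. if P \<in> J then aron_berner n sE sF P z y else 0)"

end

theory Submission
  imports Defs
begin

text \<open>
  The usual route through Krein--Milman and Milman's theorem is replaced by finitely additive means.
  If \<open>\<phi>\<close> is in the unit ball of \<open>J*\<close>, Hahn--Banach extends \<open>Re \<circ> \<phi>\<close> from \<open>J\<close>, viewed as a space of
  functions on the set \<open>S\<close> of all pairs \<open>(x, y*)\<close>, to a mean on the bounded real functions on \<open>S\<close>.
  If \<open>\<phi>\<close> is extreme, splitting \<open>S\<close> into two sets of positive mass writes \<open>\<phi>\<close> as a
  convex combination of two functionals, so both are \<open>\<phi>\<close>. Hence the pairs with \<open>Re y*(P x)\<close>
  at most \<open>Re \<phi>(P) - \<epsilon>\<close> form a null set; as finitely many null sets do not cover \<open>S\<close>, some pair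
  approximates \<open>\<phi>\<close> at finitely many \<open>P\<close> at once, which is (a).

  For (b), let \<open>(z, y*)\<close> be a weak-star cluster point of the approximating pairs. By polarization the
  polar form of \<open>P\<close> is jointly weakly continuous on bounded sets, and finite nets in the unit
  ball upgrade this to uniform weak continuity. So the canonical extension of \<open>P\<close> at \<open>z\<close> is close to \<open>P\<close> at
  all points of the ball that are weak-star close to \<open>z\<close>, which identifies \<open>\<phi>\<close> with \<open>e\<^sub>z \<otimes> y*\<close>. If \<open>z\<close>
  or \<open>y*\<close> had norm less than \<open>1\<close>, so would \<open>\<phi>\<close>, which could then be perturbed inside the ball.
\<close>

text \<open>The obstacle in (b) is that both members of an approximating pair move: x tends to z and
  its functional tends to y* only in weak-star topologies, and limits of that kind need not commute
  with the pairing. But P is uniformly weakly continuous on the ball, so the vectors P x oscillate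
  little in norm for x near z. One of these vectors can be frozen, and on a fixed vector pointwise
  convergence of the functionals is enough. The same uniformity settles the order of limits in the
  canonical extension: its value is compared with P at nearby points, whatever the order. Weak-star
  limits of unit vectors are only known to lie in the ball, so the two norms are recovered at the
  very end. The perturbation used there needs a nonzero functional on the space; evaluation at a
  suitable pair is one because of the polynomials f(x)^n b. Means see real parts only. Scalar
  identities and estimates are recovered by testing with multiples by 1 and i, which explains the
  splitting of tolerances into thirds.\<close>

section \<open>Scalars\<close>

definition rc_embed :: "'k::real_or_complex \<Rightarrow> complex"
  where "rc_embed = (SOME f. (\<forall>x y. f (x + y) = f x + f y) \<and> (\<forall>r x. f (r *\<^sub>R x) = r *\<^sub>R f x)
      \<and> (\<forall>x y. f (x * y) = f x * f y) \<and> f 1 = 1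
      \<and> (\<forall>x. norm (f x) = norm x) \<and> (range f = \<real> \<or> range f = UNIV))"

lemma rc_embed:
  fixes x y :: "'k::real_or_complex"
  shows rc_embed_add: "rc_embed (x + y) = rc_embed x + rc_embed y"
    and rc_embed_scaleR: "rc_embed (r *\<^sub>R x) = r *\<^sub>R rc_embed x"
    and rc_embed_mult: "rc_embed (x * y) = rc_embed x * rc_embed y"
    and rc_embed_1: "rc_embed (1::'k) = 1"
    and rc_embed_norm: "norm (rc_embed x) = norm x"
    and rc_embed_range: "range (rc_embed :: 'k \<Rightarrow> complex) = \<real>
      \<or> range (rc_embed :: 'k \<Rightarrow> complex) = UNIV"
proof -
  note e = someI_ex[OF real_or_complex[where 'a = 'k], folded rc_embed_def[where 'k = 'k]]
  show "rc_embed (x + y) = rc_embed x + rc_embed y" "rc_embed (r *\<^sub>R x) = r *\<^sub>R rc_embed x"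
    "rc_embed (x * y) = rc_embed x * rc_embed y" "rc_embed (1::'k) = 1"
    "norm (rc_embed x) = norm x"
    "range (rc_embed :: 'k \<Rightarrow> complex) = \<real> \<or> range (rc_embed :: 'k \<Rightarrow> complex) = UNIV"
    using e by blast+
qed

lemma rc_embed_diff: "rc_embed (x - y) = rc_embed x - rc_embed y"
  using rc_embed_add[of "x - y" y] by simp

lemma rc_embed_0 [simp]: "rc_embed 0 = 0"
  using rc_embed_diff[of 0 0] by simp

lemma rc_embed_inj: "rc_embed x = rc_embed y \<longleftrightarrow> x = y"
  using rc_embed_norm[of "x - y"] by (auto simp: rc_embed_diff)

lemma rc_embed_of_real: "rc_embed (of_real r) = of_real r"
  using rc_embed_scaleR[of r 1] by (simp add: rc_embed_1 scaleR_conv_of_real)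

definition re :: "'k::real_or_complex \<Rightarrow> real"
  where "re c = Re (rc_embed c)"

text \<open>Being \<open>0\<close> for real scalars, \<open>imu\<close> satisfies \<open>c = re c - imu * re (imu * c)\<close> in both cases.\<close>

definition imu :: "'k::real_or_complex"
  where "imu = (if range (rc_embed :: 'k \<Rightarrow> complex) = UNIV then inv rc_embed \<i> else 0)"

lemma re_add: "re (x + y) = re x + re y"
  by (simp add: re_def rc_embed_add)

lemma re_diff: "re (x - y) = re x - re y"
  by (simp add: re_def rc_embed_diff)

lemma re_of_real_mult: "re (of_real r * x) = r * re x"
  by (simp add: re_def rc_embed_mult rc_embed_of_real)

lemma re_scaleR: "re (r *\<^sub>R x) = r * re x"
  by (simp add: scaleR_conv_of_real re_of_real_mult)

lemma re_of_real [simp]: "re (of_real r) = r"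
  by (simp add: re_def rc_embed_of_real)

lemma re_0 [simp]: "re 0 = 0"
  by (simp add: re_def)

lemma re_sum: "re (\<Sum>i\<in>I. f i) = (\<Sum>i\<in>I. re (f i))"
  by (induction I rule: infinite_finite_induct) (simp_all add: re_add)

lemma abs_re_le: "\<bar>re x\<bar> \<le> norm x"
  using abs_Re_le_cmod[of "rc_embed x"] by (simp add: re_def rc_embed_norm)

lemma re_le: "re x \<le> norm x"
  using abs_re_le[of x] by linarith

lemma imu_cases:
  obtains "imu = (0::'k::real_or_complex)" "\<And>c :: 'k. Im (rc_embed c) = 0"
  | "rc_embed (imu :: 'k) = \<i>"
proof (cases "range (rc_embed :: 'k \<Rightarrow> complex) = UNIV")
  case True
  then have "rc_embed (imu :: 'k) = \<i>"
    by (simp add: imu_def surj_f_inv_f)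
  then show thesis by (rule that(2))
next
  case False
  then have r: "range (rc_embed :: 'k \<Rightarrow> complex) = \<real>" using rc_embed_range by blast
  have "Im (rc_embed c) = 0" for c :: 'k
    using r complex_is_Real_iff by blast
  with False show thesis by (intro that(1)) (simp_all add: imu_def)
qed

lemma re_imu_of_real: "re (imu * of_real r :: 'k::real_or_complex) = 0"
  by (rule imu_cases[where 'k = 'k]) (simp_all add: re_def rc_embed_mult rc_embed_of_real)

lemma imu_square: "imu = (0::'k) \<or> imu * imu = (- 1 :: 'k::real_or_complex)"
proof (rule imu_cases[where 'k = 'k])
  assume "rc_embed (imu :: 'k) = \<i>"
  then have "rc_embed (imu * imu + 1 :: 'k) = rc_embed 0"
    by (simp add: rc_embed_add rc_embed_mult rc_embed_1)
  then have "imu * imu + 1 = (0::'k)" by (rule iffD1[OF rc_embed_inj])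
  then show ?thesis by (simp only: eq_neg_iff_add_eq_0 simp_thms)
qed simp

lemma norm_imu_le: "norm (imu :: 'k::real_or_complex) \<le> 1"
  by (rule imu_cases[where 'k = 'k], simp) (metis norm_ii order_refl rc_embed_norm)

lemma scalar_eq:
  fixes c :: "'k::real_or_complex"
  shows "c = of_real (re c) - imu * of_real (re (imu * c))"
proof -
  have "rc_embed c = rc_embed (of_real (re c) - imu * of_real (re (imu * c)) :: 'k)"
    by (rule imu_cases[where 'k = 'k])
      (auto simp: re_def rc_embed_add rc_embed_diff rc_embed_mult rc_embed_of_real complex_eq_iff)
  then show ?thesis by (simp only: rc_embed_inj)
qed

text \<open>Bounds on two real parts become a bound on the norm at the cost of a factor 2; the
  thirds of e and d in the approximation lemmas leave room for it.\<close>

lemma norm_le_re: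
  fixes c :: "'k::real_or_complex"
  shows "norm c \<le> \<bar>re c\<bar> + \<bar>re (imu * c)\<bar>"
proof -
  have "norm c \<le> \<bar>re c\<bar> + norm (imu::'k) * \<bar>re (imu * c)\<bar>"
    using norm_triangle_ineq4[of "of_real (re c)" "imu * of_real (re (imu * c))"]
    by (metis norm_mult norm_of_real scalar_eq)
  also have "\<dots> \<le> \<bar>re c\<bar> + \<bar>re (imu * c)\<bar>"
    using norm_imu_le[where 'k = 'k] by (simp add: mult_left_le_one_le)
  finally show ?thesis .
qed

lemma rotate_to_norm:
  fixes c :: "'k::real_or_complex"
  obtains u :: 'k where "norm u = 1" "u * c = of_real (norm c)"
proof (cases "c = 0")
  case True
  then show thesis using that[of 1] by simp
next
  case False
  then show thesis using that[of "of_real (norm c) / c"] by (simp add: norm_divide)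
qed

text \<open>The scalars are known only through \<open>rc_embed\<close>, an isometry onto a closed
  subset of the complex plane, so compactness is pulled back along its inverse. It feeds the finite
  nets and the Tychonoff argument.\<close>

lemma compact_cball_scalar: "compact (cball (0::'k::real_or_complex) r)"
proof -
  let ?e = "rc_embed :: 'k \<Rightarrow> complex"
  have cl: "closed (range ?e)"
    using rc_embed_range[where 'k = 'k] closed_complex_Reals by auto
  have inj: "inj ?e" by (auto simp: inj_def rc_embed_inj)
  have "continuous_on (range ?e) (inv ?e)"
  proof (clarsimp simp: continuous_on_iff inv_f_f[OF inj])
    fix x :: 'k and e :: real assume "e > 0"
    then show "\<exists>d>0. \<forall>x'. dist (rc_embed x') (rc_embed x) < d \<longrightarrow> dist x' x < e"
      by (intro exI[of _ e]) (simp add: dist_norm rc_embed_norm flip: rc_embed_diff)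
  qed
  then have "compact (inv ?e ` (cball 0 r \<inter> range ?e))"
    by (intro compact_continuous_image compact_Int_closed cl compact_cball)
      (auto elim: continuous_on_subset)
  moreover have "inv ?e ` (cball 0 r \<inter> range ?e) = cball 0 r"
  proof (intro equalityI subsetI)
    fix x :: 'k assume "x \<in> cball 0 r"
    then have "?e x \<in> cball 0 r \<inter> range ?e" by (simp add: rc_embed_norm)
    then show "x \<in> inv ?e ` (cball 0 r \<inter> range ?e)"
      using inv_f_f[OF inj, of x] by (metis image_eqI)
  qed (auto simp: inv_f_f[OF inj] rc_embed_norm)
  ultimately show ?thesis by simp
qed

section \<open>The Hahn--Banach theorem\<close>

definition sublinear_on :: "'v::real_vector set \<Rightarrow> ('v \<Rightarrow> real) \<Rightarrow> bool"
  where "sublinear_on W p \<longleftrightarrow> (\<forall>x\<in>W. \<forall>y\<in>W. p (x + y) \<le> p x + p y)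
    \<and> (\<forall>x\<in>W. \<forall>t>0. p (t *\<^sub>R x) = t * p x)"

definition real_linear_on :: "'v::real_vector set \<Rightarrow> ('v \<Rightarrow> real) \<Rightarrow> bool"
  where "real_linear_on W g \<longleftrightarrow> (\<forall>x\<in>W. \<forall>y\<in>W. g (x + y) = g x + g y)
    \<and> (\<forall>x\<in>W. \<forall>t. g (t *\<^sub>R x) = t * g x)"

text \<open>One inequality is enough for homogeneity: used at \<open>t *\<^sub>R x\<close> with the
  factor 1 / t it yields the other one.\<close>

lemma sublinear_onI:
  assumes "\<And>x y. x \<in> W \<Longrightarrow> y \<in> W \<Longrightarrow> p (x + y) \<le> p x + p y"
    and "\<And>x t. x \<in> W \<Longrightarrow> t > 0 \<Longrightarrow> p (t *\<^sub>R x) \<le> t * p x" and W: "subspace W"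
  shows "sublinear_on W p"
  unfolding sublinear_on_def
proof (intro conjI ballI allI impI)
  fix x t assume x: "x \<in> W" and t: "(t::real) > 0"
  have "p ((1/t) *\<^sub>R (t *\<^sub>R x)) \<le> (1/t) * p (t *\<^sub>R x)"
    by (rule assms(2)) (use x t W in \<open>auto simp: subspace_scale\<close>)
  then have "t * p x \<le> p (t *\<^sub>R x)" using t by (simp add: field_simps)
  with assms(2)[OF x t] show "p (t *\<^sub>R x) = t * p x" by simp
qed (use assms in auto)

lemma sublinear_on_0:
  assumes "sublinear_on W p" "subspace W" shows "p 0 = 0"
proof -
  have "p (2 *\<^sub>R 0) = 2 * p 0"
    using assms subspace_0[OF assms(2)] unfolding sublinear_on_def by (metis zero_less_numeral)
  then show ?thesis by simp
qed

lemma sublinear_on_minus: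
  assumes "sublinear_on W p" "subspace W" "x \<in> W" shows "- p (- x) \<le> p x"
proof -
  have "p (x + - x) \<le> p x + p (- x)"
    using assms subspace_neg[OF assms(2,3)] unfolding sublinear_on_def by blast
  then show ?thesis using sublinear_on_0[OF assms(1,2)] by simp
qed

text \<open>Lowering a sublinear functional \<open>p\<close> so that every linear functional below it
  satisfies \<open>g w \<ge> r\<close> for all \<open>(w, r)\<close> in a convex cone.\<close>

lemma sublinear_lower:
  assumes p: "sublinear_on W p" and W: "subspace W"
    and GW: "\<And>w r. (w, r) \<in> G \<Longrightarrow> w \<in> W \<and> r \<le> p w"
    and G0: "(0, 0) \<in> G"
    and Gadd: "\<And>v r w s. (v, r) \<in> G \<Longrightarrow> (w, s) \<in> G \<Longrightarrow> (v + w, r + s) \<in> G"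
    and Gscale: "\<And>w r t. (w, r) \<in> G \<Longrightarrow> t > 0 \<Longrightarrow> (t *\<^sub>R w, t * r) \<in> G"
  obtains p' where "sublinear_on W p'" "\<And>x. x \<in> W \<Longrightarrow> p' x \<le> p x"
    "\<And>w r. (w, r) \<in> G \<Longrightarrow> p' (- w) \<le> - r"
proof
  \<comment> \<open>A linear g with g \<le> p and g w \<ge> r satisfies g x = g (x + w) - g w \<le>
    p (x + w) - r, so no such g is lost by passing to the infimum.\<close>
  define p' where "p' x = (INF (w, r)\<in>G. p (x + w) - r)" for x
  have lb: "- p (- x) \<le> p (x + w) - r" if "x \<in> W" "(w, r) \<in> G" for x w r
  proof -
    have "p ((x + w) + (- x)) \<le> p (x + w) + p (- x)"
      using p that GW[OF that(2)] W unfolding sublinear_on_def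
      by (meson subspace_add subspace_neg)
    then show ?thesis using GW[OF that(2)] by simp
  qed
  have bdd: "bdd_below ((\<lambda>(w, r). p (x + w) - r) ` G)" if "x \<in> W" for x
    using lb[OF that] by (intro bdd_belowI[of _ "- p (- x)"]) auto
  have le: "p' x \<le> p (x + w) - r" if "x \<in> W" "(w, r) \<in> G" for x w r
    unfolding p'_def using cINF_lower[OF bdd[OF that(1)] that(2)] by simp
  have ne: "G \<noteq> {}" using G0 by auto
  show "p' x \<le> p x" if "x \<in> W" for x using le[OF that G0] by simp
  show "p' (- w) \<le> - r" if "(w, r) \<in> G" for w r
    using le[of "- w" w r] GW[OF that] that W sublinear_on_0[OF p W] by (simp add: subspace_neg)
  show "sublinear_on W p'"
  proof (rule sublinear_onI[OF _ _ W])
    fix x y assume x: "x \<in> W" and y: "y \<in> W"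
    have "p' (x + y) - (p (x + w) - r) \<le> p (y + v) - s"
      if a: "(w, r) \<in> G" "(v, s) \<in> G" for w r v s
    proof -
      have "p' (x + y) \<le> p (x + y + (w + v)) - (r + s)"
        by (rule le) (use x y W a Gadd in \<open>auto simp: subspace_add\<close>)
      also have "p (x + y + (w + v)) = p ((x + w) + (y + v))" by (simp add: algebra_simps)
      also have "\<dots> \<le> p (x + w) + p (y + v)"
        using p x y GW[OF a(1)] GW[OF a(2)] W unfolding sublinear_on_def by (meson subspace_add)
      finally show ?thesis by simp
    qed
    then have "p' (x + y) - (p (x + w) - r) \<le> p' y" if "(w, r) \<in> G" for w r
      unfolding p'_def[of y] using ne that by (intro cINF_greatest) auto
    then have "p' (x + y) - p' y \<le> p (x + w) - r" if "(w, r) \<in> G" for w r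
      using that by fastforce
    then have "p' (x + y) - p' y \<le> p' x"
      unfolding p'_def[of x] using ne by (intro cINF_greatest) auto
    then show "p' (x + y) \<le> p' x + p' y" by simp
  next
    fix x t assume x: "x \<in> W" and t: "(t::real) > 0"
    have "p' (t *\<^sub>R x) / t \<le> p (x + w) - r" if a: "(w, r) \<in> G" for w r
    proof -
      have "p' (t *\<^sub>R x) \<le> p (t *\<^sub>R x + t *\<^sub>R w) - t * r"
        by (rule le) (use x W Gscale[OF a t] in \<open>auto simp: subspace_scale\<close>)
      also have "p (t *\<^sub>R x + t *\<^sub>R w) = t * p (x + w)"
        using p x GW[OF a] W t unfolding sublinear_on_def
        by (metis scaleR_right_distrib subspace_add)
      finally show ?thesis using t by (simp add: field_simps)
    qed
    then have "p' (t *\<^sub>R x) / t \<le> p' x"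
      unfolding p'_def[of x] using ne by (intro cINF_greatest) auto
    then show "p' (t *\<^sub>R x) \<le> t * p' x" using t by (simp add: field_simps)
  qed
qed

text \<open>Subadditivity is where the chain matters: if p is used at x and q at y, the smaller of
  the two serves both points. The common lower bound b keeps the infimum finite.\<close>

lemma sublinear_Inf_chain:
  assumes W: "subspace W" and ne: "C \<noteq> {}"
    and C: "\<And>p. p \<in> C \<Longrightarrow> sublinear_on W p"
    and lb: "\<And>p x. p \<in> C \<Longrightarrow> x \<in> W \<Longrightarrow> b x \<le> p x"
    and chain: "\<And>p q. p \<in> C \<Longrightarrow> q \<in> C \<Longrightarrow> (\<forall>x\<in>W. p x \<le> q x) \<or> (\<forall>x\<in>W. q x \<le> p x)"
  shows "sublinear_on W (\<lambda>x. INF p\<in>C. p x)"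
proof (rule sublinear_onI[OF _ _ W])
  have bdd: "bdd_below ((\<lambda>p. p x) ` C)" if "x \<in> W" for x
    using lb that by (intro bdd_belowI[of _ "b x"]) auto
  have le: "(INF p\<in>C. p x) \<le> p x" if "x \<in> W" "p \<in> C" for p x
    using that by (intro cINF_lower bdd)
  let ?P = "\<lambda>x. INF p\<in>C. p x"
  fix x assume x: "x \<in> W"
  {
    fix y assume y: "y \<in> W"
    have "?P (x + y) - p x \<le> q y" if pq: "p \<in> C" "q \<in> C" for p q
    proof -
      obtain m where m: "m \<in> C" "m x \<le> p x" "m y \<le> q y"
        using chain[OF pq] pq x y by blast
      have "?P (x + y) \<le> m (x + y)" using m x y W by (intro le) (auto simp: subspace_add)
      also have "\<dots> \<le> m x + m y" using C[OF m(1)] x y unfolding sublinear_on_def by blast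
      finally show ?thesis using m by simp
    qed
    then have "?P (x + y) - p x \<le> ?P y" if "p \<in> C" for p
      using that ne by (intro cINF_greatest) auto
    then have "?P (x + y) - ?P y \<le> ?P x"
      using ne by (intro cINF_greatest) (auto simp: algebra_simps)
    then show "?P (x + y) \<le> ?P x + ?P y" by simp
  }
  fix t :: real assume t: "t > 0"
  have "?P (t *\<^sub>R x) / t \<le> p x" if "p \<in> C" for p
  proof -
    have "?P (t *\<^sub>R x) \<le> p (t *\<^sub>R x)" using that x W by (intro le) (auto simp: subspace_scale)
    then show ?thesis using C[OF that] x t by (simp add: sublinear_on_def field_simps)
  qed
  then have "?P (t *\<^sub>R x) / t \<le> ?P x" using ne by (intro cINF_greatest) auto
  then show "?P (t *\<^sub>R x) \<le> t * ?P x" using t by (simp add: field_simps)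
qed

text \<open>A minimal sublinear functional is linear.\<close>

lemma linear_below_sublinear:
  assumes p: "sublinear_on W p" and W: "subspace W"
  obtains g where "real_linear_on W g" "\<And>x. x \<in> W \<Longrightarrow> g x \<le> p x"
proof -
  \<comment> \<open>The candidates vanish off W, so that equality on W is equality of functions and
    the order is antisymmetric.\<close>
  define A where "A = {q. sublinear_on W q \<and> (\<forall>x\<in>W. q x \<le> p x) \<and> (\<forall>x. x \<notin> W \<longrightarrow> q x = 0)}"
  \<comment> \<open>\<open>R\<close> is the reversed pointwise order, so the maximal element
    supplied by Zorn's lemma is a minimal functional.\<close>
  define R where "R q q' \<longleftrightarrow> (\<forall>x\<in>W. q' x \<le> q x)" for q q' :: "'a \<Rightarrow> real"
  have cut: "(\<lambda>x. if x \<in> W then q x else 0) \<in> A"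
    if "sublinear_on W q" "\<And>x. x \<in> W \<Longrightarrow> q x \<le> p x" for q
    using that W by (auto simp: A_def sublinear_on_def subspace_add subspace_scale)
  have lb: "- p (- x) \<le> q x" if "q \<in> A" "x \<in> W" for q x
  proof -
    have "- q (- x) \<le> q x" using that W by (intro sublinear_on_minus) (auto simp: A_def)
    moreover have "q (- x) \<le> p (- x)" using that W by (auto simp: A_def subspace_neg)
    ultimately show ?thesis by simp
  qed
  have "\<exists>m\<in>A. \<forall>a\<in>A. R m a \<longrightarrow> a = m"
  proof (rule predicate_Zorn)
    show "partial_order_on A (relation_of R A)"
      by (auto simp: partial_order_on_def preorder_on_def refl_on_def trans_def antisym_def
          relation_of_def R_def A_def fun_eq_iff intro: order_trans order_antisym)
        (metis order_antisym)
    fix C assume "C \<in> Chains (relation_of R A)"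
    then have CA: "C \<subseteq> A" and ch: "\<And>a b. a \<in> C \<Longrightarrow> b \<in> C \<Longrightarrow> R a b \<or> R b a"
      unfolding Chains_def relation_of_def by auto
    show "\<exists>u\<in>A. \<forall>a\<in>C. R a u"
    proof (cases "C = {}")
      case True
      then show ?thesis using cut[OF p] by auto
    next
      case False
      then obtain c where c: "c \<in> C" by auto
      let ?P = "\<lambda>x. INF p\<in>C. p x"
      have le: "?P x \<le> a x" if "a \<in> C" "x \<in> W" for a x
        using that lb CA by (intro cINF_lower bdd_belowI2[of _ "- p (- x)"]) auto
      have "sublinear_on W ?P"
        by (rule sublinear_Inf_chain[OF W False, where b = "\<lambda>x. - p (- x)"])
          (use CA lb ch in \<open>auto simp: A_def R_def subset_iff\<close>)
      moreover have "?P x \<le> p x" if "x \<in> W" for x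
      proof -
        have "c x \<le> p x" using c CA that by (auto simp: A_def)
        with le[OF c that] show ?thesis by (rule order_trans)
      qed
      ultimately have "(\<lambda>x. if x \<in> W then ?P x else 0) \<in> A" by (rule cut)
      moreover have "\<forall>a\<in>C. R a (\<lambda>x. if x \<in> W then ?P x else 0)"
        unfolding R_def using le by simp
      ultimately show ?thesis by blast
    qed
  qed
  then obtain g where g: "g \<in> A" and min: "\<And>a. a \<in> A \<Longrightarrow> R g a \<Longrightarrow> a = g" by blast
  have gs: "sublinear_on W g" using g by (simp add: A_def)
  have odd: "g (- y) = - g y" if y: "y \<in> W" for y
  proof -
    \<comment> \<open>Lowering g along the ray through y gives some q \<le> g with q (- y) \<le> - g
      y. By minimality q = g, which is the nontrivial half of oddness.\<close>
    let ?G = "{(t *\<^sub>R y, t * g y) | t. t \<ge> 0}"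
    obtain q where q: "sublinear_on W q" "\<And>x. x \<in> W \<Longrightarrow> q x \<le> g x"
      "\<And>w r. (w, r) \<in> ?G \<Longrightarrow> q (- w) \<le> - r"
    proof (rule sublinear_lower[OF gs W, where G = ?G])
      fix w r assume "(w, r) \<in> ?G"
      then obtain t where "w = t *\<^sub>R y" "r = t * g y" "t \<ge> 0" by auto
      then show "w \<in> W \<and> r \<le> g w"
        using y W gs sublinear_on_0[OF gs W]
        by (cases "t = 0") (auto simp: subspace_scale sublinear_on_def subspace_0)
    next
      fix v r w s assume "(v, r) \<in> ?G" "(w, s) \<in> ?G"
      then obtain a b where "v = a *\<^sub>R y" "r = a * g y" "a \<ge> 0" "w = b *\<^sub>R y" "s = b * g y" "b \<ge> 0"
        by auto
      then show "(v + w, r + s) \<in> ?G" 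
        by (auto intro!: exI[of _ "a + b"] simp: algebra_simps)
    next
      fix w r and t :: real assume "(w, r) \<in> ?G" "t > 0"
      then obtain a where "w = a *\<^sub>R y" "r = a * g y" "a \<ge> 0" by auto
      with \<open>t > 0\<close> show "(t *\<^sub>R w, t * r) \<in> ?G"
        by (auto intro!: exI[of _ "t * a"])
    qed (auto intro: exI[of _ 0])
    have "(y, g y) \<in> ?G" by (auto intro!: exI[of _ 1])
    then have "q (- y) \<le> - g y" by (rule q(3))
    moreover have "(\<lambda>x. if x \<in> W then q x else 0) = g"
    proof (rule min)
      show "(\<lambda>x. if x \<in> W then q x else 0) \<in> A"
      proof (rule cut[OF q(1)])
        fix x assume "x \<in> W"
        then have "g x \<le> p x" using g by (simp add: A_def)
        with q(2)[OF \<open>x \<in> W\<close>] show "q x \<le> p x" by (rule order_trans)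
      qed
      show "R g (\<lambda>x. if x \<in> W then q x else 0)" using q(2) by (simp add: R_def)
    qed
    then have "q (- y) = g (- y)" using subspace_neg[OF W y] fun_cong[of _ _ "- y"] by fastforce
    moreover have "- g (- y) \<le> g y" by (rule sublinear_on_minus[OF gs W y])
    ultimately show ?thesis by simp
  qed
  \<comment> \<open>An odd sublinear functional is linear: subadditivity at -x and -y is
    superadditivity at x and y, and oddness extends homogeneity to negative factors.\<close>
  have "real_linear_on W g"
    unfolding real_linear_on_def
  proof (intro conjI ballI allI)
    fix x y assume x: "x \<in> W" and y: "y \<in> W"
    have "g (x + y) \<le> g x + g y" using gs x y unfolding sublinear_on_def by blast
    moreover have "g (- x + - y) \<le> g (- x) + g (- y)"
      using gs x y W unfolding sublinear_on_def by (meson subspace_neg)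
    moreover have "g (- x + - y) = - g (x + y)"
      using odd[of "x + y"] x y W by (simp add: subspace_add)
    ultimately show "g (x + y) = g x + g y" using odd[OF x] odd[OF y] by simp
  next
    fix x and t :: real assume x: "x \<in> W"
    consider "t = 0" | "t > 0" | "- t > 0" by linarith
    then show "g (t *\<^sub>R x) = t * g x"
    proof cases
      case 3
      then have "g ((- t) *\<^sub>R x) = (- t) * g x" using gs x unfolding sublinear_on_def by blast
      then show ?thesis using odd[of "t *\<^sub>R x"] x W by (simp add: subspace_scale)
    qed (use gs x sublinear_on_0[OF gs W] in \<open>auto simp: sublinear_on_def\<close>)
  qed
  then show thesis using that g by (auto simp: A_def)
qed

text \<open>Extension along a map T in place of an inclusion, so that a space of polynomials can be
  moved into a space of functions. Lowering p along the pairs (T v, l v) forces l v \<le> g (T v),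
  and -v gives equality.\<close>

lemma Hahn_Banach:
  fixes V :: "'u::real_vector set" and T :: "'u \<Rightarrow> 'v::real_vector"
  assumes p: "sublinear_on W p" and W: "subspace W" and V: "subspace V"
    and T: "\<And>v. v \<in> V \<Longrightarrow> T v \<in> W" "\<And>u v. u \<in> V \<Longrightarrow> v \<in> V \<Longrightarrow> T (u + v) = T u + T v"
      "\<And>v t. v \<in> V \<Longrightarrow> T (t *\<^sub>R v) = t *\<^sub>R T v"
    and l: "real_linear_on V l" and le: "\<And>v. v \<in> V \<Longrightarrow> l v \<le> p (T v)"
  obtains g where "real_linear_on W g" "\<And>x. x \<in> W \<Longrightarrow> g x \<le> p x"
    "\<And>v. v \<in> V \<Longrightarrow> g (T v) = l v"
proof -
  let ?G = "{(T v, l v) | v. v \<in> V}"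
  have T0: "T 0 = 0" "l 0 = 0"
    using T(3)[of 0 0] l subspace_0[OF V] unfolding real_linear_on_def
    by auto (metis mult_zero_left scaleR_zero_left)
  obtain q where q: "sublinear_on W q" "\<And>x. x \<in> W \<Longrightarrow> q x \<le> p x"
      "\<And>w r. (w, r) \<in> ?G \<Longrightarrow> q (- w) \<le> - r"
  proof (rule sublinear_lower[OF p W, where G = ?G])
    show "(0, 0) \<in> ?G" using T0 subspace_0[OF V] by force
  next
    fix v r w s assume "(v, r) \<in> ?G" "(w, s) \<in> ?G"
    then obtain a b where "v = T a" "r = l a" "a \<in> V" "w = T b" "s = l b" "b \<in> V" by auto
    then show "(v + w, r + s) \<in> ?G"
      using T(2) l V by (auto simp: real_linear_on_def subspace_add intro!: exI[of _ "a + b"])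
  next
    fix w r and t :: real assume "(w, r) \<in> ?G"
    then obtain a where "w = T a" "r = l a" "a \<in> V" by auto
    then show "(t *\<^sub>R w, t * r) \<in> ?G"
      using T(3) l V by (auto simp: real_linear_on_def subspace_scale intro!: exI[of _ "t *\<^sub>R a"])
  qed (use T(1) le in auto)
  obtain g where g: "real_linear_on W g" "\<And>x. x \<in> W \<Longrightarrow> g x \<le> q x"
    using linear_below_sublinear[OF q(1) W] by blast
  have ge: "l v \<le> g (T v)" if "v \<in> V" for v
  proof -
    have "g ((-1) *\<^sub>R T v) = (-1) * g (T v)" using g(1) T(1)[OF that] unfolding real_linear_on_def by blast
    moreover have "g (- T v) \<le> q (- T v)" using T(1)[OF that] W by (intro g(2)) (simp add: subspace_neg)
    moreover have "q (- T v) \<le> - l v" using that by (intro q(3)) auto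
    ultimately show ?thesis by simp
  qed
  have "g (T v) = l v" if v: "v \<in> V" for v
  proof (rule antisym)
    have "g ((-1) *\<^sub>R T v) = (-1) * g (T v)" "l ((-1) *\<^sub>R v) = (-1) * l v"
      using g(1) T(1)[OF v] l v unfolding real_linear_on_def by blast+
    moreover have "l ((-1) *\<^sub>R v) \<le> g (T ((-1) *\<^sub>R v))"
      using v V by (intro ge) (simp add: subspace_neg)
    moreover have "T ((-1) *\<^sub>R v) = (-1) *\<^sub>R T v" using T(3)[OF v] by blast
    ultimately show "g (T v) \<le> l v" by simp
  qed (rule ge[OF v])
  then show thesis using that g q by (meson order_trans)
qed

section \<open>Means\<close>

definition bounded_funs :: "'i set \<Rightarrow> ('i \<Rightarrow> real) set"
  where "bounded_funs S = {h. \<exists>C. \<forall>i\<in>S. \<bar>h i\<bar> \<le> C}"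

lemma bounded_funsI: "(\<And>i. i \<in> S \<Longrightarrow> \<bar>h i\<bar> \<le> C) \<Longrightarrow> h \<in> bounded_funs S"
  by (auto simp: bounded_funs_def)

lemma subspace_bounded_funs: "subspace (bounded_funs S)"
proof (unfold subspace_def, intro conjI ballI allI)
  show "0 \<in> bounded_funs S" by (auto simp: bounded_funs_def intro: exI[of _ 0])
next
  fix f g assume "f \<in> bounded_funs S" "g \<in> bounded_funs S"
  then obtain C D where "\<forall>i\<in>S. \<bar>f i\<bar> \<le> C" "\<forall>i\<in>S. \<bar>g i\<bar> \<le> D" by (auto simp: bounded_funs_def)
  then show "f + g \<in> bounded_funs S"
    by (intro bounded_funsI[of _ _ "C + D"]) (fastforce simp: plus_fun_def)
next
  fix f and c :: real assume "f \<in> bounded_funs S"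
  then obtain C where "\<forall>i\<in>S. \<bar>f i\<bar> \<le> C" by (auto simp: bounded_funs_def)
  then show "c *\<^sub>R f \<in> bounded_funs S"
    by (intro bounded_funsI[of _ _ "\<bar>c\<bar> * C"]) (auto simp: scaleR_fun_def abs_mult mult_left_mono)
qed

text \<open>A finitely additive probability on S, seen as a functional. The single inequality,
  applied also to negatives, makes M positive, normalised and dependent only on the values on
  S.\<close>

definition is_mean :: "'i set \<Rightarrow> (('i \<Rightarrow> real) \<Rightarrow> real) \<Rightarrow> bool"
  where "is_mean S M \<longleftrightarrow> real_linear_on (bounded_funs S) M
    \<and> (\<forall>h\<in>bounded_funs S. \<forall>c. (\<forall>i\<in>S. h i \<le> c) \<longrightarrow> M h \<le> c)"

text \<open>Hahn--Banach with the supremum over S as the sublinear functional; the last hypothesis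
  is domination by that supremum.\<close>

lemma mean_extension:
  fixes V :: "'u::real_vector set" and T :: "'u \<Rightarrow> 'i \<Rightarrow> real"
  assumes S: "S \<noteq> {}" and V: "subspace V"
    and T: "\<And>v. v \<in> V \<Longrightarrow> T v \<in> bounded_funs S"
      "\<And>u v. u \<in> V \<Longrightarrow> v \<in> V \<Longrightarrow> T (u + v) = T u + T v"
      "\<And>v t. v \<in> V \<Longrightarrow> T (t *\<^sub>R v) = t *\<^sub>R T v"
    and l: "real_linear_on V l"
    and le: "\<And>v c. v \<in> V \<Longrightarrow> (\<And>i. i \<in> S \<Longrightarrow> T v i \<le> c) \<Longrightarrow> l v \<le> c"
  obtains M where "is_mean S M" "\<And>v. v \<in> V \<Longrightarrow> M (T v) = l v"
proof -
  define p where "p h = (SUP i\<in>S. h i)" for h :: "'i \<Rightarrow> real"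
  have bdd: "bdd_above (h ` S)" if "h \<in> bounded_funs S" for h
  proof -
    from that obtain C where "\<forall>i\<in>S. \<bar>h i\<bar> \<le> C" by (auto simp: bounded_funs_def)
    then show ?thesis by (intro bdd_aboveI2[of _ _ C]) (auto dest!: bspec)
  qed
  have ub: "h i \<le> p h" if "h \<in> bounded_funs S" "i \<in> S" for h i
    unfolding p_def using that by (intro cSUP_upper bdd)
  have lub: "p h \<le> c" if "\<And>i. i \<in> S \<Longrightarrow> h i \<le> c" for h c
    unfolding p_def using that S by (intro cSUP_least)
  have p: "sublinear_on (bounded_funs S) p"
  proof (rule sublinear_onI[OF _ _ subspace_bounded_funs])
    fix f g assume fg: "f \<in> bounded_funs S" "g \<in> bounded_funs S"
    show "p (f + g) \<le> p f + p g"
      by (rule lub) (use ub[OF fg(1)] ub[OF fg(2)] in \<open>force simp: plus_fun_def intro: add_mono\<close>)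
  next
    fix f and t :: real assume f: "f \<in> bounded_funs S" "t > 0"
    show "p (t *\<^sub>R f) \<le> t * p f"
      by (rule lub) (use ub[OF f(1)] f(2) in \<open>auto simp: scaleR_fun_def\<close>)
  qed
  obtain g where g: "real_linear_on (bounded_funs S) g" "\<And>x. x \<in> bounded_funs S \<Longrightarrow> g x \<le> p x"
    "\<And>v. v \<in> V \<Longrightarrow> g (T v) = l v"
  proof (rule Hahn_Banach[OF p subspace_bounded_funs V T l])
    show "l v \<le> p (T v)" if "v \<in> V" for v
      using that T(1) by (intro le[OF that] ub) auto
  qed auto
  have "is_mean S g" unfolding is_mean_def using g(1,2) lub by (meson order_trans)
  then show thesis using g(3) by (rule that)
qed

lemma bounded_funs_add: 
  "f \<in> bounded_funs S \<Longrightarrow> g \<in> bounded_funs S \<Longrightarrow> (\<lambda>i. f i + g i) \<in> bounded_funs S"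
  using subspace_add[OF subspace_bounded_funs, of f S g] by (simp add: plus_fun_def)

lemma bounded_funs_scale: "f \<in> bounded_funs S \<Longrightarrow> (\<lambda>i. t * f i) \<in> bounded_funs S"
  using subspace_scale[OF subspace_bounded_funs, of f S t] by (simp add: scaleR_fun_def)

lemma bounded_funs_diff: 
  "f \<in> bounded_funs S \<Longrightarrow> g \<in> bounded_funs S \<Longrightarrow> (\<lambda>i. f i - g i) \<in> bounded_funs S"
  using bounded_funs_add[of f S "\<lambda>i. -1 * g i"] bounded_funs_scale[of g S "-1"] by simp

lemma bounded_funs_const: "(\<lambda>i. c) \<in> bounded_funs S"
  by (rule bounded_funsI[of _ _ "\<bar>c\<bar>"]) simp

lemma bounded_funs_restrict: 
  "f \<in> bounded_funs S \<Longrightarrow> (\<lambda>i. indicator A i * f i) \<in> bounded_funs S"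
  unfolding bounded_funs_def by (force simp: indicator_def)

lemma bounded_funs_indicator: "indicator A \<in> bounded_funs S"
  by (rule bounded_funsI[of _ _ 1]) (simp add: indicator_def)

context
  fixes S :: "'i set" and M :: "('i \<Rightarrow> real) \<Rightarrow> real"
  assumes M: "is_mean S M"
begin

lemma mean_add: "f \<in> bounded_funs S \<Longrightarrow> g \<in> bounded_funs S \<Longrightarrow> M (\<lambda>i. f i + g i) = M f + M g"
  using M unfolding is_mean_def real_linear_on_def plus_fun_def by blast

lemma mean_scale: "f \<in> bounded_funs S \<Longrightarrow> M (\<lambda>i. t * f i) = t * M f"
  using M unfolding is_mean_def real_linear_on_def scaleR_fun_def by simp

lemma mean_le: "f \<in> bounded_funs S \<Longrightarrow> (\<And>i. i \<in> S \<Longrightarrow> f i \<le> c) \<Longrightarrow> M f \<le> c"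
  using M unfolding is_mean_def by blast

lemma mean_diff:
  "f \<in> bounded_funs S \<Longrightarrow> g \<in> bounded_funs S \<Longrightarrow> M (\<lambda>i. f i - g i) = M f - M g"
  using mean_add[of f "\<lambda>i. -1 * g i"] mean_scale[of g "-1"] bounded_funs_scale[of g S "-1"] by simp

lemma mean_mono:
  assumes "f \<in> bounded_funs S" "g \<in> bounded_funs S" "\<And>i. i \<in> S \<Longrightarrow> f i \<le> g i"
  shows "M f \<le> M g"
proof -
  have "M (\<lambda>i. f i - g i) \<le> 0" using assms by (intro mean_le bounded_funs_diff) auto
  then show ?thesis using assms mean_diff by simp
qed

lemma mean_const: "M (\<lambda>i. c) = c"
proof -
  have "M (\<lambda>i. c) \<le> c" by (intro mean_le bounded_funs_const) auto
  moreover have "M (\<lambda>i. -1 * c) \<le> -1 * c" by (intro mean_le bounded_funs_const) auto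
  moreover have "M (\<lambda>i. -1 * c) = -1 * M (\<lambda>i. c)" by (intro mean_scale bounded_funs_const)
  ultimately show ?thesis by simp
qed

lemma mean_sum:
  assumes "finite K" "\<And>k. k \<in> K \<Longrightarrow> f k \<in> bounded_funs S"
  shows "(\<lambda>i. \<Sum>k\<in>K. f k i) \<in> bounded_funs S \<and> M (\<lambda>i. \<Sum>k\<in>K. f k i) = (\<Sum>k\<in>K. M (f k))"
  using assms
  by (induction K) (auto simp: bounded_funs_const mean_const mean_add bounded_funs_add)

end

section \<open>Duals of normed spaces on a carrier\<close>

text \<open>E, F, their duals and biduals, and the polynomial spaces are all instances, so operator
  norms are treated once. The scalar laws range over the whole type because the operations are
  pointwise or those of E and F.\<close>

locale nspace =
  fixes X :: "('k::real_or_complex, 'v::real_vector) normed_sp"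
  assumes zero_mem: "0 \<in> carr X"
    and add_mem: "u \<in> carr X \<Longrightarrow> v \<in> carr X \<Longrightarrow> u + v \<in> carr X"
    and smul_mem: "v \<in> carr X \<Longrightarrow> smul X c v \<in> carr X"
    and smul_add: "smul X c (u + v) = smul X c u + smul X c v"
    and add_smul: "smul X (a + b) v = smul X a v + smul X b v"
    and smul_smul: "smul X a (smul X b v) = smul X (a * b) v"
    and smul_of_real: "smul X (of_real r) v = r *\<^sub>R v"
    and nrm_smul: "v \<in> carr X \<Longrightarrow> nrm X (smul X c v) = norm c * nrm X v"
    and nrm_nonneg: "v \<in> carr X \<Longrightarrow> 0 \<le> nrm X v"
begin

lemma scaleR_mem: "v \<in> carr X \<Longrightarrow> r *\<^sub>R v \<in> carr X"
  using smul_mem[of v "of_real r"] by (simp add: smul_of_real)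

lemma subspace_carr: "subspace (carr X)"
  by (simp add: subspace_def zero_mem add_mem scaleR_mem)

lemma nrm_scaleR: "v \<in> carr X \<Longrightarrow> nrm X (r *\<^sub>R v) = \<bar>r\<bar> * nrm X v"
  using nrm_smul[of v "of_real r"] by (simp add: smul_of_real)

lemma nrm_0: "nrm X 0 = 0"
  using nrm_scaleR[OF zero_mem, of 0] by simp

lemma zero_unit_ball: "0 \<in> unit_ball X"
  by (simp add: unit_ball_def zero_mem nrm_0)

lemma diff_mem: "u \<in> carr X \<Longrightarrow> v \<in> carr X \<Longrightarrow> u - v \<in> carr X"
  by (rule subspace_diff[OF subspace_carr])

lemma sum_mem: "(\<And>i. i \<in> I \<Longrightarrow> f i \<in> carr X) \<Longrightarrow> (\<Sum>i\<in>I. f i) \<in> carr X"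
  by (rule subspace_sum[OF subspace_carr])

lemma dual_memI:
  assumes "\<And>u v. u \<in> carr X \<Longrightarrow> v \<in> carr X \<Longrightarrow> \<phi> (u + v) = \<phi> u + \<phi> v"
    and "\<And>c v. v \<in> carr X \<Longrightarrow> \<phi> (smul X c v) = c * \<phi> v"
    and "\<And>v. v \<in> carr X \<Longrightarrow> norm (\<phi> v) \<le> C * nrm X v"
    and "\<And>v. v \<notin> carr X \<Longrightarrow> \<phi> v = 0"
  shows "\<phi> \<in> carr (dual X)"
  using assms unfolding dual_def by (simp, blast)

lemma dual_add: "\<phi> \<in> carr (dual X) \<Longrightarrow> u \<in> carr X \<Longrightarrow> v \<in> carr X \<Longrightarrow> \<phi> (u + v) = \<phi> u + \<phi> v"
  by (simp add: dual_def)

lemma dual_smul: "\<phi> \<in> carr (dual X) \<Longrightarrow> v \<in> carr X \<Longrightarrow> \<phi> (smul X c v) = c * \<phi> v"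
  by (simp add: dual_def)

lemma dual_outside: "\<phi> \<in> carr (dual X) \<Longrightarrow> v \<notin> carr X \<Longrightarrow> \<phi> v = 0"
  by (simp add: dual_def)

lemma dual_scaleR: "\<phi> \<in> carr (dual X) \<Longrightarrow> v \<in> carr X \<Longrightarrow> \<phi> (r *\<^sub>R v) = r *\<^sub>R \<phi> v"
  using dual_smul[of \<phi> v "of_real r"] by (simp add: smul_of_real scaleR_conv_of_real)

lemma dual_0: "\<phi> \<in> carr (dual X) \<Longrightarrow> \<phi> 0 = 0"
  using dual_scaleR[OF _ zero_mem, of \<phi> 0] by simp

lemma dual_diff:
  assumes "\<phi> \<in> carr (dual X)" "u \<in> carr X" "v \<in> carr X" shows "\<phi> (u - v) = \<phi> u - \<phi> v"
  using dual_add[OF assms(1) diff_mem[OF assms(2,3)] assms(3)] by (simp add: eq_diff_eq)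

lemma dual_sum:
  assumes "\<phi> \<in> carr (dual X)" "\<And>i. i \<in> I \<Longrightarrow> f i \<in> carr X"
  shows "\<phi> (\<Sum>i\<in>I. f i) = (\<Sum>i\<in>I. \<phi> (f i))"
  using assms(2)
  by (induction I rule: infinite_finite_induct)
    (auto simp: dual_0[OF assms(1)] dual_add[OF assms(1)] sum_mem)

lemma dual_bdd_above: 
  assumes "\<phi> \<in> carr (dual X)" shows "bdd_above ((\<lambda>v. norm (\<phi> v)) ` unit_ball X)"
proof -
  obtain C where C: "\<And>v. v \<in> carr X \<Longrightarrow> norm (\<phi> v) \<le> C * nrm X v"
    using assms unfolding dual_def by (simp, blast)
  have "norm (\<phi> v) \<le> \<bar>C\<bar>" if "v \<in> unit_ball X" for v
  proof -
    have v: "v \<in> carr X" "nrm X v \<le> 1" using that by (auto simp: unit_ball_def)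
    have "C * nrm X v \<le> \<bar>C\<bar> * 1"
      using v nrm_nonneg[of v] by (intro mult_mono) auto
    then show ?thesis using C[OF v(1)] by simp
  qed
  then show ?thesis by (rule bdd_aboveI2)
qed

lemma nrm_dual: "nrm (dual X) \<phi> = (SUP v\<in>unit_ball X. norm (\<phi> v))"
  by (simp add: dual_def)

lemma nrm_dual_nonneg: "\<phi> \<in> carr (dual X) \<Longrightarrow> 0 \<le> nrm (dual X) \<phi>"
  unfolding nrm_dual
  by (rule cSUP_upper2[OF dual_bdd_above zero_unit_ball]) auto

lemma dual_bound:
  assumes \<phi>: "\<phi> \<in> carr (dual X)" and v: "v \<in> carr X"
  shows "norm (\<phi> v) \<le> nrm (dual X) \<phi> * nrm X v"
proof (cases "nrm X v = 0")
  case True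
  obtain C where "norm (\<phi> v) \<le> C * nrm X v" using \<phi> v by (auto simp: dual_def)
  with True show ?thesis by simp
next
  case False
  then have pos: "nrm X v > 0" using nrm_nonneg[OF v] by simp
  let ?w = "(1 / nrm X v) *\<^sub>R v"
  have "?w \<in> unit_ball X" using v pos by (simp add: unit_ball_def scaleR_mem nrm_scaleR)
  then have "norm (\<phi> ?w) \<le> nrm (dual X) \<phi>"
    unfolding nrm_dual by (intro cSUP_upper dual_bdd_above \<phi>)
  then show ?thesis using pos by (simp add: dual_scaleR[OF \<phi> v] field_simps)
qed

lemma nrm_dual_le:
  assumes "\<And>v. v \<in> carr X \<Longrightarrow> norm (\<phi> v) \<le> C * nrm X v" "0 \<le> C"
  shows "nrm (dual X) \<phi> \<le> C"
  unfolding nrm_dual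
proof (rule cSUP_least)
  fix v assume "v \<in> unit_ball X"
  then have v: "v \<in> carr X" "nrm X v \<le> 1" by (auto simp: unit_ball_def)
  have "C * nrm X v \<le> C * 1" using v assms(2) by (intro mult_left_mono)
  then show "norm (\<phi> v) \<le> C" using assms(1)[OF v(1)] by simp
qed (use zero_unit_ball in auto)

lemma unit_ball_dual_bound:
  assumes "\<phi> \<in> unit_ball (dual X)" "v \<in> carr X" shows "norm (\<phi> v) \<le> nrm X v"
proof -
  have "norm (\<phi> v) \<le> nrm (dual X) \<phi> * nrm X v"
    using assms by (intro dual_bound) (auto simp: unit_ball_def)
  also have "\<dots> \<le> 1 * nrm X v"
    using assms nrm_nonneg by (intro mult_right_mono) (auto simp: unit_ball_def)
  finally show ?thesis by simp
qed

lemma unit_ball_dualI: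
  assumes "\<And>u v. u \<in> carr X \<Longrightarrow> v \<in> carr X \<Longrightarrow> \<phi> (u + v) = \<phi> u + \<phi> v"
    and "\<And>c v. v \<in> carr X \<Longrightarrow> \<phi> (smul X c v) = c * \<phi> v"
    and "\<And>v. v \<in> carr X \<Longrightarrow> norm (\<phi> v) \<le> nrm X v"
    and "\<And>v. v \<notin> carr X \<Longrightarrow> \<phi> v = 0"
  shows "\<phi> \<in> unit_ball (dual X)"
  unfolding unit_ball_def
proof (intro CollectI conjI)
  show "\<phi> \<in> carr (dual X)" by (rule dual_memI[where C = 1]) (use assms in auto)
  show "nrm (dual X) \<phi> \<le> 1" by (rule nrm_dual_le) (use assms in auto)
qed

text \<open>With this the dual construction can be applied again, and the bidual inherits every fact
  about duals.\<close>

lemma nspace_dual: "nspace (dual X)"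
proof
  fix \<phi> \<psi> :: "'v \<Rightarrow> 'k" and a b c :: 'k and r :: real
  show "0 \<in> carr (dual X)" by (rule dual_memI[where C = 0]) auto
  show "smul (dual X) c (\<phi> + \<psi>) = smul (dual X) c \<phi> + smul (dual X) c \<psi>"
    "smul (dual X) (a + b) \<phi> = smul (dual X) a \<phi> + smul (dual X) b \<phi>"
    "smul (dual X) a (smul (dual X) b \<phi>) = smul (dual X) (a * b) \<phi>"
    "smul (dual X) (of_real r) \<phi> = r *\<^sub>R \<phi>"
    by (auto simp: dual_def fun_eq_iff plus_fun_def scaleR_fun_def scaleR_conv_of_real algebra_simps)
  assume \<phi>: "\<phi> \<in> carr (dual X)"
  show "nrm (dual X) \<phi> \<ge> 0" by (rule nrm_dual_nonneg[OF \<phi>])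
  show mem: "smul (dual X) c \<phi> \<in> carr (dual X)" for c
  proof (rule dual_memI[where C = "norm c * nrm (dual X) \<phi>"])
    fix v assume v: "v \<in> carr X"
    show "norm (smul (dual X) c \<phi> v) \<le> norm c * nrm (dual X) \<phi> * nrm X v"
      using dual_bound[OF \<phi> v] by (simp add: dual_def norm_mult mult_left_mono mult.assoc)
  qed (auto simp: dual_def[of X] dual_add[OF \<phi>] dual_smul[OF \<phi>] dual_outside[OF \<phi>] algebra_simps)
  have sm: "smul (dual X) c \<phi> = (\<lambda>v. c * \<phi> v)" for c by (simp add: dual_def)
  have le: "nrm (dual X) (\<lambda>v. c * \<phi> v) \<le> norm c * nrm (dual X) \<phi>" for c
    by (rule nrm_dual_le)
      (use dual_bound[OF \<phi>] nrm_dual_nonneg[OF \<phi>] in \<open>auto simp: norm_mult mult_left_mono mult.assoc\<close>)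
  show "nrm (dual X) (smul (dual X) c \<phi>) = norm c * nrm (dual X) \<phi>"
  proof (cases "c = 0")
    case True
    then show ?thesis using le[of 0] nrm_dual_nonneg[OF mem[of 0]] by (simp add: sm)
  next
    case False
    have "nrm (dual X) \<phi> \<le> (1 / norm c) * nrm (dual X) (\<lambda>v. c * \<phi> v)"
    proof (rule nrm_dual_le)
      fix v assume v: "v \<in> carr X"
      have "norm (c * \<phi> v) \<le> nrm (dual X) (\<lambda>v. c * \<phi> v) * nrm X v"
        using dual_bound[OF mem[of c] v] by (simp add: sm)
      then show "norm (\<phi> v) \<le> (1 / norm c) * nrm (dual X) (\<lambda>v. c * \<phi> v) * nrm X v"
        using False by (simp add: norm_mult field_simps)
    qed (use nrm_dual_nonneg[OF mem[of c]] in \<open>simp add: sm\<close>)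
    then show ?thesis using le[of c] False by (simp add: sm field_simps)
  qed
  assume \<psi>: "\<psi> \<in> carr (dual X)"
  show "\<phi> + \<psi> \<in> carr (dual X)"
  proof (rule dual_memI[where C = "nrm (dual X) \<phi> + nrm (dual X) \<psi>"])
    fix v assume v: "v \<in> carr X"
    show "norm ((\<phi> + \<psi>) v) \<le> (nrm (dual X) \<phi> + nrm (dual X) \<psi>) * nrm X v"
      using norm_triangle_ineq[of "\<phi> v" "\<psi> v"] dual_bound[OF \<phi> v] dual_bound[OF \<psi> v]
      by (simp add: algebra_simps)
  qed (auto simp: dual_add[OF \<phi>] dual_smul[OF \<phi>] dual_outside[OF \<phi>] dual_add[OF \<psi>]
      dual_smul[OF \<psi>] dual_outside[OF \<psi>] algebra_simps)
qed

text \<open>The Bohnenblust--Sobczyk formula \<open>\<psi> v = g v - \<i> g (\<i> v)\<close>.\<close>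

lemma scalar_extension:
  assumes g: "real_linear_on (carr X) g" and le: "\<And>v. v \<in> carr X \<Longrightarrow> g v \<le> nrm X v"
  obtains \<psi> where "\<psi> \<in> unit_ball (dual X)" "\<And>v. v \<in> carr X \<Longrightarrow> re (\<psi> v) = g v"
proof
  define \<psi> :: "'v \<Rightarrow> 'k" where "\<psi> v = (if v \<in> carr X then of_real (g v) - imu * of_real (g (smul X imu v)) else 0)"
    for v :: 'v
  have gadd: "g (u + v) = g u + g v" if "u \<in> carr X" "v \<in> carr X" for u v
    using g that unfolding real_linear_on_def by blast
  have gsc: "g (smul X (of_real t) v) = t * g v" if "v \<in> carr X" for v t
    using g that unfolding real_linear_on_def by (simp add: smul_of_real)
  show re: "re (\<psi> v) = g v" if "v \<in> carr X" for v
    using that by (simp add: \<psi>_def re_diff re_imu_of_real)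
  have add: "\<psi> (u + v) = \<psi> u + \<psi> v" if "u \<in> carr X" "v \<in> carr X" for u v
    using that by (simp add: \<psi>_def gadd smul_add smul_mem add_mem algebra_simps)
  have sr: "\<psi> (smul X (of_real t) v) = of_real t * \<psi> v" if "v \<in> carr X" for t v
  proof -
    have "smul X imu (smul X (of_real t) v) = smul X (of_real t) (smul X imu v)"
      by (simp add: smul_smul mult.commute)
    then show ?thesis
      using that by (simp add: \<psi>_def gsc smul_mem right_diff_distrib mult.left_commute)
  qed
  \<comment> \<open>For real scalars \<open>imu = 0\<close> and the claim reduces to g being 0 at
    the origin; for complex scalars it is the usual computation with
    \<open>imu * imu = - 1\<close>.\<close>
  have smimu: "\<psi> (smul X imu v) = imu * \<psi> v" if v: "v \<in> carr X" for v
  proof -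
    consider "imu = (0::'k)" | "imu * imu = (-1::'k)" using imu_square by blast
    then show ?thesis
    proof cases
      case 1
      then show ?thesis using gsc[OF v, of 0] v smul_mem[OF v, of 0] by (auto simp: \<psi>_def)
    next
      case 2
      have "smul X imu (smul X imu v) = smul X (of_real (-1)) v" by (simp add: smul_smul 2)
      then have "\<psi> (smul X imu v) = of_real (g (smul X imu v)) + imu * of_real (g v)"
        using v gsc[OF v, of "-1"] by (simp add: \<psi>_def smul_mem)
      also have "of_real (g (smul X imu v)) = - ((imu * imu) * of_real (g (smul X imu v)) :: 'k)"
        by (simp add: 2)
      finally show ?thesis using v by (simp add: \<psi>_def algebra_simps)
    qed
  qed
  have smul: "\<psi> (smul X c v) = c * \<psi> v" if v: "v \<in> carr X" for c v
  proof -
    let ?b = "- re (imu * c)"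
    have c: "c = of_real (re c) + of_real ?b * imu" using scalar_eq[of c] by (simp add: mult.commute)
    have "smul X c v = smul X (of_real (re c)) v + smul X (of_real ?b) (smul X imu v)"
      by (subst c) (simp only: add_smul smul_smul)
    then have "\<psi> (smul X c v) = of_real (re c) * \<psi> v + of_real ?b * (imu * \<psi> v)"
      using v by (simp only: add sr smimu smul_mem)
    also have "\<dots> = (of_real (re c) + of_real ?b * imu) * \<psi> v" by (simp only: algebra_simps)
    finally show ?thesis using c by simp
  qed
  show "\<psi> \<in> unit_ball (dual X)"
  proof (rule unit_ball_dualI[OF add smul])
    fix v assume v: "v \<in> carr X"
    \<comment> \<open>Rotating v by u makes the value real and nonnegative, and there the bound on g
      applies.\<close>
    obtain u where u: "norm u = 1" "u * \<psi> v = of_real (norm (\<psi> v))" by (rule rotate_to_norm)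
    have "norm (\<psi> v) = re (u * \<psi> v)" by (simp add: u)
    also have "\<dots> = g (smul X u v)" using v by (simp add: smul[symmetric] re smul_mem)
    also have "\<dots> \<le> nrm X v" using le[OF smul_mem[OF v, of u]] nrm_smul[OF v, of u] by (simp add: u)
    finally show "norm (\<psi> v) \<le> nrm X v" .
  qed (auto simp: \<psi>_def)
qed

lemma re_dual_linear:
  assumes "\<phi> \<in> carr (dual X)" shows "real_linear_on (carr X) (\<lambda>v. re (\<phi> v))"
  using assms by (simp add: real_linear_on_def dual_add dual_scaleR re_add re_scaleR)

lemma re_bound_imp_norm_bound:
  assumes \<phi>: "\<phi> \<in> carr (dual X)" and le: "\<And>v. v \<in> carr X \<Longrightarrow> re (\<phi> v) \<le> C * nrm X v"
    and v: "v \<in> carr X"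
  shows "norm (\<phi> v) \<le> C * nrm X v"
proof -
  obtain u where u: "norm u = 1" "u * \<phi> v = of_real (norm (\<phi> v))" by (rule rotate_to_norm)
  have "norm (\<phi> v) = re (\<phi> (smul X u v))" using v \<phi> u by (simp add: dual_smul)
  also have "\<dots> \<le> C * nrm X (smul X u v)" by (intro le smul_mem v)
  finally show ?thesis using u v by (simp add: nrm_smul)
qed

section \<open>Extreme points and means\<close>

text \<open>As S is norming, re (\<phi> v) \<le> nrm X v is dominated by the supremum of re (ev i v)
  over S, which is what \<open>mean_extension\<close> requires. The mean plays the part of a
  representing measure on S.\<close>

lemma functional_mean:
  assumes S: "S \<noteq> {}"
    and ev: "\<And>i. i \<in> S \<Longrightarrow> ev i \<in> unit_ball (dual X)"
    and norming: "\<And>v c. v \<in> carr X \<Longrightarrow> (\<And>i. i \<in> S \<Longrightarrow> re (ev i v) \<le> c) \<Longrightarrow> nrm X v \<le> c"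
    and \<phi>: "\<phi> \<in> unit_ball (dual X)"
  obtains M where "is_mean S M" "\<And>v. v \<in> carr X \<Longrightarrow> (\<lambda>i. re (ev i v)) \<in> bounded_funs S"
    "\<And>v. v \<in> carr X \<Longrightarrow> M (\<lambda>i. re (ev i v)) = re (\<phi> v)"
proof -
  \<comment> \<open>set to \<open>0\<close> off \<open>S\<close>, so that it depends linearly on \<open>v\<close> as a function\<close>
  define T where "T v = (\<lambda>i. if i \<in> S then re (ev i v) else 0)" for v
  have evd: "ev i \<in> carr (dual X)" if "i \<in> S" for i using ev[OF that] by (simp add: unit_ball_def)
  have \<phi>d: "\<phi> \<in> carr (dual X)" using \<phi> by (simp add: unit_ball_def)
  have b: "\<bar>re (ev i v)\<bar> \<le> nrm X v" if "i \<in> S" "v \<in> carr X" for i v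
    using abs_re_le unit_ball_dual_bound[OF ev that(2)] that(1) order_trans by blast
  obtain M where M: "is_mean S M" "\<And>v. v \<in> carr X \<Longrightarrow> M (T v) = re (\<phi> v)"
  proof (rule mean_extension[OF S subspace_carr _ _ _ re_dual_linear[OF \<phi>d], of T])
    fix v c assume v: "v \<in> carr X" "\<And>i. i \<in> S \<Longrightarrow> T v i \<le> c"
    have "re (\<phi> v) \<le> norm (\<phi> v)" by (rule re_le)
    also have "\<dots> \<le> nrm X v" by (rule unit_ball_dual_bound[OF \<phi> v(1)])
    also have "\<dots> \<le> c" using v by (intro norming) (auto simp: T_def)
    finally show "re (\<phi> v) \<le> c" .
  next
    show "T v \<in> bounded_funs S" if "v \<in> carr X" for v
      by (rule bounded_funsI[of _ _ "nrm X v"]) (use b that in \<open>auto simp: T_def\<close>)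
  qed (auto simp: T_def fun_eq_iff plus_fun_def scaleR_fun_def dual_add dual_scaleR evd re_add re_scaleR)
  have "(\<lambda>i. re (ev i v)) \<in> bounded_funs S \<and> M (\<lambda>i. re (ev i v)) = M (T v)" if v: "v \<in> carr X" for v
  proof
    show bf: "(\<lambda>i. re (ev i v)) \<in> bounded_funs S"
      by (rule bounded_funsI[of _ _ "nrm X v"]) (use b v in auto)
    have bT: "T v \<in> bounded_funs S"
      by (rule bounded_funsI[of _ _ "nrm X v"]) (use b v in \<open>auto simp: T_def\<close>)
    show "M (\<lambda>i. re (ev i v)) = M (T v)"
      by (rule antisym; rule mean_mono[OF M(1)]) (use bf bT in \<open>auto simp: T_def\<close>)
  qed
  then show thesis using M by (intro that[of M]) auto
qed

lemma extreme_midpoint: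
  fixes \<phi> a b :: "'v \<Rightarrow> 'k"
  assumes "\<phi> extreme_point_of unit_ball (dual X)" "a \<in> unit_ball (dual X)" "b \<in> unit_ball (dual X)"
    and "0 < t" "t < 1" "\<And>v. \<phi> v = (1 - t) *\<^sub>R a v + t *\<^sub>R b v"
  shows "a = b"
proof (rule ccontr)
  assume "a \<noteq> b"
  then have "\<phi> \<in> open_segment a b"
    using assms(4-6) unfolding in_segment
    by (intro conjI exI[of _ t]) (auto simp: fun_eq_iff plus_fun_def scaleR_fun_def)
  then show False using assms(1-3) unfolding extreme_point_of_def by blast
qed

text \<open>The restriction of the mean to a set of positive mass, renormalised, represents a functional
  in the unit ball; extremality forces it to be \<open>\<phi>\<close> itself. Hence a set on which some
  \<open>re \<circ> ev i\<close> stays away from \<open>re \<circ> \<phi>\<close> is a null set, and finitely many null sets do not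
  cover \<open>S\<close>.\<close>

lemma extreme_point_approx:
  assumes S: "S \<noteq> {}"
    and ev: "\<And>i. i \<in> S \<Longrightarrow> ev i \<in> unit_ball (dual X)"
    and norming: "\<And>v c. v \<in> carr X \<Longrightarrow> (\<And>i. i \<in> S \<Longrightarrow> re (ev i v) \<le> c) \<Longrightarrow> nrm X v \<le> c"
    and ext: "\<phi> extreme_point_of unit_ball (dual X)"
    and Q: "finite Q" "Q \<subseteq> carr X" and e: "e > 0"
  shows "\<exists>i\<in>S. \<forall>v\<in>Q. norm (ev i v - \<phi> v) < e"
proof -
  have \<phi>: "\<phi> \<in> unit_ball (dual X)" using ext by (simp add: extreme_point_of_def)
  then have \<phi>d: "\<phi> \<in> carr (dual X)" by (simp add: unit_ball_def)
  have evd: "ev i \<in> carr (dual X)" if "i \<in> S" for i using ev[OF that] by (simp add: unit_ball_def)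
  obtain M where M: "is_mean S M" and bf: "\<And>v. v \<in> carr X \<Longrightarrow> (\<lambda>i. re (ev i v)) \<in> bounded_funs S"
    and Mre: "\<And>v. v \<in> carr X \<Longrightarrow> M (\<lambda>i. re (ev i v)) = re (\<phi> v)"
  proof (rule functional_mean[where S = S and ev = ev and \<phi> = \<phi>])
    show "nrm X v \<le> c" if "v \<in> carr X" "\<And>i. i \<in> S \<Longrightarrow> re (ev i v) \<le> c" for v c
      using that by (rule norming)
  qed (use S \<phi> ev that in auto)
  note bi = bounded_funs_indicator[of _ S]
  note br = bounded_funs_restrict[OF bf]
  have b: "re (ev i v) \<le> nrm X v" if "i \<in> S" "v \<in> carr X" for i v
    using re_le unit_ball_dual_bound[OF ev that(2)] that(1) order_trans by blast
  \<comment> \<open>Positive mass allows renormalisation; the bound by the norm comes from re (ev i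
    v) \<le> nrm X v on S.\<close>
  have local: "\<exists>\<psi>\<in>unit_ball (dual X). \<forall>v\<in>carr X. re (\<psi> v) = M (\<lambda>i. indicator A i * re (ev i v)) / M (indicator A)"
    if pos: "M (indicator A) > 0" for A
  proof -
    let ?g = "\<lambda>v. M (\<lambda>i. indicator A i * re (ev i v)) / M (indicator A)"
    have eq: "M f = M g" if "f \<in> bounded_funs S" "g \<in> bounded_funs S" "\<And>i. i \<in> S \<Longrightarrow> f i = g i" for f g
      using mean_mono[OF M, of f g] mean_mono[OF M, of g f] that by (auto intro: antisym)
    have "real_linear_on (carr X) ?g"
      unfolding real_linear_on_def
    proof (intro conjI ballI allI)
      fix u v assume uv: "u \<in> carr X" "v \<in> carr X"
      have "M (\<lambda>i. indicator A i * re (ev i (u + v)))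
          = M (\<lambda>i. indicator A i * re (ev i u) + indicator A i * re (ev i v))"
        using uv by (intro eq br bounded_funs_add add_mem)
          (auto simp: dual_add evd re_add algebra_simps)
      then show "?g (u + v) = ?g u + ?g v"
        using uv by (simp add: mean_add[OF M br br] add_divide_distrib)
    next
      fix v and t :: real assume v: "v \<in> carr X"
      have "M (\<lambda>i. indicator A i * re (ev i (t *\<^sub>R v))) = M (\<lambda>i. t * (indicator A i * re (ev i v)))"
        using v by (intro eq br bounded_funs_scale scaleR_mem)
          (auto simp: dual_scaleR evd re_scaleR algebra_simps)
      then show "?g (t *\<^sub>R v) = t * ?g v" using v by (simp add: mean_scale[OF M br])
    qed
    moreover have "?g v \<le> nrm X v" if v: "v \<in> carr X" for v
    proof -
      have "M (\<lambda>i. indicator A i * re (ev i v)) \<le> M (\<lambda>i. nrm X v * indicator A i)"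
        using v b by (intro mean_mono[OF M] br bounded_funs_scale bi) (auto simp: indicator_def)
      also have "\<dots> = nrm X v * M (indicator A)" by (rule mean_scale[OF M bi])
      finally show ?thesis using pos by (simp add: field_simps)
    qed
    ultimately obtain \<psi> where "\<psi> \<in> unit_ball (dual X)" "\<And>v. v \<in> carr X \<Longrightarrow> re (\<psi> v) = ?g v"
      using scalar_extension[of ?g] by blast
    then show ?thesis by auto
  qed
  have split: "M (\<lambda>i. indicator A i * h i) + M (\<lambda>i. indicator (- A) i * h i) = M h"
    if h: "h \<in> bounded_funs S" for A h
  proof -
    have "(\<lambda>i. indicator A i * h i + indicator (- A) i * h i) = h"
      by (auto simp: fun_eq_iff indicator_def)
    then show ?thesis
      using mean_add[OF M bounded_funs_restrict[OF h] bounded_funs_restrict[OF h], of A "- A"]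
      by simp
  qed
  have split1: "M (indicator A) + M (indicator (- A)) = 1" for A
    using split[OF bounded_funs_const[of 1], of A] mean_const[OF M, of 1] by simp
  have ipos: "M (indicator A) \<ge> 0" for A
    using mean_mono[OF M bounded_funs_const[of 0] bi, of A] mean_const[OF M, of 0] by simp
  have loc: "M (\<lambda>i. indicator A i * re (ev i v)) = M (indicator A) * re (\<phi> v)"
    if pos: "M (indicator A) > 0" and v: "v \<in> carr X" for A v
  proof (cases "M (indicator (- A)) = 0")
    \<comment> \<open>If the complement is null, A already carries the full mean. Extremality enters
      only in the other case.\<close>
    case True
    have "\<bar>M (\<lambda>i. indicator (- A) i * re (ev i v))\<bar> \<le> 0"
    proof -
      have b': "re (ev i v) \<le> nrm X v" "- nrm X v \<le> re (ev i v)" if "i \<in> S" for i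
        using order_trans[OF abs_re_le unit_ball_dual_bound[OF ev v], of i] that by auto
      have "M (\<lambda>i. indicator (- A) i * re (ev i v)) \<le> M (\<lambda>i. nrm X v * indicator (- A) i)"
        using v by (intro mean_mono[OF M] br bounded_funs_scale bi)
          (use b' in \<open>auto simp: indicator_def\<close>)
      moreover have "M (\<lambda>i. - nrm X v * indicator (- A) i) \<le> M (\<lambda>i. indicator (- A) i * re (ev i v))"
        using v by (intro mean_mono[OF M] br bounded_funs_scale bi)
          (use b' in \<open>auto simp: indicator_def\<close>)
      ultimately show ?thesis
        using True mean_scale[OF M bi, of "nrm X v" "- A"] mean_scale[OF M bi, of "- nrm X v" "- A"]
        by simp
    qed
    then show ?thesis using split[OF bf[OF v], of A] split1[of A] Mre[OF v] True by simp
  next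
    case False
    then have neg: "M (indicator (- A)) > 0" using ipos[of "- A"] by simp
    obtain a where a: "a \<in> unit_ball (dual X)"
      and rea: "\<And>v. v \<in> carr X \<Longrightarrow> re (a v) = M (\<lambda>i. indicator A i * re (ev i v)) / M (indicator A)"
      using local[OF pos] by blast
    obtain d where d: "d \<in> unit_ball (dual X)"
      and red: "\<And>v. v \<in> carr X \<Longrightarrow> re (d v) = M (\<lambda>i. indicator (- A) i * re (ev i v)) / M (indicator (- A))"
      using local[OF neg] by blast
    \<comment> \<open>Now \<phi> is the convex combination of the two local functionals, weighted by
      the masses 1 - t and t.\<close>
    define t where "t = M (indicator (- A))"
    have t: "0 < t" "t < 1" "M (indicator A) = 1 - t" using neg pos split1[of A] by (auto simp: t_def)
    have ad: "a \<in> carr (dual X)" "d \<in> carr (dual X)" using a d by (auto simp: unit_ball_def)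
    have re_eq: "re (\<phi> v) = re ((1 - t) *\<^sub>R a v + t *\<^sub>R d v)" if v: "v \<in> carr X" for v
      using split[OF bf[OF v], of A] t rea[OF v] red[OF v] Mre[OF v]
      by (simp add: re_add re_scaleR t_def[symmetric])
    have "\<phi> v = (1 - t) *\<^sub>R a v + t *\<^sub>R d v" for v
    proof (cases "v \<in> carr X")
      case True
      \<comment> \<open>The identity is known for real parts at every multiple of v; the multiples
        by 1 and imu determine the scalar.\<close>
      define x where "x = \<phi> v - ((1 - t) *\<^sub>R a v + t *\<^sub>R d v)"
      have "re (c * x) = 0" for c
      proof -
        have "re (c * x) = re (\<phi> (smul X c v) - ((1 - t) *\<^sub>R a (smul X c v) + t *\<^sub>R d (smul X c v)))"
          using True by (simp add: x_def dual_smul[OF \<phi>d] dual_smul[OF ad(1)] dual_smul[OF ad(2)]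
              scaleR_conv_of_real algebra_simps)
        also have "\<dots> = 0" using re_eq[OF smul_mem[OF True]] by (simp add: re_diff)
        finally show ?thesis .
      qed
      then have "norm x \<le> 0" using norm_le_re[of x] by (metis abs_zero add_0 mult_1)
      then show ?thesis by (simp add: x_def)
    qed (simp add: dual_outside[OF \<phi>d] dual_outside[OF ad(1)] dual_outside[OF ad(2)])
    from extreme_midpoint[OF ext a d t(1,2) this] have "a = d" .
    with \<open>\<And>v. \<phi> v = _ v\<close> have "\<phi> v = a v" for v by (simp add: scaleR_left_diff_distrib)
    then show ?thesis using rea[OF v] pos by simp
  qed
  have null: "M (indicator {i. re (ev i v) \<le> re (\<phi> v) - d}) = 0" (is "M (indicator ?A) = 0")
    if d: "d > 0" and v: "v \<in> carr X" for v d
  proof (rule ccontr)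
    assume "M (indicator ?A) \<noteq> 0"
    then have pos: "M (indicator ?A) > 0" using ipos[of ?A] by simp
    have "M (\<lambda>i. indicator ?A i * re (ev i v)) \<le> M (\<lambda>i. (re (\<phi> v) - d) * indicator ?A i)"
      using v by (intro mean_mono[OF M] br bounded_funs_scale bi) (auto simp: indicator_def)
    then have "M (indicator ?A) * re (\<phi> v) \<le> (re (\<phi> v) - d) * M (indicator ?A)"
      using loc[OF pos v] mean_scale[OF M bi, of "re (\<phi> v) - d" ?A] by simp
    then show False using mult_pos_pos[OF d pos] by (simp add: algebra_simps)
  qed
  \<comment> \<open>The null sets control real parts from below only. These four multiples bound re
    and re (imu * _) of the error on both sides by e / 3, and two thirds of e bound its
    norm.\<close>
  define K where "K = (\<lambda>(u, v). smul X u v) ` ({1, - 1, imu, - imu} \<times> Q)"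
  have K: "finite K" "K \<subseteq> carr X" using Q by (auto simp: K_def smul_mem)
  \<comment> \<open>If these null sets covered S, the sum of their indicators would be at least 1 on
    S and so would its mean, which is 0.\<close>
  let ?A = "\<lambda>v. {i. re (ev i v) \<le> re (\<phi> v) - e / 3}"
  have "M (\<lambda>i. \<Sum>v\<in>K. indicator (?A v) i) = 0"
    using mean_sum[OF M K(1), of "\<lambda>v. indicator (?A v)"] bi null e K(2) by (simp add: subset_iff)
  moreover have "M (\<lambda>i. 1) = 1" by (rule mean_const[OF M])
  moreover have "(\<lambda>i. \<Sum>v\<in>K. indicator (?A v) i) \<in> bounded_funs S"
    using mean_sum[OF M K(1), of "\<lambda>v. indicator (?A v)"] bi by simp
  ultimately have "\<not> (\<forall>i\<in>S. 1 \<le> (\<Sum>v\<in>K. indicator (?A v) i :: real))"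
    using mean_mono[OF M bounded_funs_const[of 1], of "\<lambda>i. \<Sum>v\<in>K. indicator (?A v) i"] by auto
  then obtain i where i: "i \<in> S" "(\<Sum>v\<in>K. indicator (?A v) i :: real) < 1" by auto
  have notA: "i \<notin> ?A v" if "v \<in> K" for v
  proof
    assume "i \<in> ?A v"
    then have "(1::real) = indicator (?A v) i" by simp
    also have "\<dots> \<le> (\<Sum>v\<in>K. indicator (?A v) i)"
      using that K(1) by (intro member_le_sum) auto
    finally show False using i(2) by simp
  qed
  have "norm (ev i v - \<phi> v) < e" if v: "v \<in> Q" for v
  proof -
    have vX: "v \<in> carr X" using v Q by auto
    let ?x = "ev i v - \<phi> v"
    have gt: "re (u * ?x) > - (e / 3)" if "u \<in> {1, - 1, imu, - imu}" for u
    proof -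
      have "smul X u v \<in> K" using that v by (force simp: K_def)
      then have "re (ev i (smul X u v)) > re (\<phi> (smul X u v)) - e / 3" using notA by fastforce
      then show ?thesis
        by (simp add: dual_smul[OF evd[OF i(1)] vX] dual_smul[OF \<phi>d vX] right_diff_distrib re_diff)
    qed
    have neg: "re (- y) = - re y" for y :: 'k using re_diff[of 0 y] by simp
    have "- (e / 3) < re ?x" "- (e / 3) < re (imu * ?x)" using gt[of 1] gt[of imu] by auto
    moreover have "re (- 1 * ?x) > - (e / 3)" "re (- imu * ?x) > - (e / 3)"
      by (rule gt; simp)+
    ultimately have "\<bar>re ?x\<bar> < e / 3" "\<bar>re (imu * ?x)\<bar> < e / 3"
      unfolding mult_minus_left neg abs_less_iff mult_1 by linarith+
    then show ?thesis using norm_le_re[of ?x] e by linarith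
  qed
  then show ?thesis using i(1) by blast
qed

end

section \<open>Normed spaces over the scalars\<close>

abbreviation dual_space :: "('k::real_or_complex \<Rightarrow> 'a::real_normed_vector \<Rightarrow> 'a) \<Rightarrow> ('k, 'a \<Rightarrow> 'k) normed_sp"
  where "dual_space s \<equiv> dual (whole_space s)"

abbreviation functionals :: "('k::real_or_complex \<Rightarrow> 'a::real_normed_vector \<Rightarrow> 'a) \<Rightarrow> ('a \<Rightarrow> 'k) set"
  where "functionals s \<equiv> carr (dual_space s)"

context normed_space_over
begin

lemma nspace_whole_space: "nspace (whole_space scale)"
  by standard (simp_all add: whole_space_def norm_scale scale_of_real scale_right_distrib
      scale_left_distrib)

sublocale ws: nspace "whole_space scale"
  rewrites "carr (whole_space scale) = UNIV"
    and "smul (whole_space scale) = scale"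
    and "nrm (whole_space scale) = norm"
  by (rule nspace_whole_space) (simp_all add: whole_space_def)

sublocale ds: nspace "dual_space scale"
  by (rule ws.nspace_dual)

sublocale dds: nspace "dual (dual_space scale)"
  by (rule ds.nspace_dual)

lemma scaleR_scale: "r *\<^sub>R scale c x = scale c (r *\<^sub>R x)"
  by (metis scale_left_commute scale_of_real)

text \<open>Hahn--Banach on the line through x, taken as the image of r \<mapsto> r x, followed by
  the passage to the scalar field.\<close>

lemma norming_functional:
  assumes "x \<noteq> 0"
  obtains f where "f \<in> unit_sphere (dual_space scale)" "re (f x) = norm x"
proof -
  have 1: "sublinear_on UNIV (norm :: 'a \<Rightarrow> real)"
    by (simp add: sublinear_on_def norm_triangle_ineq)
  obtain g where g: "real_linear_on UNIV g" "\<And>y. g y \<le> norm y" "\<And>r. g (r *\<^sub>R x) = r * norm x"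
  proof (rule Hahn_Banach[OF 1 real_vector.subspace_UNIV real_vector.subspace_UNIV,
        where T = "\<lambda>r::real. r *\<^sub>R x" and l = "\<lambda>r. r * norm x"])
    show "real_linear_on UNIV (\<lambda>r. r * norm x)" by (simp add: real_linear_on_def algebra_simps)
    show "v * norm x \<le> norm (v *\<^sub>R x)" for v by (simp add: mult_right_mono)
  qed (auto simp: scaleR_left_distrib)
  obtain f where f: "f \<in> unit_ball (dual_space scale)" "\<And>y. re (f y) = g y"
    using ws.scalar_extension[OF g(1)] g(2) by auto
  have "norm x \<le> norm (f x)" using re_le[of "f x"] f(2)[of x] g(3)[of 1] by simp
  also have "\<dots> \<le> nrm (dual_space scale) f * norm x"
    using f(1) by (intro ws.dual_bound) (auto simp: unit_ball_def)
  finally have "1 \<le> nrm (dual_space scale) f" using assms by simp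
  then have "f \<in> unit_sphere (dual_space scale)" using f(1) by (simp add: unit_ball_def unit_sphere_def)
  then show thesis using that f(2)[of x] g(3)[of 1] by simp
qed

lemma evaluation_unit_ball:
  assumes "norm x \<le> 1"
  shows "(\<lambda>f. if f \<in> functionals scale then f x else 0) \<in> unit_ball (dual (dual_space scale))"
proof (rule ds.unit_ball_dualI)
  fix f assume f: "f \<in> functionals scale"
  have "norm (f x) \<le> nrm (dual_space scale) f * norm x" using ws.dual_bound[OF f] by simp
  also have "\<dots> \<le> nrm (dual_space scale) f * 1"
    using assms ds.nrm_nonneg[OF f] by (intro mult_left_mono)
  finally show "norm (if f \<in> functionals scale then f x else 0) \<le> nrm (dual_space scale) f"
    using f by simp
qed (auto simp: ds.add_mem ds.smul_mem, simp add: dual_def)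

end

section \<open>Finite nets for the weak topology and Goldstine's theorem\<close>

text \<open>Total boundedness in the form of a colouring with finitely many colours. Each disc is
  covered by finitely many balls of radius d / 2; the centre chosen for h j u is encoded as a number
  and paired with the label for the earlier indices, so values at points with equal labels lie in a
  common ball.\<close>

lemma small_oscillation_labels:
  fixes h :: "'j \<Rightarrow> 'i \<Rightarrow> 'k::real_or_complex"
  assumes "finite J" and bd: "\<And>j u. j \<in> J \<Longrightarrow> u \<in> B \<Longrightarrow> norm (h j u) \<le> C j" and d: "d > 0"
  shows "\<exists>l :: 'i \<Rightarrow> nat. finite (l ` B)
    \<and> (\<forall>u\<in>B. \<forall>v\<in>B. l u = l v \<longrightarrow> (\<forall>j\<in>J. norm (h j u - h j v) < d))"
  using assms(1,2)
proof (induction J)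
  case empty
  show ?case by (rule exI[of _ "\<lambda>_. 0"]) (auto intro: finite_subset[of _ "{0}"])
next
  case (insert j J)
  then obtain l :: "'i \<Rightarrow> nat" where l: "finite (l ` B)"
    "\<And>u v j. u \<in> B \<Longrightarrow> v \<in> B \<Longrightarrow> l u = l v \<Longrightarrow> j \<in> J \<Longrightarrow> norm (h j u - h j v) < d"
    by (metis insertCI)
  have "\<exists>T. finite T \<and> T \<subseteq> cball (0::'k) (C j) \<and> cball 0 (C j) \<subseteq> (\<Union>t\<in>T. ball t (d / 2))"
    by (rule compactE_image[OF compact_cball_scalar, of "cball 0 (C j)" "\<lambda>t. ball t (d / 2)"])
      (use d in force)+
  then obtain T where T: "finite T" "cball (0::'k) (C j) \<subseteq> (\<Union>t\<in>T. ball t (d / 2))" by blast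
  obtain idx :: "'k \<Rightarrow> nat" where idx: "inj_on idx T"
    using T(1) finite_imp_inj_to_nat_seg by metis
  have "\<forall>u\<in>B. \<exists>t\<in>T. dist t (h j u) < d / 2"
  proof
    fix u assume "u \<in> B"
    then have "h j u \<in> cball 0 (C j)" using insert.prems by simp
    then show "\<exists>t\<in>T. dist t (h j u) < d / 2" using T(2) by (auto simp: subset_iff)
  qed
  then obtain t where t: "\<And>u. u \<in> B \<Longrightarrow> t u \<in> T \<and> dist (t u) (h j u) < d / 2" by metis
  let ?l = "\<lambda>u. prod_encode (l u, idx (t u))"
  have "?l ` B \<subseteq> prod_encode ` (l ` B \<times> idx ` T)" using t by auto
  then have "finite (?l ` B)" by (rule finite_subset) (use l(1) T(1) in auto)
  moreover have "norm (h i u - h i v) < d"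
    if uv: "u \<in> B" "v \<in> B" "?l u = ?l v" and i: "i \<in> insert j J" for u v i
  proof (cases "i = j")
    case True
    have "t u = t v" using uv t idx by (auto simp: inj_on_def)
    then have "dist (h j u) (h j v) < d"
      using t[OF uv(1)] t[OF uv(2)] dist_triangle_half_r[of "t u"] by metis
    then show ?thesis using True by (simp add: dist_norm)
  next
    case False
    then show ?thesis using uv i l(2) by auto
  qed
  ultimately show ?case by (intro exI[of _ ?l]) blast
qed

context normed_space_over
begin

text \<open>One point of the ball for each label forms the net.\<close>

lemma cball_finite_net:
  assumes F: "finite F" "F \<subseteq> functionals scale" and d: "d > 0"
  obtains Y where "finite Y" "Y \<subseteq> cball 0 r"
    "\<And>u. norm u \<le> r \<Longrightarrow> \<exists>y\<in>Y. \<forall>f\<in>F. norm (f (u - y)) < d"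
proof -
  have "\<exists>l :: 'a \<Rightarrow> nat. finite (l ` cball 0 r)
    \<and> (\<forall>u\<in>cball 0 r. \<forall>v\<in>cball 0 r. l u = l v \<longrightarrow> (\<forall>f\<in>F. norm (f u - f v) < d))"
  proof (rule small_oscillation_labels[OF F(1) _ d])
    fix f and u :: 'a assume "f \<in> F" "u \<in> cball 0 r"
    then have f: "f \<in> functionals scale" and u: "norm u \<le> r" using F by auto
    show "norm (f u) \<le> nrm (dual_space scale) f * r"
      by (rule order_trans[OF ws.dual_bound[OF f UNIV_I] mult_left_mono[OF u ds.nrm_nonneg[OF f]]])
  qed
  then obtain l :: "'a \<Rightarrow> nat" where l: "finite (l ` cball 0 r)"
    "\<And>u v f. norm u \<le> r \<Longrightarrow> norm v \<le> r \<Longrightarrow> l u = l v \<Longrightarrow> f \<in> F \<Longrightarrow> norm (f u - f v) < d"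
    by auto
  obtain Y where Y: "Y \<subseteq> cball 0 r" "finite Y" "l ` cball 0 r = l ` Y"
    using finite_subset_image[OF l(1) order_refl] by metis
  have "\<exists>y\<in>Y. \<forall>f\<in>F. norm (f (u - y)) < d" if u: "norm u \<le> r" for u
  proof -
    have "l u \<in> l ` Y" using u Y(3) by auto
    then obtain y where y: "y \<in> Y" "l u = l y" by auto
    then have "norm (f (u - y)) < d" if "f \<in> F" for f
      using l(2)[OF u _ y(2) that] Y(1) F(2) that by (auto simp: ws.dual_diff subset_iff)
    then show ?thesis using y(1) by blast
  qed
  then show thesis using that Y by blast
qed

text \<open>Represent z by a mean on the unit ball and discretise it: the ball is cut into classes
  on which F oscillates by less than d / 3, and x is the barycentre of one representative per class,
  weighted by the mass of the class.\<close>

lemma Goldstine: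
  assumes z: "z \<in> unit_ball (dual (dual_space scale))"
    and F: "finite F" "F \<subseteq> functionals scale" and d: "d > 0"
  obtains x where "norm x \<le> 1" "\<And>f. f \<in> F \<Longrightarrow> norm (f x - z f) < d"
proof -
  let ?B = "cball (0::'a) 1"
  let ?ev = "\<lambda>x f. if f \<in> functionals scale then f x else 0"
  obtain M where M: "is_mean ?B M"
    and bf: "\<And>f. f \<in> functionals scale \<Longrightarrow> (\<lambda>x. re (?ev x f)) \<in> bounded_funs ?B"
    and Mf: "\<And>f. f \<in> functionals scale \<Longrightarrow> M (\<lambda>x. re (?ev x f)) = re (z f)"
  proof (rule ds.functional_mean[where S = ?B and ev = ?ev and \<phi> = z])
    fix f c assume f: "f \<in> functionals scale" and c: "\<And>i. i \<in> ?B \<Longrightarrow> re (?ev i f) \<le> c"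
    have "c \<ge> 0" using c[of 0] f by (simp add: ws.dual_0)
    show "nrm (dual_space scale) f \<le> c"
    proof (rule ws.nrm_dual_le[OF _ \<open>c \<ge> 0\<close>], rule ws.re_bound_imp_norm_bound[OF f])
      fix x :: 'a
      show "re (f x) \<le> c * norm x"
      proof (cases "x = 0")
        case True
        then show ?thesis using f by (simp add: ws.dual_0)
      next
        case False
        have "re (f ((1 / norm x) *\<^sub>R x)) \<le> c" using c[of "(1 / norm x) *\<^sub>R x"] f False by simp
        then show ?thesis using False f by (simp add: ws.dual_scaleR re_scaleR field_simps)
      qed
    qed auto
  qed (use z evaluation_unit_ball that in auto)
  have re_f: "re (?ev x f) = re (f x)" if "f \<in> functionals scale" for x f using that by simp
  have "\<exists>l :: 'a \<Rightarrow> nat. finite (l ` ?B)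
    \<and> (\<forall>u\<in>?B. \<forall>v\<in>?B. l u = l v \<longrightarrow> (\<forall>f\<in>F. norm (f u - f v) < d / 3))"
  proof (rule small_oscillation_labels[OF F(1)])
    fix f and u :: 'a assume "f \<in> F" "u \<in> ?B"
    then have f: "f \<in> functionals scale" and u: "norm u \<le> 1" using F by auto
    show "norm (f u) \<le> nrm (dual_space scale) f * 1"
      by (rule order_trans[OF ws.dual_bound[OF f UNIV_I] mult_left_mono[OF u ds.nrm_nonneg[OF f]]])
  qed (use d in auto)
  then obtain l :: "'a \<Rightarrow> nat" where l: "finite (l ` ?B)"
    "\<And>u v f. u \<in> ?B \<Longrightarrow> v \<in> ?B \<Longrightarrow> l u = l v \<Longrightarrow> f \<in> F \<Longrightarrow> norm (f u - f v) < d / 3"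
    by blast
  let ?K = "l ` ?B"
  define y where "y k = inv_into ?B l k" for k
  have y: "y k \<in> ?B" "l (y k) = k" if "k \<in> ?K" for k
    unfolding y_def using that by (rule inv_into_into, rule f_inv_into_f)
  define m where "m k = M (indicator {u. l u = k})" for k
  note bi = bounded_funs_indicator
  have m0: "m k \<ge> 0" for k
    using mean_mono[OF M bounded_funs_const[of 0] bi] mean_const[OF M, of 0] by (simp add: m_def)
  have eq: "M g = M h" if "g \<in> bounded_funs ?B" "h \<in> bounded_funs ?B" "\<And>i. i \<in> ?B \<Longrightarrow> g i = h i" for g h
    using mean_mono[OF M, of g h] mean_mono[OF M, of h g] that by (auto intro: antisym)
  have sel: "(\<Sum>k\<in>?K. c k * indicator {u. l u = k} u) = (c (l u) :: real)" if "u \<in> ?B" for u c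
  proof -
    have "(\<Sum>k\<in>?K. c k * indicator {u. l u = k} u) = (\<Sum>k\<in>?K. if k = l u then c k else 0)"
      by (intro sum.cong) (auto simp: indicator_def)
    then show ?thesis using that l(1) by simp
  qed
  have msum: "(\<lambda>u. c (l u) :: real) \<in> bounded_funs ?B \<and> M (\<lambda>u. c (l u)) = (\<Sum>k\<in>?K. c k * m k)" for c
  proof
    have s: "(\<lambda>u. \<Sum>k\<in>?K. c k * indicator {u. l u = k} u) \<in> bounded_funs ?B"
      "M (\<lambda>u. \<Sum>k\<in>?K. c k * indicator {u. l u = k} u) = (\<Sum>k\<in>?K. c k * m k)"
      using mean_sum[OF M l(1), of "\<lambda>k u. c k * indicator {u. l u = k} u"]
      by (simp_all add: bounded_funs_scale bi mean_scale[OF M] m_def)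
    show b: "(\<lambda>u. c (l u)) \<in> bounded_funs ?B"
    proof -
      obtain C where C: "\<And>u. u \<in> ?B \<Longrightarrow> \<bar>\<Sum>k\<in>?K. c k * indicator {u. l u = k} u\<bar> \<le> C"
        using s(1) unfolding bounded_funs_def by blast
      show ?thesis
      proof (rule bounded_funsI)
        fix u assume u: "u \<in> ?B"
        show "\<bar>c (l u)\<bar> \<le> C" using C[OF u] unfolding sel[OF u] .
      qed
    qed
    show "M (\<lambda>u. c (l u)) = (\<Sum>k\<in>?K. c k * m k)"
      unfolding s(2)[symmetric] by (rule eq[OF b s(1)]) (rule sel[symmetric])
  qed
  have m1: "(\<Sum>k\<in>?K. m k) = 1" using msum[of "\<lambda>_. 1"] mean_const[OF M, of 1] by simp
  define x where "x = (\<Sum>k\<in>?K. m k *\<^sub>R y k)"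
  have "norm x \<le> (\<Sum>k\<in>?K. m k * 1)"
    unfolding x_def
  proof (rule sum_norm_le)
    fix k assume "k \<in> ?K"
    then have "norm (y k) \<le> 1" using y by auto
    then show "norm (m k *\<^sub>R y k) \<le> m k * 1" using m0[of k] mult_left_mono[OF _ m0[of k]] by fastforce
  qed
  then have nx: "norm x \<le> 1" using m1 by simp
  \<comment> \<open>Replacing u by the representative of its class changes re (f u) by at most d / 3
    and hence the mean by no more.\<close>
  have close: "\<bar>re (f x) - re (z f)\<bar> \<le> d / 3"
    if f: "f \<in> functionals scale" and osc: "\<And>u v. u \<in> ?B \<Longrightarrow> v \<in> ?B \<Longrightarrow> l u = l v \<Longrightarrow> norm (f u - f v) < d / 3" for f
  proof -
    have bf': "(\<lambda>u. re (f u)) \<in> bounded_funs ?B" "M (\<lambda>u. re (f u)) = re (z f)"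
      using bf[OF f] Mf[OF f] f by simp_all
    have fx: "re (f x) = M (\<lambda>u. re (f (y (l u))))"
    proof -
      have "f x = (\<Sum>k\<in>?K. m k *\<^sub>R f (y k))"
        unfolding x_def by (simp add: ws.dual_sum[OF f] ws.dual_scaleR[OF f])
      also have "re \<dots> = (\<Sum>k\<in>?K. re (f (y k)) * m k)"
        by (simp add: re_sum re_scaleR mult.commute)
      finally show ?thesis using msum[of "\<lambda>k. re (f (y k))"] by simp
    qed
    have b2: "(\<lambda>u. re (f (y (l u)))) \<in> bounded_funs ?B" using msum[of "\<lambda>k. re (f (y k))"] by simp
    have o: "re (f u) - re (f (y (l u))) \<le> d / 3" "re (f (y (l u))) - re (f u) \<le> d / 3"
      if "u \<in> ?B" for u
    proof -
      have "\<bar>re (f u - f (y (l u)))\<bar> \<le> norm (f u - f (y (l u)))" by (rule abs_re_le)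
      also have "\<dots> < d / 3" using that y by (intro osc) auto
      finally show "re (f u) - re (f (y (l u))) \<le> d / 3" "re (f (y (l u))) - re (f u) \<le> d / 3"
        unfolding re_diff by linarith+
    qed
    have "M (\<lambda>u. re (f u) - re (f (y (l u)))) \<le> d / 3"
      by (intro mean_le[OF M] bounded_funs_diff bf' b2 o)
    moreover have "M (\<lambda>u. re (f (y (l u))) - re (f u)) \<le> d / 3"
      by (intro mean_le[OF M] bounded_funs_diff bf' b2 o)
    ultimately show ?thesis
      unfolding fx bf'(2)[symmetric] mean_diff[OF M bf'(1) b2] mean_diff[OF M b2 bf'(1)] by linarith
  qed
  have "norm (f x - z f) < d" if "f \<in> F" for f
  proof -
    have f: "f \<in> functionals scale" using that F by auto
    have zd: "z \<in> carr (dual (dual_space scale))" using z by (simp add: unit_ball_def)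
    \<comment> \<open>imu f oscillates no more than f because |imu| \<le> 1, so the same classes
      handle it and the second real part is controlled too.\<close>
    let ?jf = "smul (dual_space scale) imu f"
    have jf: "?jf = (\<lambda>u. imu * f u)" by (simp add: dual_def)
    have 1: "\<bar>re (f x - z f)\<bar> \<le> d / 3" using close[OF f] l(2) that by (simp add: re_diff)
    have "\<bar>re (?jf x) - re (z ?jf)\<bar> \<le> d / 3"
    proof (rule close[OF ds.smul_mem[OF f]])
      fix u v assume "u \<in> ?B" "v \<in> ?B" "l u = l v"
      then have "norm (f u - f v) < d / 3" using l(2) that by blast
      moreover have "norm (imu * (f u - f v)) \<le> norm (f u - f v)"
        unfolding norm_mult using norm_imu_le[where 'k = 'k] by (simp add: mult_left_le_one_le)
      ultimately show "norm (?jf u - ?jf v) < d / 3" by (simp add: jf right_diff_distrib)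
    qed
    then have 2: "\<bar>re (imu * (f x - z f))\<bar> \<le> d / 3"
      using ds.dual_smul[OF zd f, of imu] by (simp add: jf right_diff_distrib re_diff)
    show ?thesis using norm_le_re[of "f x - z f"] 1 2 d by linarith
  qed
  with nx show thesis by (rule that)
qed

end

section \<open>Polarization\<close>

context
  fixes sE :: "'k::real_or_complex \<Rightarrow> 'a::real_normed_vector \<Rightarrow> 'a"
    and sF :: "'k \<Rightarrow> 'b::real_normed_vector \<Rightarrow> 'b"
    and n :: nat
begin

text \<open>Arguments indexed by naturals turn a change of one coordinate into a function update;
  only the first n values are read.\<close>

abbreviation on_family :: "('a list \<Rightarrow> 'b) \<Rightarrow> (nat \<Rightarrow> 'a) \<Rightarrow> 'b"
  where "on_family A v \<equiv> A (map v [0..<n])"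

lemma map_upt_update: "i < n \<Longrightarrow> map (v(i := u)) [0..<n] = (map v [0..<n])[i := u]"
  by (auto intro!: nth_equalityI simp: nth_list_update)

lemma multilinear_coord:
  assumes "multilinear n sE sF A" "i < n"
  shows "Vector_Spaces.linear sE sF (\<lambda>u. on_family A (v(i := u)))"
  unfolding map_upt_update[OF assms(2)] using assms unfolding multilinear_def by simp

lemma multilinear_coord_add:
  assumes "multilinear n sE sF A" "i < n"
  shows "on_family A (v(i := u + w)) = on_family A (v(i := u)) + on_family A (v(i := w))"
  using multilinear_coord[OF assms, of v] unfolding Vector_Spaces.linear_iff by blast

lemma multilinear_coord_sum:
  assumes "multilinear n sE sF A" "i < n" "finite S"
  shows "on_family A (v(i := \<Sum>s\<in>S. x s)) = (\<Sum>s\<in>S. on_family A (v(i := x s)))"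
  using assms(3)
proof (induction S)
  case empty
  show ?case
    using multilinear_coord_add[OF assms(1,2), of v 0 0]
    unfolding add_0_left add_cancel_right_right sum.empty .
next
  case (insert s S)
  then show ?case by (simp only: sum.insert multilinear_coord_add[OF assms(1,2)] simp_thms)
qed

text \<open>m counts the coordinates occupied by the sum, and the arbitrary remainder w makes
  induction on m possible. The case m = n expands P at a sum.\<close>

lemma multilinear_expand:
  assumes A: "multilinear n sE sF A" and S: "finite S" and m: "m \<le> n"
  shows "on_family A (\<lambda>k. if k < m then \<Sum>s\<in>S. x s else w k)
    = (\<Sum>g\<in>{..<m} \<rightarrow>\<^sub>E S. on_family A (\<lambda>k. if k < m then x (g k) else w k))"
  using m
proof (induction m arbitrary: w)
  case (Suc m)
  let ?y = "\<Sum>s\<in>S. x s"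
  have e1: "(\<lambda>k. if k < Suc m then ?y else w k) = (\<lambda>k. if k < m then ?y else (w(m := ?y)) k)" for w
    by (auto simp: fun_eq_iff less_Suc_eq)
  have e2: "(\<lambda>k. if k < m then x (g k) else (w(m := y)) k)
      = (\<lambda>k. if k < m then x (g k) else w k)(m := y)" for g y
    by (auto simp: fun_eq_iff)
  have e3: "(\<lambda>k. if k < m then x (g k) else w k)(m := x s)
      = (\<lambda>k. if k < Suc m then x ((g(m := s)) k) else w k)" for g s
    by (auto simp: fun_eq_iff less_Suc_eq)
  have "on_family A (\<lambda>k. if k < Suc m then ?y else w k)
      = (\<Sum>g\<in>{..<m} \<rightarrow>\<^sub>E S. on_family A (\<lambda>k. if k < m then x (g k) else (w(m := ?y)) k))"
    unfolding e1 using Suc by (intro Suc.IH) auto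
  also have "\<dots> = (\<Sum>g\<in>{..<m} \<rightarrow>\<^sub>E S. \<Sum>s\<in>S. on_family A ((\<lambda>k. if k < m then x (g k) else w k)(m := x s)))"
    unfolding e2 using Suc.prems by (intro sum.cong multilinear_coord_sum A S) auto
  also have "\<dots> = (\<Sum>(g, s)\<in>({..<m} \<rightarrow>\<^sub>E S) \<times> S. on_family A (\<lambda>k. if k < Suc m then x ((g(m := s)) k) else w k))"
    unfolding e3 by (rule sum.cartesian_product)
  also have "\<dots> = (\<Sum>g\<in>{..<Suc m} \<rightarrow>\<^sub>E S. on_family A (\<lambda>k. if k < Suc m then x (g k) else w k))"
  proof (rule sum.reindex_bij_witness[where j = "\<lambda>(g, s). g(m := s)"
        and i = "\<lambda>h. (h(m := undefined), h m)"])
    fix h assume "h \<in> {..<Suc m} \<rightarrow>\<^sub>E S"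
    then show "(h(m := undefined), h m) \<in> ({..<m} \<rightarrow>\<^sub>E S) \<times> S"
      by (auto simp: PiE_iff extensional_def less_Suc_eq)
  next
    fix a assume "a \<in> ({..<m} \<rightarrow>\<^sub>E S) \<times> S"
    then obtain g s where "a = (g, s)" "g \<in> {..<m} \<rightarrow>\<^sub>E S" "s \<in> S" by auto
    then show "(case a of (g, s) \<Rightarrow> g(m := s)) \<in> {..<Suc m} \<rightarrow>\<^sub>E S"
      by (auto simp: PiE_iff extensional_def less_Suc_eq)
    show "(\<lambda>h. (h(m := undefined), h m)) (case a of (g, s) \<Rightarrow> g(m := s)) = a"
      using \<open>a = _\<close> \<open>g \<in> _\<close> by (auto simp: fun_eq_iff PiE_iff extensional_def)
  qed (auto simp: fun_eq_iff)
  finally show ?case .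
qed simp

text \<open>The permutations of the indices, n! in number; the surjective form is what the
  coefficient computation for the polarization formula produces.\<close>

definition surjections :: "(nat \<Rightarrow> nat) set"
  where "surjections = {g \<in> {..<n} \<rightarrow>\<^sub>E {..<n}. g ` {..<n} = {..<n}}"

lemma finite_surjections: "finite surjections"
  by (simp add: surjections_def finite_PiE)

lemma card_surjections_pos: "card surjections > 0"
proof -
  have "restrict id {..<n} \<in> surjections" by (auto simp: surjections_def)
  then show ?thesis using finite_surjections card_gt_0_iff by blast
qed

lemma surjections_inj: "g \<in> surjections \<Longrightarrow> inj_on g {..<n}"
  by (rule eq_card_imp_inj_on) (auto simp: surjections_def)

text \<open>The polarization identity in the variant with subsets in place of sign vectors;
  \<open>card surjections\<close> is the usual n!.\<close>

definition polarization :: "('a \<Rightarrow> 'b) \<Rightarrow> (nat \<Rightarrow> 'a) \<Rightarrow> 'b"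
  where "polarization P v = (1 / real (card surjections)) *\<^sub>R
    (\<Sum>S\<in>Pow {..<n}. (- 1) ^ card ({..<n} - S) *\<^sub>R P (\<Sum>i\<in>S. v i))"

text \<open>Expanding \<open>P\<close>, the coefficient of the term of a map \<open>g\<close> on indices is the sum of
  \<open>(-1)\<^bsup>n - |S|\<^esup>\<close> over all \<open>S \<supseteq> range g\<close>, which vanishes unless \<open>g\<close> is onto.\<close>

lemma polarization_eq:
  assumes A: "multilinear n sE sF A" and P: "\<And>x. P x = A (replicate n x)"
  shows "polarization P v
    = (1 / real (card surjections)) *\<^sub>R (\<Sum>g\<in>surjections. on_family A (\<lambda>k. v (g k)))"
proof -
  let ?N = "{..<n}"
  let ?c = "\<lambda>S. (- 1 :: real) ^ card (?N - S)"
  have PS: "P (\<Sum>i\<in>S. v i) = (\<Sum>g\<in>?N \<rightarrow>\<^sub>E ?N. (if g ` ?N \<subseteq> S then 1 else (0::real)) *\<^sub>R on_family A (\<lambda>k. v (g k)))"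
    if S: "S \<subseteq> ?N" for S
  proof -
    have fS: "finite S" using S finite_subset by blast
    have "replicate n (\<Sum>i\<in>S. v i) = map (\<lambda>k. if k < n then \<Sum>i\<in>S. v i else 0) [0..<n]"
      by (auto intro!: nth_equalityI)
    then have "P (\<Sum>i\<in>S. v i) = on_family A (\<lambda>k. if k < n then \<Sum>i\<in>S. v i else 0)" by (simp add: P)
    also have "\<dots> = (\<Sum>g\<in>?N \<rightarrow>\<^sub>E S. on_family A (\<lambda>k. if k < n then v (g k) else 0))"
      by (rule multilinear_expand[OF A fS order_refl])
    also have "\<dots> = (\<Sum>g\<in>?N \<rightarrow>\<^sub>E S. on_family A (\<lambda>k. v (g k)))"
      by (intro sum.cong arg_cong[where f = A]) auto
    also have "\<dots> = (\<Sum>g\<in>?N \<rightarrow>\<^sub>E ?N. if g ` ?N \<subseteq> S then on_family A (\<lambda>k. v (g k)) else 0)"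
      using S by (intro sum.mono_neutral_cong_left) (auto simp: finite_PiE PiE_iff)
    also have "\<dots> = (\<Sum>g\<in>?N \<rightarrow>\<^sub>E ?N. (if g ` ?N \<subseteq> S then 1 else (0::real)) *\<^sub>R on_family A (\<lambda>k. v (g k)))"
      by (intro sum.cong) auto
    finally show ?thesis .
  qed
  have coeff: "(\<Sum>S\<in>Pow ?N. ?c S * (if g ` ?N \<subseteq> S then 1 else 0)) = (if g ` ?N = ?N then 1 else 0)"
    if g: "g \<in> ?N \<rightarrow>\<^sub>E ?N" for g
  proof -
    \<comment> \<open>The sum over S is the expansion of the product of all 1 + ?b i, whose factors
      off the range of g are 1 - 1 = 0.\<close>
    let ?b = "\<lambda>i. if i \<in> g ` ?N then 0 else (- 1 :: real)"
    have "(\<Prod>i\<in>?N - S. ?b i) = ?c S * (if g ` ?N \<subseteq> S then 1 else 0)" if "S \<subseteq> ?N" for S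
    proof (cases "g ` ?N \<subseteq> S")
      case True
      then have "(\<Prod>i\<in>?N - S. ?b i) = (\<Prod>i\<in>?N - S. - 1)" by (intro prod.cong) auto
      with True show ?thesis by simp
    next
      case False
      then obtain i where "i \<in> g ` ?N" "i \<notin> S" by blast
      moreover have "i \<in> ?N" using \<open>i \<in> g ` ?N\<close> g by (auto simp: PiE_iff)
      ultimately show ?thesis using False by (simp add: prod_zero_iff) blast
    qed
    then have "(\<Sum>S\<in>Pow ?N. ?c S * (if g ` ?N \<subseteq> S then 1 else 0))
        = (\<Sum>S\<in>Pow ?N. (\<Prod>i\<in>S. 1) * (\<Prod>i\<in>?N - S. ?b i))"
      by (intro sum.cong) auto
    also have "\<dots> = (\<Prod>i\<in>?N. 1 + ?b i)" by (rule prod_add[symmetric]) simp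
    also have "\<dots> = (if g ` ?N = ?N then 1 else 0)"
    proof (cases "g ` ?N = ?N")
      case False
      then obtain i where "i \<in> ?N" "i \<notin> g ` ?N" using g by (auto simp: PiE_iff)
      then have "(\<Prod>i\<in>?N. 1 + ?b i) = 0" by (intro prod_zero) auto
      with False show ?thesis by simp
    qed simp
    finally show ?thesis .
  qed
  have "(\<Sum>S\<in>Pow ?N. ?c S *\<^sub>R P (\<Sum>i\<in>S. v i))
      = (\<Sum>S\<in>Pow ?N. \<Sum>g\<in>?N \<rightarrow>\<^sub>E ?N. (?c S * (if g ` ?N \<subseteq> S then 1 else 0)) *\<^sub>R on_family A (\<lambda>k. v (g k)))"
    by (intro sum.cong) (simp_all add: PS scaleR_sum_right)
  also have "\<dots> = (\<Sum>g\<in>?N \<rightarrow>\<^sub>E ?N. (\<Sum>S\<in>Pow ?N. ?c S * (if g ` ?N \<subseteq> S then 1 else 0)) *\<^sub>R on_family A (\<lambda>k. v (g k)))"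
    by (subst sum.swap) (simp only: scaleR_sum_left)
  also have "\<dots> = (\<Sum>g\<in>?N \<rightarrow>\<^sub>E ?N. (if g ` ?N = ?N then 1 else 0) *\<^sub>R on_family A (\<lambda>k. v (g k)))"
    by (intro sum.cong refl) (simp only: coeff)
  also have "\<dots> = (\<Sum>g\<in>surjections. on_family A (\<lambda>k. v (g k)))"
    by (rule sum.mono_neutral_cong_right) (auto simp: surjections_def finite_PiE)
  finally show ?thesis by (simp add: polarization_def)
qed

text \<open>For symmetric A all terms of the sum over \<open>surjections\<close> agree. This yields
  the uniqueness of the symmetric polar form.\<close>

lemma polarization_symmetric:
  assumes A: "multilinear n sE sF A" and P: "\<And>x. P x = A (replicate n x)"
    and sym: "\<forall>xs ys. mset xs = mset ys \<longrightarrow> A xs = A ys"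
  shows "on_family A v = polarization P v"
proof -
  have "on_family A (\<lambda>k. v (g k)) = on_family A v" if g: "g \<in> surjections" for g
  proof -
    have "mset (map g [0..<n]) = mset [0..<n]"
      using g surjections_inj[OF g]
      by (intro set_eq_iff_mset_eq_distinct[THEN iffD1])
        (auto simp: distinct_map surjections_def lessThan_atLeast0)
    then have "mset (map v (map g [0..<n])) = mset (map v [0..<n])" by (simp only: mset_map)
    then show ?thesis using sym by (simp add: comp_def)
  qed
  then have "(\<Sum>g\<in>surjections. on_family A (\<lambda>k. v (g k))) = real (card surjections) *\<^sub>R on_family A v"
    by (simp add: sum_constant_scaleR)
  then show ?thesis using polarization_eq[OF A P, of v] card_surjections_pos by simp
qed

text \<open>A permutation of the arguments permutes the subsets S and preserves their sizes. Hence
  the polarization, read on lists, is symmetric.\<close>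

lemma polarization_multiset:
  assumes "mset (map v [0..<n]) = mset (map w [0..<n])"
  shows "polarization P v = polarization P w"
proof -
  obtain p where p: "p permutes {..<n}" "permute_list p (map w [0..<n]) = map v [0..<n]"
    using mset_eq_permutation[OF assms] by auto
  have v: "v i = w (p i)" if "i < n" for i
  proof -
    have "permute_list p (map w [0..<n]) ! i = w (p i)"
      using that p(1) permutes_in_image[OF p(1), of i] by (simp add: permute_list_nth)
    then show ?thesis using that p(2) by simp
  qed
  have inj: "inj p" using p(1) permutes_inj by blast
  have img: "p ` {..<n} = {..<n}" by (rule permutes_image[OF p(1)])
  have "(\<Sum>S\<in>Pow {..<n}. (- 1) ^ card ({..<n} - S) *\<^sub>R P (\<Sum>i\<in>S. v i))
      = (\<Sum>S\<in>Pow {..<n}. (- 1) ^ card ({..<n} - p ` S) *\<^sub>R P (\<Sum>i\<in>p ` S. w i))"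
  proof (intro sum.cong refl)
    fix S assume S: "S \<in> Pow {..<n}"
    have "(\<Sum>i\<in>p ` S. w i) = (\<Sum>i\<in>S. v i)"
      using S v inj by (subst sum.reindex) (auto intro!: sum.cong inj_on_subset[OF inj] simp: subset_iff)
    moreover have "card ({..<n} - p ` S) = card ({..<n} - S)"
    proof -
      have "{..<n} - p ` S = p ` ({..<n} - S)" using img inj by (simp add: image_set_diff)
      then show ?thesis using inj by (simp add: card_image inj_on_subset)
    qed
    ultimately show "(- 1) ^ card ({..<n} - S) *\<^sub>R P (\<Sum>i\<in>S. v i)
        = (- 1) ^ card ({..<n} - p ` S) *\<^sub>R P (\<Sum>i\<in>p ` S. w i)" by simp
  qed
  also have "\<dots> = (\<Sum>S\<in>Pow {..<n}. (- 1) ^ card ({..<n} - S) *\<^sub>R P (\<Sum>i\<in>S. w i))"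
  proof (rule sum.reindex_bij_betw[of "image p"])
    show "bij_betw (image p) (Pow {..<n}) (Pow {..<n})"
      using inj img bij_betw_Pow[of p "{..<n}" "{..<n}"] by (simp add: bij_betw_def inj_on_subset)
  qed
  finally show ?thesis by (simp add: polarization_def)
qed

end

locale normed_pair = E: normed_space_over sE + F: normed_space_over sF
  for sE :: "'k::real_or_complex \<Rightarrow> 'a::real_normed_vector \<Rightarrow> 'a"
    and sF :: "'k \<Rightarrow> 'b::real_normed_vector \<Rightarrow> 'b"
begin

lemma linear_iff:
  "Vector_Spaces.linear sE sF f \<longleftrightarrow> (\<forall>x y. f (x + y) = f x + f y) \<and> (\<forall>c x. f (sE c x) = sF c (f x))"
  unfolding Vector_Spaces.linear_iff using E.vector_space_axioms F.vector_space_axioms by blast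

text \<open>The description that defines \<open>polar_form\<close> has exactly one solution:
  symmetrising the possibly nonsymmetric A gives B, and \<open>polarization_symmetric\<close>
  identifies any symmetric solution with it. The third part lets analytic properties pass from P to
  its polar form.\<close>

lemma polar_form:
  assumes A: "multilinear n sE sF A" and P: "\<And>x. P x = A (replicate n x)"
  shows "multilinear n sE sF (polar_form n sE sF P)"
    and "P x = polar_form n sE sF P (replicate n x)"
    and "polar_form n sE sF P (map v [0..<n]) = polarization n P v"
proof -
  define B where "B xs = (if length xs = n then polarization n P ((!) xs) else 0)" for xs
  have Bv: "B (map v [0..<n]) = polarization n P v" for v
    unfolding B_def by (simp, rule polarization_multiset) (rule arg_cong[of _ _ mset], auto)
  have BA: "B xs = (1 / real (card (surjections n))) *\<^sub>R (\<Sum>g\<in>surjections n. A (map (\<lambda>k. xs ! (g k)) [0..<n]))"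
    if "length xs = n" for xs
    using that polarization_eq[OF A P] by (simp add: B_def)
  have lin: "multilinear n sE sF B"
    unfolding multilinear_def linear_iff
  proof (intro conjI allI impI)
    fix xs :: "'a list" and i assume xs: "length xs = n" "i < n"
    \<comment> \<open>In the term of a permutation g, updating coordinate i touches exactly the
      position j with g j = i, so linearity of A in that position applies.\<close>
    have upd: "\<exists>j<n. \<forall>u. map (\<lambda>k. xs[i := u] ! (g k)) [0..<n] = (map (\<lambda>k. xs ! (g k)) [0..<n])[j := u]"
      if g: "g \<in> surjections n" for g
    proof -
      have "i \<in> g ` {..<n}" using g xs by (simp add: surjections_def)
      then obtain j where j: "j < n" "g j = i" by auto
      have "xs[i := u] ! g k = (map (\<lambda>k. xs ! (g k)) [0..<n])[j := u] ! k" if k: "k < n" for k u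
      proof (cases "k = j")
        case True
        then show ?thesis using xs j by simp
      next
        case False
        then have "g k \<noteq> i" using surjections_inj[OF g] j k by (auto simp: inj_on_def)
        then show ?thesis using False k by simp
      qed
      then show ?thesis using j(1) by (intro exI[of _ j] conjI allI nth_equalityI) simp_all
    qed
    have add: "A (map (\<lambda>k. xs[i := u + w] ! (g k)) [0..<n])
        = A (map (\<lambda>k. xs[i := u] ! (g k)) [0..<n]) + A (map (\<lambda>k. xs[i := w] ! (g k)) [0..<n])"
      and sc: "A (map (\<lambda>k. xs[i := sE c u] ! (g k)) [0..<n]) = sF c (A (map (\<lambda>k. xs[i := u] ! (g k)) [0..<n]))"
      if g: "g \<in> surjections n" for g u w c
    proof -
      obtain j where j: "j < n" "\<And>u. map (\<lambda>k. xs[i := u] ! (g k)) [0..<n] = (map (\<lambda>k. xs ! (g k)) [0..<n])[j := u]"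
        using upd[OF g] by blast
      have "Vector_Spaces.linear sE sF (\<lambda>u. A ((map (\<lambda>k. xs ! (g k)) [0..<n])[j := u]))"
        using A j(1) unfolding multilinear_def by simp
      then show "A (map (\<lambda>k. xs[i := u + w] ! (g k)) [0..<n])
        = A (map (\<lambda>k. xs[i := u] ! (g k)) [0..<n]) + A (map (\<lambda>k. xs[i := w] ! (g k)) [0..<n])"
       "A (map (\<lambda>k. xs[i := sE c u] ! (g k)) [0..<n]) = sF c (A (map (\<lambda>k. xs[i := u] ! (g k)) [0..<n]))"
        unfolding j(2) linear_iff by blast+
    qed
    show "B (xs[i := u + w]) = B (xs[i := u]) + B (xs[i := w])" for u w
      using xs by (simp add: BA add sum.distrib scaleR_add_right)
    show "B (xs[i := sE c u]) = sF c (B (xs[i := u]))" for c u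
      using xs by (simp add: BA sc F.scale_sum_right F.scaleR_scale[symmetric])
  qed (simp add: B_def)
  have sym: "\<forall>xs ys. mset xs = mset ys \<longrightarrow> B xs = B ys"
  proof (intro allI impI)
    fix xs ys :: "'a list" assume m: "mset xs = mset ys"
    then have len: "length xs = length ys" by (rule mset_eq_length)
    show "B xs = B ys"
    proof (cases "length ys = n")
      case True
      then have "map ((!) xs) [0..<n] = xs" "map ((!) ys) [0..<n] = ys"
        using len map_nth by metis+
      then show ?thesis using polarization_multiset[where n = n and v = "(!) xs" and w = "(!) ys" and P = P] m len True by (simp add: B_def)
    qed (simp add: B_def len)
  qed
  have diag: "P x = B (replicate n x)" for x
  proof -
    have "map (\<lambda>k. replicate n x ! (g k)) [0..<n] = replicate n x" if "g \<in> surjections n" for g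
      using that by (auto intro!: nth_equalityI simp: surjections_def PiE_iff)
    then have "B (replicate n x) = (1 / real (card (surjections n))) *\<^sub>R (\<Sum>g\<in>surjections n. A (replicate n x))"
      by (simp add: BA cong: sum.cong)
    then show ?thesis using card_surjections_pos[of n] by (simp add: sum_constant_scaleR P)
  qed
  have pf: "polar_form n sE sF P = B"
    unfolding polar_form_def
  proof (rule the_equality)
    show "multilinear n sE sF B \<and> (\<forall>xs ys. mset xs = mset ys \<longrightarrow> B xs = B ys) \<and> (\<forall>x. P x = B (replicate n x))"
      using lin sym diag by blast
    fix C assume C: "multilinear n sE sF C \<and> (\<forall>xs ys. mset xs = mset ys \<longrightarrow> C xs = C ys) \<and> (\<forall>x. P x = C (replicate n x))"
    show "C = B"
    proof
      fix xs
      show "C xs = B xs"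
      proof (cases "length xs = n")
        case True
        then have "C xs = C (map ((!) xs) [0..<n])" using map_nth by metis
        also have "\<dots> = polarization n P ((!) xs)"
          by (rule polarization_symmetric[of n sE sF C]) (use C in blast)+
        finally show ?thesis using True by (simp add: B_def)
      qed (use C in \<open>auto simp: multilinear_def B_def\<close>)
    qed
  qed
  show "multilinear n sE sF (polar_form n sE sF P)" "P x = polar_form n sE sF P (replicate n x)"
    "polar_form n sE sF P (map v [0..<n]) = polarization n P v"
    unfolding pf by (rule lin diag Bv)+
qed

end

section \<open>Weak neighbourhoods and uniform weak continuity\<close>

context normed_space_over
begin

text \<open>A base at 0 of the weak topology; nearness of points is expressed through their
  differences.\<close>

definition weak_nbhds :: "'a set set"
  where "weak_nbhds = {{u. \<forall>f\<in>F. norm (f u) < d} | F d. finite F \<and> F \<subseteq> functionals scale \<and> d > 0}"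

lemma weak_nbhdsI: "finite F \<Longrightarrow> F \<subseteq> functionals scale \<Longrightarrow> d > 0 \<Longrightarrow> {u. \<forall>f\<in>F. norm (f u) < d} \<in> weak_nbhds"
  unfolding weak_nbhds_def by blast

lemma weak_nbhds_UNIV: "UNIV \<in> weak_nbhds"
  using weak_nbhdsI[of "{}" 1] by simp

lemma weak_nbhds_zero: "U \<in> weak_nbhds \<Longrightarrow> 0 \<in> U"
  unfolding weak_nbhds_def by (auto simp: ws.dual_0 subset_iff)

lemma weak_nbhds_Int:
  assumes "U \<in> weak_nbhds" "V \<in> weak_nbhds"
  obtains W where "W \<in> weak_nbhds" "W \<subseteq> U" "W \<subseteq> V"
proof -
  obtain F d where F: "U = {u. \<forall>f\<in>F. norm (f u) < d}" "finite F" "F \<subseteq> functionals scale" "d > 0"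
    using assms(1) unfolding weak_nbhds_def by blast
  obtain G e where G: "V = {u. \<forall>f\<in>G. norm (f u) < e}" "finite G" "G \<subseteq> functionals scale" "e > 0"
    using assms(2) unfolding weak_nbhds_def by blast
  show thesis
    by (rule that[OF weak_nbhdsI[of "F \<union> G" "min d e"]]) (use F G in auto)
qed

lemma weak_nbhds_INT:
  assumes "finite I" "\<And>i. i \<in> I \<Longrightarrow> U i \<in> weak_nbhds"
  shows "\<exists>W\<in>weak_nbhds. \<forall>i\<in>I. W \<subseteq> U i"
  using assms
proof (induction I)
  case empty
  then show ?case using weak_nbhds_UNIV by blast
next
  case (insert i I)
  then obtain W where "W \<in> weak_nbhds" "\<forall>i\<in>I. W \<subseteq> U i" by auto
  moreover obtain W' where "W' \<in> weak_nbhds" "W' \<subseteq> W" "W' \<subseteq> U i"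
    using weak_nbhds_Int[OF \<open>W \<in> weak_nbhds\<close>] insert.prems by blast
  ultimately show ?case by blast
qed

lemma weak_nbhds_net:
  assumes "U \<in> weak_nbhds"
  obtains Y where "finite Y" "Y \<subseteq> cball 0 r" "\<And>u. norm u \<le> r \<Longrightarrow> \<exists>y\<in>Y. u - y \<in> U"
proof -
  obtain F d where F: "U = {u. \<forall>f\<in>F. norm (f u) < d}" "finite F" "F \<subseteq> functionals scale" "d > 0"
    using assms(1) unfolding weak_nbhds_def by blast
  show thesis
    using cball_finite_net[OF F(2-4), of r] that by (auto simp: F(1))
qed

text \<open>If \<open>A\<close> is weakly continuous at the origin in all coordinates of \<open>I\<close>, then it is small as soon
  as the coordinates in a nonempty \<open>K \<subseteq> I\<close> are weakly small: a further coordinate of \<open>I\<close> splits into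
  an element of a finite net, which is then frozen, and a weakly small remainder.\<close>

lemma multiadditive_small:
  fixes A :: "(nat \<Rightarrow> 'a) \<Rightarrow> 'c::real_normed_vector"
  assumes I\<^sub>0: "finite I\<^sub>0"
    and add: "\<And>i v u w. i \<in> I\<^sub>0 \<Longrightarrow> A (v(i := u + w)) = A (v(i := u)) + A (v(i := w))"
    and cont: "\<And>w r e. e > 0 \<Longrightarrow> \<exists>U\<in>weak_nbhds. \<forall>v. (\<forall>k\<in>I\<^sub>0. norm (v k) \<le> r \<and> v k - w k \<in> U)
      \<and> (\<forall>k. k \<notin> I\<^sub>0 \<longrightarrow> v k = w k) \<longrightarrow> norm (A v - A w) < e"
    and IK: "I \<subseteq> I\<^sub>0" "K \<subseteq> I" "K \<noteq> {}" and e: "e > 0"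
  shows "\<exists>U\<in>weak_nbhds. \<forall>v. (\<forall>k. k \<notin> I \<longrightarrow> v k = w k) \<and> (\<forall>k\<in>I. norm (v k) \<le> r)
    \<and> (\<forall>k\<in>K. v k \<in> U) \<longrightarrow> norm (A v) < e"
  using IK e
\<comment> \<open>There are two recursive calls: one enlarges K by j, the other freezes j and
  removes it from I. The measure drops in both.\<close>
proof (induction "card I + card (I - K)" arbitrary: I K w r e rule: less_induct)
  case less
  have finI: "finite I" using less.prems I\<^sub>0 finite_subset by blast
  show ?case
  proof (cases "K = I")
    case True
    \<comment> \<open>All free coordinates are weakly small, so the family is compared with the one
      that is 0 on I, where A vanishes by additivity.\<close>
    let ?w = "\<lambda>k. if k \<in> I then 0 else w k"
    have A0: "A ?w = 0"
    proof -
      obtain i where i: "i \<in> I" using less.prems by auto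
      have "A (?w(i := 0 + 0)) = A (?w(i := 0)) + A (?w(i := 0))"
        using less.prems i by (intro add) auto
      moreover have "?w(i := 0) = ?w" using i by auto
      ultimately show ?thesis unfolding add_0 by simp
    qed
    \<comment> \<open>Joint continuity takes one radius for all coordinates of
      \<open>I\<^sub>0\<close>, including those frozen at w; hence the added sum of norms.\<close>
    obtain U where U: "U \<in> weak_nbhds" "\<And>v. (\<And>k. k \<in> I\<^sub>0 \<Longrightarrow> norm (v k) \<le> \<bar>r\<bar> + (\<Sum>k\<in>I\<^sub>0. norm (w k)) \<and> v k - ?w k \<in> U)
      \<Longrightarrow> (\<And>k. k \<notin> I\<^sub>0 \<Longrightarrow> v k = ?w k) \<Longrightarrow> norm (A v - A ?w) < e"
      using cont[OF less.prems(4), of "\<bar>r\<bar> + (\<Sum>k\<in>I\<^sub>0. norm (w k))" ?w] by blast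
    have "norm (A v) < e" if v: "\<forall>k. k \<notin> I \<longrightarrow> v k = w k" "\<forall>k\<in>I. norm (v k) \<le> r" "\<forall>k\<in>K. v k \<in> U" for v
    proof -
      have "norm (A v - A ?w) < e"
      proof (rule U(2))
        fix k assume k: "k \<in> I\<^sub>0"
        have s: "norm (w k) \<le> (\<Sum>k\<in>I\<^sub>0. norm (w k))" "0 \<le> (\<Sum>k\<in>I\<^sub>0. norm (w k))"
          using I\<^sub>0 k by (auto intro: member_le_sum sum_nonneg)
        show "norm (v k) \<le> \<bar>r\<bar> + (\<Sum>k\<in>I\<^sub>0. norm (w k)) \<and> v k - ?w k \<in> U"
        proof (cases "k \<in> I")
          case True
          then have "norm (v k) \<le> r" "v k \<in> U" using v \<open>K = I\<close> by auto
          then show ?thesis using True s by auto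
        next
          case False
          then show ?thesis using v s weak_nbhds_zero[OF U(1)] by auto
        qed
      qed (use v less.prems in auto)
      then show ?thesis by (simp only: A0 diff_0_right)
    qed
    then show ?thesis using U(1) by blast
  next
    case False
    then obtain j where j: "j \<in> I" "j \<notin> K" using less.prems by blast
    have c1: "card (I - {j}) < card I" by (rule card_Diff1_less[OF finI j(1)])
    have "I - insert j K = (I - K) - {j}" by auto
    then have c2: "card (I - insert j K) < card (I - K)"
      using j finI by (simp only:) (rule card_Diff1_less, auto)
    have c3: "card (I - {j} - K) \<le> card (I - K)" using finI by (intro card_mono) auto
    have "e / 2 > 0" using less.prems by simp
    \<comment> \<open>This will be applied to the remainder v j - y, a difference of two vectors of
      norm at most r; hence the radius 2 * r.\<close>
    obtain U where U: "U \<in> weak_nbhds" "\<And>v. (\<And>k. k \<notin> I \<Longrightarrow> v k = w k) \<Longrightarrow> (\<And>k. k \<in> I \<Longrightarrow> norm (v k) \<le> 2 * r)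
        \<Longrightarrow> (\<And>k. k \<in> insert j K \<Longrightarrow> v k \<in> U) \<Longrightarrow> norm (A v) < e / 2"
    proof -
      have "\<exists>U\<in>weak_nbhds. \<forall>v. (\<forall>k. k \<notin> I \<longrightarrow> v k = w k) \<and> (\<forall>k\<in>I. norm (v k) \<le> 2 * r)
          \<and> (\<forall>k\<in>insert j K. v k \<in> U) \<longrightarrow> norm (A v) < e / 2"
        by (rule less.hyps) (use c2 less.prems j \<open>e / 2 > 0\<close> in auto)
      then show thesis using that by blast
    qed
    obtain Y where Y: "finite Y" "Y \<subseteq> cball 0 r" "\<And>u. norm u \<le> r \<Longrightarrow> \<exists>y\<in>Y. u - y \<in> U"
      using weak_nbhds_net[OF U(1)] by blast
    \<comment> \<open>With coordinate j frozen at y the neighbourhood depends on y; since the net is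
      finite, those for its points have a common refinement.\<close>
    have "\<exists>U\<in>weak_nbhds. \<forall>v. (\<forall>k. k \<notin> I - {j} \<longrightarrow> v k = (w(j := y)) k) \<and> (\<forall>k\<in>I - {j}. norm (v k) \<le> r)
        \<and> (\<forall>k\<in>K. v k \<in> U) \<longrightarrow> norm (A v) < e / 2" for y
      using c1 c3 less.prems j \<open>e / 2 > 0\<close> by (intro less.hyps) auto
    then obtain T where T: "\<And>y. T y \<in> weak_nbhds"
      "\<And>y v. (\<And>k. k \<notin> I - {j} \<Longrightarrow> v k = (w(j := y)) k) \<Longrightarrow> (\<And>k. k \<in> I - {j} \<Longrightarrow> norm (v k) \<le> r)
        \<Longrightarrow> (\<And>k. k \<in> K \<Longrightarrow> v k \<in> T y) \<Longrightarrow> norm (A v) < e / 2"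
      by metis
    obtain W where W: "W \<in> weak_nbhds" "\<forall>y\<in>Y. W \<subseteq> T y"
      using weak_nbhds_INT[OF Y(1), of T] T(1) by blast
    obtain W' where W': "W' \<in> weak_nbhds" "W' \<subseteq> W" "W' \<subseteq> U" using weak_nbhds_Int[OF W(1) U(1)] .
    have "norm (A v) < e" if v: "\<forall>k. k \<notin> I \<longrightarrow> v k = w k" "\<forall>k\<in>I. norm (v k) \<le> r" "\<forall>k\<in>K. v k \<in> W'" for v
    proof -
      obtain y where y: "y \<in> Y" "v j - y \<in> U" using Y(3) v(2) j(1) by blast
      have "r \<ge> 0" using v(2) j(1) norm_ge_zero order_trans by blast
      have "A v = A (v(j := (v j - y) + y))" by simp
      also have "\<dots> = A (v(j := v j - y)) + A (v(j := y))"
        using less.prems j by (intro add) auto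
      finally have Av: "norm (A v) \<le> norm (A (v(j := v j - y))) + norm (A (v(j := y)))"
        using norm_triangle_ineq by simp
      have "norm (A (v(j := v j - y))) < e / 2"
      proof (rule U(2))
        have "norm (v j - y) \<le> norm (v j) + norm y" by (rule norm_triangle_ineq4)
        also have "\<dots> \<le> 2 * r" using v(2) j(1) y(1) Y(2) by force
        finally have yj: "norm (v j - y) \<le> 2 * r" .
        show "norm ((v(j := v j - y)) k) \<le> 2 * r" if "k \<in> I" for k
          using yj v(2) \<open>r \<ge> 0\<close> that by fastforce
        show "(v(j := v j - y)) k \<in> U" if "k \<in> insert j K" for k
          using y(2) v(3) W' that by auto
        show "(v(j := v j - y)) k = w k" if "k \<notin> I" for k using v(1) j(1) that by auto
      qed
      moreover have "norm (A (v(j := y))) < e / 2"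
      proof (rule T(2)[where y = y])
        have "W' \<subseteq> T y" using W'(2) W(2) y(1) by blast
        then show "(v(j := y)) k \<in> T y" if "k \<in> K" for k using v(3) that j(2) by auto
      qed (use v in auto)
      ultimately show ?thesis using Av by linarith
    qed
    then show ?thesis using W'(1) by blast
  qed
qed

text \<open>Exchange the coordinates of v for those of v' one at a time. By additivity each exchange
  costs the value of A at a family with v j - v' j in place j, a weakly small vector of norm at most
  2 * r, and \<open>multiadditive_small\<close> with a singleton K bounds this uniformly in the
  other coordinates.\<close>

lemma multiadditive_uniform:
  fixes A :: "(nat \<Rightarrow> 'a) \<Rightarrow> 'c::real_normed_vector"
  assumes I\<^sub>0: "finite I\<^sub>0"
    and add: "\<And>i v u w. i \<in> I\<^sub>0 \<Longrightarrow> A (v(i := u + w)) = A (v(i := u)) + A (v(i := w))"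
    and cont: "\<And>w r e. e > 0 \<Longrightarrow> \<exists>U\<in>weak_nbhds. \<forall>v. (\<forall>k\<in>I\<^sub>0. norm (v k) \<le> r \<and> v k - w k \<in> U)
      \<and> (\<forall>k. k \<notin> I\<^sub>0 \<longrightarrow> v k = w k) \<longrightarrow> norm (A v - A w) < e"
    and e: "e > 0"
  shows "\<exists>U\<in>weak_nbhds. \<forall>v v'. (\<forall>k\<in>I\<^sub>0. norm (v k) \<le> r \<and> norm (v' k) \<le> r \<and> v k - v' k \<in> U)
    \<and> (\<forall>k. k \<notin> I\<^sub>0 \<longrightarrow> v k = w k \<and> v' k = w k) \<longrightarrow> norm (A v - A v') < e"
proof -
  \<comment> \<open>One d is spent per exchange; the summand 1 in the denominator keeps the total
    strictly below e.\<close>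
  define d where "d = e / (real (card I\<^sub>0) + 1)"
  have d: "d > 0" using e by (simp add: d_def)
  have "\<exists>U\<in>weak_nbhds. \<forall>v. (\<forall>k. k \<notin> I\<^sub>0 \<longrightarrow> v k = w k) \<and> (\<forall>k\<in>I\<^sub>0. norm (v k) \<le> 2 * r)
    \<and> (\<forall>k\<in>{i}. v k \<in> U) \<longrightarrow> norm (A v) < d" if "i \<in> I\<^sub>0" for i
    by (rule multiadditive_small[OF I\<^sub>0 add cont order_refl _ _ d]) (use that in auto)
  then have "\<exists>U. \<forall>i\<in>I\<^sub>0. U i \<in> weak_nbhds \<and> (\<forall>v. (\<forall>k. k \<notin> I\<^sub>0 \<longrightarrow> v k = w k) \<and> (\<forall>k\<in>I\<^sub>0. norm (v k) \<le> 2 * r)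
    \<and> v i \<in> U i \<longrightarrow> norm (A v) < d)"
    by (intro bchoice) auto
  then obtain U where U: "\<And>i. i \<in> I\<^sub>0 \<Longrightarrow> U i \<in> weak_nbhds"
    "\<And>i v. i \<in> I\<^sub>0 \<Longrightarrow> (\<And>k. k \<notin> I\<^sub>0 \<Longrightarrow> v k = w k) \<Longrightarrow> (\<And>k. k \<in> I\<^sub>0 \<Longrightarrow> norm (v k) \<le> 2 * r)
      \<Longrightarrow> v i \<in> U i \<Longrightarrow> norm (A v) < d"
    by blast
  obtain W where W: "W \<in> weak_nbhds" "\<And>i. i \<in> I\<^sub>0 \<Longrightarrow> W \<subseteq> U i"
    using weak_nbhds_INT[of I\<^sub>0 U] I\<^sub>0 U(1) by blast
  have "norm (A v - A v') < e"
    if v: "\<And>k. k \<in> I\<^sub>0 \<Longrightarrow> norm (v k) \<le> r \<and> norm (v' k) \<le> r \<and> v k - v' k \<in> W"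
      "\<And>k. k \<notin> I\<^sub>0 \<Longrightarrow> v k = w k \<and> v' k = w k" for v v'
  proof -
    let ?h = "\<lambda>J k. if k \<in> J then v' k else v k"
    have "norm (A v - A (?h J)) \<le> real (card J) * d" if "finite J" "J \<subseteq> I\<^sub>0" for J
      using that
    proof (induction J)
      case (insert j J)
      then have j: "j \<in> I\<^sub>0" and IH: "norm (A v - A (?h J)) \<le> real (card J) * d" by auto
      have bd: "norm (x k) \<le> 2 * r" if "norm (x k) \<le> r" for x :: "nat \<Rightarrow> 'a" and k
      proof -
        have "r \<ge> 0" using that norm_ge_zero order_trans by blast
        then show ?thesis using that by simp
      qed
      have h1: "?h J = (?h J)(j := (v j - v' j) + v' j)" using insert.hyps by auto
      have h2: "?h (insert j J) = (?h J)(j := v' j)" by auto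
      have "A (?h J) - A (?h (insert j J)) = A ((?h J)(j := v j - v' j))"
        unfolding h2 by (subst h1, subst add[OF j]) simp
      also have "norm \<dots> < d"
      proof (rule U(2)[OF j])
        fix k assume k: "k \<in> I\<^sub>0"
        have "norm (v j - v' j) \<le> 2 * r"
          using norm_triangle_ineq4[of "v j" "v' j"] v(1)[OF j] by linarith
        then show "norm (((?h J)(j := v j - v' j)) k) \<le> 2 * r"
          using v(1)[OF k] bd by auto
      next
        show "((?h J)(j := v j - v' j)) j \<in> U j" using v(1)[OF j] W(2)[OF j] by auto
      qed (use v(2) j in auto)
      finally have "norm (A v - A (?h J)) + norm (A (?h J) - A (?h (insert j J))) \<le> real (card J) * d + d"
        using IH by linarith
      then have "norm (A v - A (?h (insert j J))) \<le> real (card J) * d + d"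
        using norm_triangle_ineq[of "A v - A (?h J)" "A (?h J) - A (?h (insert j J))"] by simp
      also have "\<dots> = real (card (insert j J)) * d" using insert.hyps by (simp add: algebra_simps)
      finally show ?case .
    qed simp
    from this[OF I\<^sub>0 order_refl] have "norm (A v - A (?h I\<^sub>0)) \<le> real (card I\<^sub>0) * d" .
    also have "?h I\<^sub>0 = v'" using v(2) by auto
    also have "real (card I\<^sub>0) * d < e" using e by (simp add: d_def field_simps)
    finally show ?thesis .
  qed
  then show ?thesis using W(1) by blast
qed

section \<open>Iterated extensions\<close>

text \<open>The bound C is a parameter because fixing the first argument at x changes it to
  \<open>C * norm x\<close>; this is what bounds the partial extensions as functionals of x.\<close>

definition bounded_form :: "nat \<Rightarrow> real \<Rightarrow> ('a list \<Rightarrow> 'k) \<Rightarrow> bool"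
  where "bounded_form k C B \<longleftrightarrow> 0 \<le> C
    \<and> (\<forall>xs i. length xs = k \<longrightarrow> i < k \<longrightarrow> (\<forall>u w. B (xs[i := u + w]) = B (xs[i := u]) + B (xs[i := w]))
        \<and> (\<forall>c u. B (xs[i := scale c u]) = c * B (xs[i := u])))
    \<and> (\<forall>xs. length xs = k \<longrightarrow> norm (B xs) \<le> C * prod_list (map norm xs))"

lemma bounded_form_Cons:
  assumes "bounded_form (Suc k) C B" shows "bounded_form k (C * norm x) (\<lambda>xs. B (x # xs))"
  unfolding bounded_form_def
proof (intro conjI allI impI)
  fix xs :: "'a list" and i u w c assume xs: "length xs = k" "i < k"
  have "length (x # xs) = Suc k" "Suc i < Suc k" using xs by auto
  then have "B ((x # xs)[Suc i := u + w]) = B ((x # xs)[Suc i := u]) + B ((x # xs)[Suc i := w])"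
    "B ((x # xs)[Suc i := scale c u]) = c * B ((x # xs)[Suc i := u])"
    using assms unfolding bounded_form_def by blast+
  then show "B (x # xs[i := u + w]) = B (x # xs[i := u]) + B (x # xs[i := w])"
    "B (x # xs[i := scale c u]) = c * B (x # xs[i := u])" by simp_all
next
  fix xs :: "'a list" assume "length xs = k"
  then have "length (x # xs) = Suc k" by simp
  then have "norm (B (x # xs)) \<le> C * prod_list (map norm (x # xs))"
    using assms unfolding bounded_form_def by blast
  then show "norm (B (x # xs)) \<le> C * norm x * prod_list (map norm xs)" by (simp add: mult.assoc)
qed (use assms in \<open>auto simp: bounded_form_def\<close>)

lemma bounded_form_head:
  assumes "bounded_form (Suc k) C B" "length xs = k"
  shows "B ((x + y) # xs) = B (x # xs) + B (y # xs)" "B (scale c x # xs) = c * B (x # xs)"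
proof -
  have "length (0 # xs) = Suc k" "0 < Suc k" using assms by auto
  then have "B ((0 # xs)[0 := x + y]) = B ((0 # xs)[0 := x]) + B ((0 # xs)[0 := y])"
    "B ((0 # xs)[0 := scale c x]) = c * B ((0 # xs)[0 := x])"
    using assms(1) unfolding bounded_form_def by blast+
  then show "B ((x + y) # xs) = B (x # xs) + B (y # xs)" "B (scale c x # xs) = c * B (x # xs)"
    by simp_all
qed

lemma iterated_ext_cong:
  assumes "\<And>xs. length xs = length zs \<Longrightarrow> B xs = B' xs"
  shows "iterated_ext zs B = iterated_ext zs B'"
  using assms
proof (induction zs arbitrary: B B')
  case (Cons z zs)
  have "iterated_ext zs (\<lambda>xs. B (x # xs)) = iterated_ext zs (\<lambda>xs. B' (x # xs))" for x
    by (rule Cons.IH) (simp add: Cons.prems)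
  then show ?case by simp
qed simp

context
  fixes z assumes z: "z \<in> unit_ball (dual (dual_space scale))"
begin

lemma z_dual: "z \<in> carr (dual (dual_space scale))"
  using z by (simp add: unit_ball_def)

text \<open>The four claims need each other: linearity of z is available only on bounded
  functionals, so at stage k + 1 the inner function has to be recognised as one, and that uses
  boundedness and linearity at stage k.\<close>

lemma iterated_ext_linear:
  "(\<forall>C B. bounded_form k C B \<longrightarrow> norm (iterated_ext (replicate k z) B) \<le> C)
    \<and> (\<forall>C D B B'. bounded_form k C B \<longrightarrow> bounded_form k D B' \<longrightarrow>
        iterated_ext (replicate k z) (\<lambda>xs. B xs + B' xs)
          = iterated_ext (replicate k z) B + iterated_ext (replicate k z) B')
    \<and> (\<forall>C B c. bounded_form k C B \<longrightarrow>
        iterated_ext (replicate k z) (\<lambda>xs. c * B xs) = c * iterated_ext (replicate k z) B)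
    \<and> (\<forall>C B. bounded_form (Suc k) C B \<longrightarrow>
        (\<lambda>x. iterated_ext (replicate k z) (\<lambda>xs. B (x # xs))) \<in> functionals scale
        \<and> nrm (dual_space scale) (\<lambda>x. iterated_ext (replicate k z) (\<lambda>xs. B (x # xs))) \<le> C)"
    (is "?bound k \<and> ?add k \<and> ?scal k \<and> ?step k")
proof (induction k)
  have step: "?step k" if bound: "?bound k" and add: "?add k" and scal: "?scal k" for k
  proof (intro allI impI conjI)
    fix C B assume B: "bounded_form (Suc k) C B"
    let ?g = "\<lambda>x. iterated_ext (replicate k z) (\<lambda>xs. B (x # xs))"
    note b = bounded_form_Cons[OF B]
    have le: "norm (?g x) \<le> C * norm x" for x using bound b by blast
    show "?g \<in> functionals scale"
    proof (rule ws.dual_memI[OF _ _ le])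
      fix x y c
      have "?g (x + y) = iterated_ext (replicate k z) (\<lambda>xs. B (x # xs) + B (y # xs))"
        by (rule iterated_ext_cong) (simp add: bounded_form_head[OF B])
      also have "\<dots> = ?g x + ?g y" using add b by blast
      finally show "?g (x + y) = ?g x + ?g y" .
      have "?g (scale c x) = iterated_ext (replicate k z) (\<lambda>xs. c * B (x # xs))"
        by (rule iterated_ext_cong) (simp add: bounded_form_head[OF B])
      also have "\<dots> = c * ?g x" using scal b by blast
      finally show "?g (scale c x) = c * ?g x" .
    qed simp
    show "nrm (dual_space scale) ?g \<le> C"
      by (rule ws.nrm_dual_le[OF le]) (use B in \<open>simp add: bounded_form_def\<close>)
  qed
  case 0
  have "?bound 0" "?add 0" "?scal 0" by (auto simp: bounded_form_def)
  with step show ?case by blast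
  case (Suc k)
  then have IH: "?bound k" "?add k" "?scal k" "?step k" by blast+
  have 1: "?bound (Suc k)"
  proof (intro allI impI)
    fix C B assume B: "bounded_form (Suc k) C B"
    have "norm (z (\<lambda>x. iterated_ext (replicate k z) (\<lambda>xs. B (x # xs)))) \<le> C"
      using IH(4) B ds.unit_ball_dual_bound[OF z] order_trans by blast
    then show "norm (iterated_ext (replicate (Suc k) z) B) \<le> C" by simp
  qed
  have 2: "?add (Suc k)"
  proof (intro allI impI)
    fix C D B B' assume B: "bounded_form (Suc k) C B" "bounded_form (Suc k) D B'"
    have "iterated_ext (replicate k z) (\<lambda>xs. B (x # xs) + B' (x # xs))
      = iterated_ext (replicate k z) (\<lambda>xs. B (x # xs)) + iterated_ext (replicate k z) (\<lambda>xs. B' (x # xs))" for x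
      using IH(2) bounded_form_Cons[OF B(1), of x] bounded_form_Cons[OF B(2), of x] by blast
    moreover have "z (f + g) = z f + z g" if "f \<in> functionals scale" "g \<in> functionals scale" for f g
      by (rule ds.dual_add[OF z_dual that])
    ultimately show "iterated_ext (replicate (Suc k) z) (\<lambda>xs. B xs + B' xs)
      = iterated_ext (replicate (Suc k) z) B + iterated_ext (replicate (Suc k) z) B'"
      using IH(4) B by (simp add: plus_fun_def)
  qed
  have 3: "?scal (Suc k)"
  proof (intro allI impI)
    fix C B c assume B: "bounded_form (Suc k) C B"
    have "iterated_ext (replicate k z) (\<lambda>xs. c * B (x # xs)) = c * iterated_ext (replicate k z) (\<lambda>xs. B (x # xs))" for x
      using IH(3) bounded_form_Cons[OF B, of x] by blast
    moreover have "z (\<lambda>x. c * f x) = c * z f" if "f \<in> functionals scale" for f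
      using ds.dual_smul[OF z_dual that, of c] by (simp add: dual_def)
    ultimately show "iterated_ext (replicate (Suc k) z) (\<lambda>xs. c * B xs) = c * iterated_ext (replicate (Suc k) z) B"
      using IH(4) B by simp
  qed
  from step[OF 1 2 3] 1 2 3 show ?case by blast
qed

lemma iterated_ext_functional:
  assumes "bounded_form (Suc k) C B"
  shows "(\<lambda>x. iterated_ext (replicate k z) (\<lambda>xs. B (x # xs))) \<in> functionals scale"
  using iterated_ext_linear[of k] assms by blast

text \<open>The inner extension is a functional g of the first variable. Goldstine's theorem for F
  together with g supplies a point x of V at which g nearly takes the value z g, and the induction
  hypothesis bounds g x - c.\<close>

lemma iterated_ext_approx:
  assumes F: "finite F" "F \<subseteq> functionals scale" and d: "d > 0"
    and V: "V = {x. norm x \<le> 1 \<and> (\<forall>f\<in>F. norm (f x - z f) < d)}"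
    and B: "bounded_form k C B"
    and close: "\<And>xs. length xs = k \<Longrightarrow> set xs \<subseteq> V \<Longrightarrow> norm (B xs - c) \<le> e"
  shows "norm (iterated_ext (replicate k z) B - c) \<le> e"
  using B close
proof (induction k arbitrary: B C)
  case (Suc k)
  let ?g = "\<lambda>x. iterated_ext (replicate k z) (\<lambda>xs. B (x # xs))"
  have g: "?g \<in> functionals scale" by (rule iterated_ext_functional[OF Suc.prems(1)])
  have gV: "norm (?g x - c) \<le> e" if "x \<in> V" for x
    by (rule Suc.IH[OF bounded_form_Cons[OF Suc.prems(1)]]) (use that Suc.prems(2) in simp)
  have "norm (z ?g - c) \<le> e"
  proof (rule field_le_epsilon)
    fix h :: real assume h: "h > 0"
    obtain x where x: "norm x \<le> 1" "\<And>f. f \<in> insert ?g F \<Longrightarrow> norm (f x - z f) < min d h"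
      using Goldstine[OF z, of "insert ?g F" "min d h"] F g d h by auto
    have "x \<in> V" using x V by auto
    have "norm (z ?g - c) \<le> norm (?g x - z ?g) + norm (?g x - c)"
      using norm_triangle_ineq4[of "?g x - c" "?g x - z ?g"] by simp
    also have "\<dots> \<le> h + e" using x(2)[of ?g] gV[OF \<open>x \<in> V\<close>] by simp
    finally show "norm (z ?g - c) \<le> e + h" by simp
  qed
  then show ?case by simp
qed simp

text \<open>Homogeneity of degree k in z; it later permits renormalising a z of norm below
  1.\<close>

lemma iterated_ext_scaleR:
  assumes w: "\<And>f. f \<in> functionals scale \<Longrightarrow> w f = of_real s * z f" and B: "bounded_form k C B"
  shows "iterated_ext (replicate k w) B = of_real (s ^ k) * iterated_ext (replicate k z) B"
  using B
proof (induction k arbitrary: B C)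
  case (Suc k)
  let ?g = "\<lambda>x. iterated_ext (replicate k z) (\<lambda>xs. B (x # xs))"
  have g: "?g \<in> functionals scale" by (rule iterated_ext_functional[OF Suc.prems])
  have "iterated_ext (replicate (Suc k) w) B = w (\<lambda>x. of_real (s ^ k) * ?g x)"
    using Suc.IH[OF bounded_form_Cons[OF Suc.prems]] by simp
  also have "\<dots> = of_real s * z (\<lambda>x. of_real (s ^ k) * ?g x)"
    using ds.smul_mem[OF g, of "of_real (s ^ k)"] by (intro w) (simp add: dual_def)
  also have "z (\<lambda>x. of_real (s ^ k) * ?g x) = of_real (s ^ k) * z ?g"
    using ds.dual_smul[OF z_dual g, of "of_real (s ^ k)"] by (simp add: dual_def)
  finally show ?case by simp
qed simp

end

end

section \<open>Spaces of homogeneous polynomials\<close>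

context normed_pair
begin

lemma multilinear_coord_eq:
  assumes "multilinear n sE sF A" "i < n"
  shows "A (map (v(i := u + w)) [0..<n]) = A (map (v(i := u)) [0..<n]) + A (map (v(i := w)) [0..<n])"
    and "A (map (v(i := sE c u)) [0..<n]) = sF c (A (map (v(i := u)) [0..<n]))"
  using multilinear_coord[OF assms, of v] unfolding linear_iff by blast+

lemma multilinear_scale:
  assumes A: "multilinear n sE sF A"
  shows "A (map (\<lambda>k. sE (c k) (v k)) [0..<n]) = sF (\<Prod>k<n. c k) (A (map v [0..<n]))"
proof -
  have "A (map (\<lambda>k. if k < m then sE (c k) (v k) else v k) [0..<n]) = sF (\<Prod>k<m. c k) (A (map v [0..<n]))"
    if "m \<le> n" for m
    using that
  proof (induction m)
    case (Suc m)
    let ?h = "\<lambda>m k. if k < m then sE (c k) (v k) else v k"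
    have 1: "?h (Suc m) = (?h m)(m := sE (c m) (v m))" and 2: "(?h m)(m := v m) = ?h m"
      by (auto simp: fun_eq_iff less_Suc_eq)
    have "A (map (?h (Suc m)) [0..<n]) = sF (c m) (A (map (?h m) [0..<n]))"
      unfolding 1 using multilinear_coord_eq(2)[OF A, of m "?h m" "c m" "v m"] Suc.prems
      by (simp only: 2 Suc_le_eq)
    then show ?case using Suc by (simp add: mult.commute)
  qed simp
  moreover have "map (\<lambda>k. if k < n then sE (c k) (v k) else v k) [0..<n] = map (\<lambda>k. sE (c k) (v k)) [0..<n]"
    by simp
  ultimately show ?thesis by (metis order_refl)
qed

lemma polyE:
  assumes "P \<in> polys n sE sF"
  obtains A where "multilinear n sE sF A" "\<And>x. P x = A (replicate n x)" "continuous_on UNIV P"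
  using assms unfolding polys_def by blast

lemma poly_scale:
  assumes "P \<in> polys n sE sF" shows "P (sE c x) = sF (c ^ n) (P x)"
proof -
  obtain A where A: "multilinear n sE sF A" "\<And>x. P x = A (replicate n x)"
    using polyE[OF assms] by metis
  have "A (map (\<lambda>k. sE c x) [0..<n]) = sF (\<Prod>k<n. c) (A (map (\<lambda>_. x) [0..<n]))"
    by (rule multilinear_scale[OF A(1)])
  then show ?thesis by (simp add: A(2) map_replicate_const)
qed

lemma poly_scaleR: "P \<in> polys n sE sF \<Longrightarrow> P (r *\<^sub>R x) = (r ^ n) *\<^sub>R P x"
  using poly_scale[of P n "of_real r" x] by (simp add: E.scale_of_real flip: of_real_power F.scale_of_real)

lemma poly_bound:
  assumes P: "P \<in> polys n sE sF" and n: "n \<ge> 1"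
  obtains C where "0 \<le> C" "\<And>x. norm (P x) \<le> C * norm x ^ n"
proof -
  have P0: "P 0 = 0" using poly_scaleR[OF P, of 0 0] n by (simp add: power_0_left)
  have "isCont P 0" using P unfolding polys_def by (simp add: continuous_on_eq_continuous_at)
  then obtain d where d: "d > 0" "\<And>x. norm x < d \<Longrightarrow> norm (P x) < 1"
    unfolding continuous_at_eps_delta by (metis P0 diff_zero dist_norm zero_less_one)
  show thesis
  proof (rule that)
    fix x
    show "norm (P x) \<le> (2 / d) ^ n * norm x ^ n"
    proof (cases "x = 0")
      case False
      \<comment> \<open>The scaled vector has norm d / 2, inside the ball where P is below 1;
        undoing the scaling produces the constant (2 / d) ^ n.\<close>
      let ?r = "d / (2 * norm x)"
      have "norm (?r *\<^sub>R x) < d" using False d(1) by simp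
      then have "norm (P (?r *\<^sub>R x)) \<le> 1" using d(2) less_imp_le by blast
      then have "?r ^ n * norm (P x) \<le> 1" using d(1) by (simp add: poly_scaleR[OF P])
      then have "norm (P x) \<le> 1 / ?r ^ n"
        using False d(1) by (simp add: field_simps)
      also have "1 / ?r ^ n = (2 / d) ^ n * norm x ^ n"
        using False d(1) by (simp add: power_divide power_mult_distrib)
      finally show ?thesis .
    qed (simp add: P0 d(1) less_imp_le)
  qed (use d(1) in simp)
qed

lemma poly_bdd_above:
  assumes "P \<in> polys n sE sF" "n \<ge> 1"
  shows "bdd_above ((\<lambda>x. norm (P x)) ` cball 0 1)"
proof -
  obtain C where C: "0 \<le> C" "\<And>x. norm (P x) \<le> C * norm x ^ n" using poly_bound[OF assms] by blast
  show ?thesis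
  proof (rule bdd_aboveI2)
    fix x :: 'a assume "x \<in> cball 0 1"
    then have "norm x ^ n \<le> 1" by (simp add: power_le_one)
    then show "norm (P x) \<le> C" using C(2)[of x] mult_left_mono[OF _ C(1)] by fastforce
  qed
qed

definition poly_norm :: "('a \<Rightarrow> 'b) \<Rightarrow> real"
  where "poly_norm P = (SUP x\<in>cball 0 1. norm (P x))"

lemma poly_space_sel [simp]:
  "carr (poly_space sF J) = J" "smul (poly_space sF J) = (\<lambda>c P x. sF c (P x))"
  "nrm (poly_space sF J) = poly_norm"
  by (simp_all add: poly_space_def poly_norm_def fun_eq_iff)

lemma poly_norm_upper:
  assumes "P \<in> polys n sE sF" "n \<ge> 1" "norm x \<le> 1" shows "norm (P x) \<le> poly_norm P"
  unfolding poly_norm_def using assms by (intro cSUP_upper poly_bdd_above) auto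

lemma poly_norm_least:
  assumes "\<And>x. norm x \<le> 1 \<Longrightarrow> norm (P x) \<le> c" shows "poly_norm P \<le> c"
  unfolding poly_norm_def using assms by (intro cSUP_least) auto

lemma module_polys: "module (\<lambda>c (P :: 'a \<Rightarrow> 'b) x. sF c (P x))"
  by standard (simp_all add: fun_eq_iff F.scale_right_distrib F.scale_left_distrib)

lemma nspace_poly_space:
  assumes J: "module.subspace (\<lambda>c P x. sF c (P x)) J" "J \<subseteq> polys n sE sF" and n: "n \<ge> 1"
  shows "nspace (poly_space sF J)"
proof
  note sub = J(1)[unfolded module.subspace_def[OF module_polys]]
  show "0 \<in> carr (poly_space sF J)" using sub by simp
  show mem: "v \<in> carr (poly_space sF J) \<Longrightarrow> smul (poly_space sF J) c v \<in> carr (poly_space sF J)" for c v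
    using sub by simp
  fix u v :: "'a \<Rightarrow> 'b" and a b c :: 'k and r :: real
  show "smul (poly_space sF J) c (u + v) = smul (poly_space sF J) c u + smul (poly_space sF J) c v"
    "smul (poly_space sF J) (a + b) v = smul (poly_space sF J) a v + smul (poly_space sF J) b v"
    "smul (poly_space sF J) a (smul (poly_space sF J) b v) = smul (poly_space sF J) (a * b) v"
    "smul (poly_space sF J) (of_real r) v = r *\<^sub>R v"
    by (simp_all add: fun_eq_iff F.scale_right_distrib F.scale_left_distrib F.scale_of_real scaleR_fun_def)
  assume v: "v \<in> carr (poly_space sF J)"
  then have vP: "v \<in> polys n sE sF" using J by auto
  have "0 \<le> norm (v 0)" by simp
  also have "\<dots> \<le> poly_norm v" by (rule poly_norm_upper[OF vP n]) simp
  finally show nn: "0 \<le> nrm (poly_space sF J) v" by simp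
  have le: "poly_norm (\<lambda>x. sF c (w x)) \<le> norm c * poly_norm w" if "w \<in> J" for w c
  proof (rule poly_norm_least)
    fix x :: 'a assume "norm x \<le> 1"
    then have "norm (w x) \<le> poly_norm w" using poly_norm_upper[of w n x] that J n by auto
    then show "norm (sF c (w x)) \<le> norm c * poly_norm w" by (simp add: F.norm_scale mult_left_mono)
  qed
  show "nrm (poly_space sF J) (smul (poly_space sF J) c v) = norm c * nrm (poly_space sF J) v"
  proof (cases "c = 0")
    case True
    have "0 \<le> norm (sF 0 (v 0))" by simp
    also have "\<dots> \<le> poly_norm (\<lambda>x. sF 0 (v x))"
      using poly_norm_upper[of "\<lambda>x. sF 0 (v x)" n 0] mem[OF v, of 0] J n by auto
    finally show ?thesis using True le[of v 0] v by simp
  next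
    case False
    have "poly_norm v = poly_norm (\<lambda>x. sF (1 / c) (sF c (v x)))" using False by simp
    also have "\<dots> \<le> norm (1 / c) * poly_norm (\<lambda>x. sF c (v x))"
      using le[OF mem[OF v, of c, simplified], of "1 / c"] by simp
    finally have "norm c * poly_norm v \<le> poly_norm (\<lambda>x. sF c (v x))"
      using False by (simp add: norm_divide field_simps)
    then show ?thesis using le[of v c] v by simp
  qed
  show "u \<in> carr (poly_space sF J) \<Longrightarrow> u + v \<in> carr (poly_space sF J)" using sub v by simp
qed

lemma eval_tensor_unit_ball:
  assumes J: "module.subspace (\<lambda>c P x. sF c (P x)) J" "J \<subseteq> polys n sE sF" and n: "n \<ge> 1"
    and x: "norm x \<le> 1" and y: "y \<in> unit_ball (dual_space sF)"
  shows "eval_tensor J x y \<in> unit_ball (dual (poly_space sF J))"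
proof -
  interpret X: nspace "poly_space sF J" by (rule nspace_poly_space[OF J n])
  have yd: "y \<in> functionals sF" using y by (simp add: unit_ball_def)
  show ?thesis
  proof (rule X.unit_ball_dualI)
    fix P assume P: "P \<in> carr (poly_space sF J)"
    have "norm (y (P x)) \<le> norm (P x)" by (rule F.ws.unit_ball_dual_bound[OF y UNIV_I])
    also have "\<dots> \<le> poly_norm P" using poly_norm_upper[of P n x] P J x n by auto
    finally show "norm (eval_tensor J x y P) \<le> nrm (poly_space sF J) P"
      using P by (simp add: eval_tensor_def)
  qed (use X.add_mem X.smul_mem in \<open>auto simp: eval_tensor_def F.ws.dual_add[OF yd] F.ws.dual_smul[OF yd]\<close>)
qed

text \<open>Homogeneity moves the supremum from the ball to the sphere, and a norming functional of
  F turns the norm of P x into a real part. Nonzero E and F provide at least one pair, which gives c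
  \<ge> 0.\<close>

lemma eval_tensor_norming:
  assumes P: "P \<in> polys n sE sF" and n: "n \<ge> 1"
    and nz: "\<exists>x::'a. x \<noteq> 0" "\<exists>y::'b. y \<noteq> 0"
    and le: "\<And>x y. norm x = 1 \<Longrightarrow> y \<in> unit_sphere (dual_space sF) \<Longrightarrow> re (y (P x)) \<le> c"
  shows "poly_norm P \<le> c"
proof (rule poly_norm_least)
  obtain b :: 'b where "b \<noteq> 0" using nz by blast
  then obtain y0 where y0: "y0 \<in> unit_sphere (dual_space sF)" by (rule F.norming_functional)
  have sph: "norm (P x) \<le> c" if "norm x = 1" for x
  proof (cases "P x = 0")
    case True
    have "y0 0 = 0" using y0 by (intro F.ws.dual_0) (simp add: unit_sphere_def)
    then show ?thesis using le[OF that y0] True by simp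
  next
    case False
    then obtain y where "y \<in> unit_sphere (dual_space sF)" "re (y (P x)) = norm (P x)"
      by (rule F.norming_functional)
    then show ?thesis using le[OF that] by metis
  qed
  obtain a :: 'a where "a \<noteq> 0" using nz by blast
  then have "norm ((1 / norm a) *\<^sub>R a) = 1" by simp
  from sph[OF this] have c: "0 \<le> c" using norm_ge_zero order_trans by blast
  fix x :: 'a assume x: "norm x \<le> 1"
  show "norm (P x) \<le> c"
  proof (cases "x = 0")
    case True
    then show ?thesis using poly_scaleR[OF P, of 0 0] n c by (simp add: power_0_left)
  next
    case False
    have "P x = P (norm x *\<^sub>R ((1 / norm x) *\<^sub>R x))" using False by simp
    also have "\<dots> = norm x ^ n *\<^sub>R P ((1 / norm x) *\<^sub>R x)" by (rule poly_scaleR[OF P])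
    finally have "norm (P x) = norm x ^ n * norm (P ((1 / norm x) *\<^sub>R x))" by (metis abs_norm_cancel norm_scaleR power_abs)
    also have "\<dots> \<le> 1 * c"
      using sph[of "(1 / norm x) *\<^sub>R x"] False x c by (intro mult_mono) (auto simp: power_le_one)
    finally show ?thesis by simp
  qed
qed

lemma extreme_functional_approx:
  assumes J: "module.subspace (\<lambda>c P x. sF c (P x)) J" "J \<subseteq> polys n sE sF" and n: "n \<ge> 1"
    and nz: "\<exists>x::'a. x \<noteq> 0" "\<exists>y::'b. y \<noteq> 0"
    and ext: "\<phi> extreme_point_of unit_ball (dual (poly_space sF J))"
    and Q: "finite Q" "Q \<subseteq> J" and e: "e > 0"
  obtains x y where "norm x = 1" "y \<in> unit_sphere (dual_space sF)"
    "\<And>P. P \<in> Q \<Longrightarrow> norm (y (P x) - \<phi> P) < e"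
proof -
  interpret X: nspace "poly_space sF J" by (rule nspace_poly_space[OF J n])
  let ?S = "sphere (0::'a) 1 \<times> unit_sphere (dual_space sF)"
  obtain a :: 'a where "a \<noteq> 0" using nz by blast
  then have a: "(1 / norm a) *\<^sub>R a \<in> sphere 0 1" by simp
  obtain b :: 'b where "b \<noteq> 0" using nz by blast
  then obtain y0 where "y0 \<in> unit_sphere (dual_space sF)" by (rule F.norming_functional)
  with a have S: "?S \<noteq> {}" by blast
  have "\<exists>i\<in>?S. \<forall>P\<in>Q. norm ((\<lambda>(x, y). eval_tensor J x y) i P - \<phi> P) < e"
  proof (rule X.extreme_point_approx[OF S _ _ ext Q(1) _ e])
    show "Q \<subseteq> carr (poly_space sF J)" using Q by simp
    show "(\<lambda>(x, y). eval_tensor J x y) i \<in> unit_ball (dual (poly_space sF J))" if "i \<in> ?S" for i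
      using that eval_tensor_unit_ball[OF J n] by (auto simp: unit_ball_def unit_sphere_def)
    fix P c assume P: "P \<in> carr (poly_space sF J)"
      and le: "\<And>i. i \<in> ?S \<Longrightarrow> re ((\<lambda>(x, y). eval_tensor J x y) i P) \<le> c"
    have "re (y (P x)) \<le> c" if "norm x = 1" "y \<in> unit_sphere (dual_space sF)" for x y
      using le[of "(x, y)"] that P by (simp add: eval_tensor_def)
    then show "nrm (poly_space sF J) P \<le> c"
      using eval_tensor_norming[of P n c] P J n nz by auto
  qed
  then obtain x y where "norm x = 1" "y \<in> unit_sphere (dual_space sF)" "\<forall>P\<in>Q. norm (eval_tensor J x y P - \<phi> P) < e"
    by auto
  then show thesis using that Q(2) by (auto simp: eval_tensor_def subset_iff)
qed

end

section \<open>Weak-star closure of the evaluation functionals\<close>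

lemma weak_star_open_basis:
  assumes "openin (weak_star X) T" "\<phi> \<in> T"
  obtains Q e where "finite Q" "Q \<subseteq> carr X" "e > 0"
    "\<And>\<psi>. \<psi> \<in> carr (dual X) \<Longrightarrow> (\<And>v. v \<in> Q \<Longrightarrow> norm (\<psi> v - \<phi> v) < e) \<Longrightarrow> \<psi> \<in> T"
proof -
  have "generate_topology_on {{\<phi> \<in> carr (dual X). \<phi> v \<in> U} | v U. v \<in> carr X \<and> open U} T"
    using assms(1) unfolding weak_star_def openin_topology_generated_by_iff .
  then have "\<exists>Q e. finite Q \<and> Q \<subseteq> carr X \<and> e > 0
    \<and> (\<forall>\<psi>\<in>carr (dual X). (\<forall>v\<in>Q. norm (\<psi> v - \<phi> v) < e) \<longrightarrow> \<psi> \<in> T)"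
    using assms(2)
  proof (induction rule: generate_topology_on.induct)
    case (Int A B)
    then obtain Q e Q' e' where "finite Q" "Q \<subseteq> carr X" "e > 0"
      "\<forall>\<psi>\<in>carr (dual X). (\<forall>v\<in>Q. norm (\<psi> v - \<phi> v) < e) \<longrightarrow> \<psi> \<in> A"
      "finite Q'" "Q' \<subseteq> carr X" "e' > 0"
      "\<forall>\<psi>\<in>carr (dual X). (\<forall>v\<in>Q'. norm (\<psi> v - \<phi> v) < e') \<longrightarrow> \<psi> \<in> B"
      by auto
    then show ?case by (intro exI[of _ "Q \<union> Q'"] exI[of _ "min e e'"]) auto
  next
    case (UN K)
    then obtain A where A: "A \<in> K" "\<phi> \<in> A" by blast
    have "\<exists>Q e. finite Q \<and> Q \<subseteq> carr X \<and> e > 0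
      \<and> (\<forall>\<psi>\<in>carr (dual X). (\<forall>v\<in>Q. norm (\<psi> v - \<phi> v) < e) \<longrightarrow> \<psi> \<in> A)"
      by (rule UN.IH[OF A])
    then show ?case using A(1) by (elim exE) (intro exI, auto)
  next
    case (Basis s)
    then obtain v U where v: "s = {\<phi> \<in> carr (dual X). \<phi> v \<in> U}" "v \<in> carr X" "open U" "\<phi> v \<in> U" by auto
    then obtain e where "e > 0" "\<And>c. dist c (\<phi> v) < e \<Longrightarrow> c \<in> U" unfolding open_dist by blast
    then show ?case using v by (intro exI[of _ "{v}"] exI[of _ e]) (auto simp: dist_norm)
  qed simp
  then obtain Q e where Q: "finite Q" "Q \<subseteq> carr X" "e > 0"
    and T: "\<forall>\<psi>\<in>carr (dual X). (\<forall>v\<in>Q. norm (\<psi> v - \<phi> v) < e) \<longrightarrow> \<psi> \<in> T"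
    by (elim exE conjE)
  show thesis by (rule that[OF Q]) (use T in auto)
qed

context normed_pair
begin

lemma extreme_functionals_subset_closure:
  assumes J: "module.subspace (\<lambda>c P x. sF c (P x)) J" "J \<subseteq> polys n sE sF" and n: "n \<ge> 1"
    and nz: "\<exists>x::'a. x \<noteq> 0" "\<exists>y::'b. y \<noteq> 0"
    and ext: "\<phi> extreme_point_of unit_ball (dual (poly_space sF J))"
  shows "\<phi> \<in> weak_star (poly_space sF J) closure_of
    {eval_tensor J x y | x y. x \<in> sphere 0 1 \<and> y \<in> unit_sphere (dual_space sF)}"
  unfolding in_closure_of
proof (intro conjI allI impI)
  interpret X: nspace "poly_space sF J" by (rule nspace_poly_space[OF J n])
  have \<phi>d: "\<phi> \<in> carr (dual (poly_space sF J))" using ext by (simp add: extreme_point_of_def unit_ball_def)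
  \<comment> \<open>The subbasic set given by evaluation at 0 and the whole scalar field is the
    entire dual, so \<phi> belongs to the underlying set of the topology.\<close>
  have "openin (weak_star (poly_space sF J)) {\<phi> \<in> carr (dual (poly_space sF J)). \<phi> 0 \<in> UNIV}"
    unfolding weak_star_def openin_topology_generated_by_iff
    by (rule generate_topology_on.Basis) (use X.zero_mem in blast)
  then show "\<phi> \<in> topspace (weak_star (poly_space sF J))"
    using \<phi>d openin_subset by fastforce
  fix T assume "\<phi> \<in> T \<and> openin (weak_star (poly_space sF J)) T"
  then obtain Q e where Q: "finite Q" "Q \<subseteq> J" "e > 0"
    "\<And>\<psi>. \<psi> \<in> carr (dual (poly_space sF J)) \<Longrightarrow> (\<And>v. v \<in> Q \<Longrightarrow> norm (\<psi> v - \<phi> v) < e) \<Longrightarrow> \<psi> \<in> T"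
    using weak_star_open_basis[of "poly_space sF J" T \<phi>] by auto
  obtain x y where xy: "norm x = 1" "y \<in> unit_sphere (dual_space sF)" "\<And>P. P \<in> Q \<Longrightarrow> norm (y (P x) - \<phi> P) < e"
    using extreme_functional_approx[OF J n nz ext Q(1-3)] by blast
  have "eval_tensor J x y \<in> T"
  proof (rule Q(4))
    have "eval_tensor J x y \<in> unit_ball (dual (poly_space sF J))"
      using xy by (intro eval_tensor_unit_ball[OF J n]) (auto simp: unit_ball_def unit_sphere_def)
    then show "eval_tensor J x y \<in> carr (dual (poly_space sF J))" by (simp add: unit_ball_def)
  qed (use xy(3) Q(2) in \<open>auto simp: eval_tensor_def subset_iff\<close>)
  then show "\<exists>\<psi>. \<psi> \<in> {eval_tensor J x y | x y. x \<in> sphere 0 1 \<and> y \<in> unit_sphere (dual_space sF)} \<and> \<psi> \<in> T"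
    using xy by auto
qed

section \<open>Weakly continuous polynomials\<close>

lemma multilinear_add: "multilinear n sE sF A \<Longrightarrow> multilinear n sE sF B \<Longrightarrow> multilinear n sE sF (\<lambda>xs. A xs + B xs)"
  unfolding multilinear_def linear_iff by (auto simp: F.scale_right_distrib)

lemma multilinear_smul: "multilinear n sE sF A \<Longrightarrow> multilinear n sE sF (\<lambda>xs. sF c (A xs))"
  unfolding multilinear_def linear_iff by (auto simp: F.scale_right_distrib F.scale_left_commute)

lemma continuous_on_smul: "continuous_on S f \<Longrightarrow> continuous_on S (\<lambda>x. sF c (f x))"
proof -
  have "bounded_linear (sF c)"
    by (rule bounded_linear_intro[where K = "norm c"])
      (simp_all add: F.scale_right_distrib F.scaleR_scale[symmetric] F.norm_scale)
  then show "continuous_on S f \<Longrightarrow> continuous_on S (\<lambda>x. sF c (f x))"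
    by (rule bounded_linear.continuous_on)
qed

lemma subspace_weakly_cont_polys:
  "module.subspace (\<lambda>c P x. sF c (P x)) (weakly_cont_polys n sE sF)"
  unfolding module.subspace_def[OF module_polys]
proof (intro conjI ballI allI)
  have "multilinear n sE sF (\<lambda>_. 0)" unfolding multilinear_def linear_iff by simp
  then show "0 \<in> weakly_cont_polys n sE sF"
    by (auto simp: weakly_cont_polys_def polys_def zero_fun_def intro!: exI[of _ "\<lambda>_. 0"])
next
  fix P Q assume P: "P \<in> weakly_cont_polys n sE sF" and Q: "Q \<in> weakly_cont_polys n sE sF"
  have "P \<in> polys n sE sF" "Q \<in> polys n sE sF" using P Q by (auto simp: weakly_cont_polys_def)
  then obtain A B where "multilinear n sE sF A" "\<And>x. P x = A (replicate n x)" "continuous_on UNIV P"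
    "multilinear n sE sF B" "\<And>x. Q x = B (replicate n x)" "continuous_on UNIV Q"
    by (metis polyE)
  then have "P + Q \<in> polys n sE sF"
    unfolding polys_def
    by (auto intro!: exI[of _ "\<lambda>xs. A xs + B xs"] multilinear_add simp: plus_fun_def continuous_on_add)
  moreover have "((\<lambda>u. norm ((P + Q) u - (P + Q) x)) \<longlongrightarrow> 0) \<F>"
    if "(\<exists>r. \<forall>\<^sub>F u in \<F>. norm u \<le> r) \<and> (\<forall>f\<in>functionals sE. (f \<longlongrightarrow> f x) \<F>)" for \<F> x
  proof -
    have "((\<lambda>u. norm (P u - P x)) \<longlongrightarrow> 0) \<F>" "((\<lambda>u. norm (Q u - Q x)) \<longlongrightarrow> 0) \<F>"
      using P Q that by (auto simp: weakly_cont_polys_def)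
    from tendsto_norm_zero[OF tendsto_add_zero[OF this[THEN tendsto_norm_zero_cancel]]]
    show ?thesis by (simp add: algebra_simps)
  qed
  ultimately show "P + Q \<in> weakly_cont_polys n sE sF" by (auto simp: weakly_cont_polys_def)
next
  fix c P assume P: "P \<in> weakly_cont_polys n sE sF"
  then have "P \<in> polys n sE sF" by (simp add: weakly_cont_polys_def)
  then obtain A where "multilinear n sE sF A" "\<And>x. P x = A (replicate n x)" "continuous_on UNIV P"
    by (metis polyE)
  then have "(\<lambda>x. sF c (P x)) \<in> polys n sE sF"
    unfolding polys_def
    by (auto intro!: exI[of _ "\<lambda>xs. sF c (A xs)"] multilinear_smul simp: continuous_on_smul)
  moreover have "((\<lambda>u. norm (sF c (P u) - sF c (P x))) \<longlongrightarrow> 0) \<F>"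
    if "(\<exists>r. \<forall>\<^sub>F u in \<F>. norm u \<le> r) \<and> (\<forall>f\<in>functionals sE. (f \<longlongrightarrow> f x) \<F>)" for \<F> x
  proof -
    have "((\<lambda>u. norm (P u - P x)) \<longlongrightarrow> 0) \<F>" using P that by (auto simp: weakly_cont_polys_def)
    from tendsto_mult_right_zero[OF this, of "norm c"]
    show ?thesis by (simp add: F.norm_scale flip: F.scale_right_diff_distrib)
  qed
  ultimately show "(\<lambda>x. sF c (P x)) \<in> weakly_cont_polys n sE sF" by (auto simp: weakly_cont_polys_def)
qed

text \<open>In the final perturbation argument one of these polynomials shows that an evaluation
  functional is nonzero.\<close>

lemma power_functional_weakly_cont:
  assumes f: "f \<in> functionals sE"
  shows "(\<lambda>x. sF (f x ^ n) b) \<in> weakly_cont_polys n sE sF"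
proof -
  define A where "A xs = (if length xs = n then sF (\<Prod>k<n. f (xs ! k)) b else 0)" for xs
  have "multilinear n sE sF A"
    unfolding multilinear_def linear_iff
  proof (intro conjI allI impI)
    fix xs :: "'a list" and i assume xs: "length xs = n" "i < n"
    have "(\<Prod>k<n. f (xs[i := u] ! k)) = f u * (\<Prod>k\<in>{..<n} - {i}. f (xs ! k))" for u
    proof -
      have "(\<Prod>k<n. f (xs[i := u] ! k)) = f (xs[i := u] ! i) * (\<Prod>k\<in>{..<n} - {i}. f (xs[i := u] ! k))"
        using xs by (intro prod.remove) auto
      also have "(\<Prod>k\<in>{..<n} - {i}. f (xs[i := u] ! k)) = (\<Prod>k\<in>{..<n} - {i}. f (xs ! k))"
        by (intro prod.cong) auto
      finally show ?thesis using xs by simp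
    qed
    then have A_eq: "A (xs[i := u]) = sF (f u * (\<Prod>k\<in>{..<n} - {i}. f (xs ! k))) b" for u
      using xs by (simp add: A_def)
    show "A (xs[i := u + w]) = A (xs[i := u]) + A (xs[i := w])" for u w
      by (simp add: A_eq E.ws.dual_add[OF f] distrib_right F.scale_left_distrib)
    show "A (xs[i := sE c u]) = sF c (A (xs[i := u]))" for c u
      by (simp add: A_eq E.ws.dual_smul[OF f] mult.assoc)
  qed (simp add: A_def)
  moreover have "sF (f x ^ n) b = A (replicate n x)" for x by (simp add: A_def)
  moreover have "continuous_on UNIV (\<lambda>x. sF (f x ^ n) b)"
  proof -
    have "bounded_linear f"
      by (rule bounded_linear_intro[where K = "nrm (dual_space sE) f"])
        (use E.ws.dual_bound[OF f] in \<open>simp_all add: E.ws.dual_add[OF f] E.ws.dual_scaleR[OF f] mult.commute\<close>)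
    moreover have "bounded_linear (\<lambda>c. sF c b)"
      by (rule bounded_linear_intro[where K = "norm b"])
        (simp_all add: F.scale_left_distrib F.norm_scale scaleR_conv_of_real F.scale_of_real flip: F.scale_scale)
    ultimately show ?thesis
      by (intro bounded_linear.continuous_on[of "\<lambda>c. sF c b"] continuous_on_power linear_continuous_on)
  qed
  ultimately have "(\<lambda>x. sF (f x ^ n) b) \<in> polys n sE sF" unfolding polys_def by blast
  moreover have "((\<lambda>u. norm (sF (f u ^ n) b - sF (f x ^ n) b)) \<longlongrightarrow> 0) \<F>"
    if "(f \<longlongrightarrow> f x) \<F>" for \<F> x
  proof -
    have "((\<lambda>u. norm (f u ^ n - f x ^ n) * norm b) \<longlongrightarrow> 0) \<F>"
      by (intro tendsto_mult_left_zero tendsto_norm_zero LIM_zero tendsto_power that)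
    then show ?thesis by (simp add: F.norm_scale flip: F.scale_left_diff_distrib)
  qed
  ultimately show ?thesis using f by (auto simp: weakly_cont_polys_def)
qed

section \<open>Weak continuity and bounds of polar forms\<close>

lemma weakly_cont_polys_subset: "weakly_cont_polys n sE sF \<subseteq> polys n sE sF"
  by (auto simp: weakly_cont_polys_def)

text \<open>The hypothesis on P concerns filters on E, the claim concerns families. So the families
  near w generate a filter, and each partial sum pushes it to a bounded filter on E that converges
  weakly to the partial sum of w; polarization is a finite combination of values of P at such
  sums.\<close>

lemma polar_form_weakly_cont:
  assumes P: "P \<in> weakly_cont_polys n sE sF" and e: "e > 0"
  shows "\<exists>U\<in>E.weak_nbhds. \<forall>v. (\<forall>k\<in>{..<n}. norm (v k) \<le> r \<and> v k - w k \<in> U)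
      \<and> (\<forall>k. k \<notin> {..<n} \<longrightarrow> v k = w k)
    \<longrightarrow> norm (polar_form n sE sF P (map v [0..<n]) - polar_form n sE sF P (map w [0..<n])) < e"
proof -
  have "P \<in> polys n sE sF" using P weakly_cont_polys_subset by blast
  then obtain A where A: "multilinear n sE sF A" "\<And>x. P x = A (replicate n x)" by (metis polyE)
  note pf = polar_form(3)[OF A]
  define N where "N U = {v. (\<forall>k<n. norm (v k) \<le> r \<and> v k - w k \<in> U)}" for U
  define \<F> where "\<F> = (INF U\<in>E.weak_nbhds. principal (N U))"
  have ev: "eventually R \<F> \<longleftrightarrow> (\<exists>U\<in>E.weak_nbhds. \<forall>v\<in>N U. R v)" for R
    unfolding \<F>_def
  proof (subst eventually_INF_base)
    show "E.weak_nbhds \<noteq> {}" using E.weak_nbhds_UNIV by blast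
    fix U V assume "U \<in> E.weak_nbhds" "V \<in> E.weak_nbhds"
    then obtain W where "W \<in> E.weak_nbhds" "W \<subseteq> U" "W \<subseteq> V" by (rule E.weak_nbhds_Int)
    then show "\<exists>W\<in>E.weak_nbhds. principal (N W) \<le> inf (principal (N U)) (principal (N V))"
      by (auto simp: N_def intro!: bexI[of _ W])
  qed (simp add: eventually_principal)
  have coord: "((\<lambda>v. f (v k)) \<longlongrightarrow> f (w k)) \<F>" if f: "f \<in> functionals sE" and k: "k < n" for f k
  proof (rule tendstoI)
    fix d :: real assume "d > 0"
    then have "{u. \<forall>f\<in>{f}. norm (f u) < d} \<in> E.weak_nbhds" using f by (intro E.weak_nbhdsI) auto
    then show "\<forall>\<^sub>F v in \<F>. dist (f (v k)) (f (w k)) < d"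
      unfolding ev using k
      by (intro bexI[of _ "{u. \<forall>f\<in>{f}. norm (f u) < d}"])
        (auto simp: N_def dist_norm E.ws.dual_diff[OF f])
  qed
  have sumP: "((\<lambda>v. P (\<Sum>i\<in>S. v i)) \<longlongrightarrow> P (\<Sum>i\<in>S. w i)) \<F>" if S: "S \<in> Pow {..<n}" for S
  proof -
    let ?G = "filtermap (\<lambda>v. \<Sum>i\<in>S. v i) \<F>"
    have "\<forall>\<^sub>F v in \<F>. norm (\<Sum>i\<in>S. v i) \<le> (\<Sum>i\<in>S. r)"
      unfolding ev using S E.weak_nbhds_UNIV
      by (intro bexI[of _ UNIV] ballI sum_norm_le) (auto simp: N_def)
    then have "\<exists>r. \<forall>\<^sub>F u in ?G. norm u \<le> r" by (auto simp: eventually_filtermap)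
    moreover have "(f \<longlongrightarrow> f (\<Sum>i\<in>S. w i)) ?G" if f: "f \<in> functionals sE" for f
      unfolding filterlim_filtermap E.ws.dual_sum[OF f UNIV_I]
      using S by (intro tendsto_sum coord f) auto
    ultimately have "((\<lambda>u. norm (P u - P (\<Sum>i\<in>S. w i))) \<longlongrightarrow> 0) ?G"
      using P unfolding weakly_cont_polys_def by blast
    then have "((\<lambda>v. P (\<Sum>i\<in>S. v i) - P (\<Sum>i\<in>S. w i)) \<longlongrightarrow> 0) \<F>"
      unfolding filterlim_filtermap by (rule tendsto_norm_zero_cancel)
    then show ?thesis by (rule LIM_zero_cancel)
  qed
  have "(polarization n P \<longlongrightarrow> polarization n P w) \<F>"
    unfolding polarization_def by (intro tendsto_scaleR tendsto_const tendsto_sum sumP)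
  then have "\<forall>\<^sub>F v in \<F>. dist (polarization n P v) (polarization n P w) < e" using e by (rule tendstoD)
  then obtain U where "U \<in> E.weak_nbhds" "\<forall>v\<in>N U. dist (polarization n P v) (polarization n P w) < e"
    unfolding ev by blast
  then show ?thesis by (intro bexI[of _ U]) (auto simp: pf N_def dist_norm)
qed

lemma polar_form_weakly_uniform:
  assumes P: "P \<in> weakly_cont_polys n sE sF" and e: "e > 0"
  obtains U where "U \<in> E.weak_nbhds"
    "\<And>v w. (\<And>k. k < n \<Longrightarrow> norm (v k) \<le> 1 \<and> norm (w k) \<le> 1 \<and> v k - w k \<in> U) \<Longrightarrow>
      norm (polar_form n sE sF P (map v [0..<n]) - polar_form n sE sF P (map w [0..<n])) < e"
proof -
  have "P \<in> polys n sE sF" using P weakly_cont_polys_subset by blast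
  then obtain A where A: "multilinear n sE sF A" "\<And>x. P x = A (replicate n x)" by (metis polyE)
  let ?A = "\<lambda>v. polar_form n sE sF P (map v [0..<n])"
  have "\<exists>U\<in>E.weak_nbhds. \<forall>v v'. (\<forall>k\<in>{..<n}. norm (v k) \<le> 1 \<and> norm (v' k) \<le> 1 \<and> v k - v' k \<in> U)
    \<and> (\<forall>k. k \<notin> {..<n} \<longrightarrow> v k = 0 \<and> v' k = 0) \<longrightarrow> norm (?A v - ?A v') < e"
    by (rule E.multiadditive_uniform[where A = ?A, OF _ _ _ e])
      (use multilinear_coord_eq(1)[OF polar_form(1)[OF A]] polar_form_weakly_cont[OF P] in auto)
  then obtain U where U: "U \<in> E.weak_nbhds" "\<And>v w. (\<And>k. k < n \<Longrightarrow> norm (v k) \<le> 1 \<and> norm (w k) \<le> 1 \<and> v k - w k \<in> U)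
     \<Longrightarrow> (\<And>k. \<not> k < n \<Longrightarrow> v k = 0 \<and> w k = 0) \<Longrightarrow> norm (?A v - ?A w) < e"
    by (metis lessThan_iff)
  show thesis
  proof (rule that[OF U(1)])
    fix v w :: "nat \<Rightarrow> 'a" assume vw: "\<And>k. k < n \<Longrightarrow> norm (v k) \<le> 1 \<and> norm (w k) \<le> 1 \<and> v k - w k \<in> U"
    \<comment> \<open>Entries from n on are set to 0, because the uniform statement requires both
      families to agree there with a fixed one; the polar form does not read them.\<close>
    let ?c = "\<lambda>v k. if k < n then v k else 0"
    have c: "map (?c v) [0..<n] = map v [0..<n]" for v :: "nat \<Rightarrow> 'a" by simp
    have "norm (?A (?c v) - ?A (?c w)) < e" by (rule U(2)) (use vw in auto)
    then show "norm (?A v - ?A w) < e" unfolding c .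
  qed
qed

lemma polar_form_bounded:
  assumes P: "P \<in> polys n sE sF" and n: "n \<ge> 1" and y: "y \<in> unit_ball (dual_space sF)"
  obtains C where "E.bounded_form n C (\<lambda>xs. y (polar_form n sE sF P xs))"
proof -
  obtain A where A: "multilinear n sE sF A" "\<And>x. P x = A (replicate n x)" using polyE[OF P] by metis
  note pf = polar_form(3)[OF A] and ml = polar_form(1)[OF A]
  obtain C where C: "0 \<le> C" "\<And>x. norm (P x) \<le> C * norm x ^ n" using poly_bound[OF P n] by blast
  \<comment> \<open>A partial sum of vectors of the unit ball has norm at most n, so P is at most C
    n^n in each term of the polarization.\<close>
  define D where "D = (1 / real (card (surjections n))) * (\<Sum>S\<in>Pow {..<n}. C * real n ^ n)"
  have D: "D \<ge> 0" unfolding D_def using C(1) by (intro mult_nonneg_nonneg sum_nonneg) auto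
  have yd: "y \<in> functionals sF" using y by (simp add: unit_ball_def)
  have unit: "norm (polar_form n sE sF P (map v [0..<n])) \<le> D" if v: "\<And>k. k < n \<Longrightarrow> norm (v k) \<le> 1" for v
  proof -
    have "norm (P (\<Sum>i\<in>S. v i)) \<le> C * real n ^ n" if S: "S \<in> Pow {..<n}" for S
    proof -
      have "norm (\<Sum>i\<in>S. v i) \<le> (\<Sum>i\<in>S. 1)" using S v by (intro sum_norm_le) auto
      also have "\<dots> \<le> real n" using card_mono[of "{..<n}" S] S by auto
      finally have "norm (\<Sum>i\<in>S. v i) ^ n \<le> real n ^ n" by (intro power_mono) auto
      then show ?thesis using C(2)[of "\<Sum>i\<in>S. v i"] mult_left_mono[OF _ C(1)] order_trans by blast
    qed
    then have "norm (\<Sum>S\<in>Pow {..<n}. (- 1) ^ card ({..<n} - S) *\<^sub>R P (\<Sum>i\<in>S. v i))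
        \<le> (\<Sum>S\<in>Pow {..<n}. C * real n ^ n)"
      by (intro sum_norm_le) (auto simp: power_abs)
    then show ?thesis unfolding pf polarization_def D_def norm_scaleR
      by (intro mult_mono) (auto intro: sum_nonneg C(1))
  qed
  have bound: "norm (polar_form n sE sF P (map v [0..<n])) \<le> D * (\<Prod>k<n. norm (v k))" for v
  proof -
    \<comment> \<open>For v k = 0 the convention 1 / 0 = 0 gives ?u k = 0, so the factorisation of v
      below covers zero entries as well.\<close>
    let ?u = "\<lambda>k. (1 / norm (v k)) *\<^sub>R v k"
    have "v = (\<lambda>k. sE (of_real (norm (v k))) (?u k))" by (auto simp: fun_eq_iff E.scale_of_real)
    then have "polar_form n sE sF P (map v [0..<n]) = sF (\<Prod>k<n. of_real (norm (v k))) (polar_form n sE sF P (map ?u [0..<n]))"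
      using multilinear_scale[OF ml, of "\<lambda>k. of_real (norm (v k))" ?u] by simp
    then have "norm (polar_form n sE sF P (map v [0..<n])) = (\<Prod>k<n. norm (v k)) * norm (polar_form n sE sF P (map ?u [0..<n]))"
      by (simp add: F.norm_scale flip: prod_norm)
    also have "\<dots> \<le> (\<Prod>k<n. norm (v k)) * D"
      by (intro mult_left_mono unit prod_nonneg) auto
    finally show ?thesis by (simp add: mult.commute)
  qed
  show thesis
  proof (rule that)
    show "E.bounded_form n D (\<lambda>xs. y (polar_form n sE sF P xs))"
      unfolding E.bounded_form_def
    proof (intro conjI allI impI D)
      fix xs :: "'a list" and i u w c assume xs: "length xs = n" "i < n"
      have "Vector_Spaces.linear sE sF (\<lambda>u. polar_form n sE sF P (xs[i := u]))"
        using ml xs unfolding multilinear_def by blast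
      then show "y (polar_form n sE sF P (xs[i := u + w])) = y (polar_form n sE sF P (xs[i := u])) + y (polar_form n sE sF P (xs[i := w]))"
        "y (polar_form n sE sF P (xs[i := sE c u])) = c * y (polar_form n sE sF P (xs[i := u]))"
        unfolding linear_iff by (simp_all add: F.ws.dual_add[OF yd] F.ws.dual_smul[OF yd])
    next
      fix xs :: "'a list" assume xs: "length xs = n"
      then have m: "map ((!) xs) [0..<n] = xs" using map_nth by metis
      have "prod_list (map norm xs) = (\<Prod>k<n. norm (xs ! k))"
        using xs by (simp add: prod.list_conv_set_nth atLeast0LessThan)
      then have "norm (polar_form n sE sF P xs) \<le> D * prod_list (map norm xs)"
        using bound[of "(!) xs"] by (simp add: m)
      then show "norm (y (polar_form n sE sF P xs)) \<le> D * prod_list (map norm xs)"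
        using F.ws.unit_ball_dual_bound[OF y UNIV_I] order_trans by blast
    qed
  qed
qed

end

section \<open>The canonical extension near the points of the bidual\<close>

text \<open>Every defining property of the unit ball of the dual involves at most three points, so
  it survives approximation on finite sets.\<close>

lemma (in nspace) unit_ball_dual_limit:
  assumes approx: "\<And>Q e. finite Q \<Longrightarrow> e > 0 \<Longrightarrow> \<exists>\<psi>\<in>unit_ball (dual X). \<forall>v\<in>Q. norm (\<psi> v - z v) < e"
  shows "z \<in> unit_ball (dual X)"
proof -
  have small: "x = 0" if b: "\<And>e. e > 0 \<Longrightarrow> norm x \<le> C * e" for x :: 'k and C
  proof -
    have "norm x \<le> 0 + e" if e: "e > 0" for e
    proof -
      have "norm x \<le> C * (e / (\<bar>C\<bar> + 1))" by (rule b) (use e in simp)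
      also have "\<dots> \<le> (\<bar>C\<bar> + 1) * (e / (\<bar>C\<bar> + 1))" using e by (intro mult_right_mono) auto
      also have "\<dots> = e" by (simp add: field_simps)
      finally show ?thesis by simp
    qed
    then have "norm x \<le> 0" by (rule field_le_epsilon)
    then show ?thesis by simp
  qed
  show ?thesis
  proof (rule unit_ball_dualI)
    fix u v assume uv: "u \<in> carr X" "v \<in> carr X"
    have "norm (z (u + v) - (z u + z v)) \<le> 3 * e" if e: "e > 0" for e
    proof -
      obtain \<psi> where \<psi>: "\<psi> \<in> unit_ball (dual X)" "\<forall>w\<in>{u, v, u + v}. norm (\<psi> w - z w) < e"
        using approx[of "{u, v, u + v}" e] e by auto
      then have "\<psi> (u + v) = \<psi> u + \<psi> v" using uv by (intro dual_add) (auto simp: unit_ball_def)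
      then have "z (u + v) - (z u + z v) = (\<psi> u - z u) + (\<psi> v - z v) - (\<psi> (u + v) - z (u + v))" by simp
      also have "norm \<dots> \<le> norm (\<psi> u - z u) + norm (\<psi> v - z v) + norm (\<psi> (u + v) - z (u + v))"
        by (rule order_trans[OF norm_triangle_ineq4]) (simp add: norm_triangle_ineq)
      finally show ?thesis using \<psi>(2) by auto
    qed
    from small[OF this] show "z (u + v) = z u + z v" by simp
  next
    fix c v assume v: "v \<in> carr X"
    have "norm (z (smul X c v) - c * z v) \<le> (1 + norm c) * e" if e: "e > 0" for e
    proof -
      obtain \<psi> where \<psi>: "\<psi> \<in> unit_ball (dual X)" "\<forall>w\<in>{v, smul X c v}. norm (\<psi> w - z w) < e"
        using approx[of "{v, smul X c v}" e] e by auto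
      then have "\<psi> (smul X c v) = c * \<psi> v" using v by (intro dual_smul) (auto simp: unit_ball_def)
      then have "z (smul X c v) - c * z v = c * (\<psi> v - z v) - (\<psi> (smul X c v) - z (smul X c v))"
        by (simp add: right_diff_distrib)
      also have "norm \<dots> \<le> norm c * norm (\<psi> v - z v) + norm (\<psi> (smul X c v) - z (smul X c v))"
        by (rule order_trans[OF norm_triangle_ineq4]) (simp add: norm_mult)
      also have "\<dots> \<le> norm c * e + e" using \<psi>(2) by (intro add_mono mult_left_mono) auto
      finally show ?thesis by (simp add: algebra_simps)
    qed
    from small[OF this] show "z (smul X c v) = c * z v" by simp
  next
    fix v assume v: "v \<in> carr X"
    show "norm (z v) \<le> nrm X v"
    proof (rule field_le_epsilon)
      fix e :: real assume e: "e > 0"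
      obtain \<psi> where \<psi>: "\<psi> \<in> unit_ball (dual X)" "norm (\<psi> v - z v) < e"
        using approx[of "{v}" e] e by auto
      have "norm (z v) \<le> norm (\<psi> v) + norm (\<psi> v - z v)"
        using norm_triangle_ineq4[of "\<psi> v" "\<psi> v - z v"] by simp
      then show "norm (z v) \<le> nrm X v + e" using unit_ball_dual_bound[OF \<psi>(1) v] \<psi>(2) by simp
    qed
  next
    fix v assume v: "v \<notin> carr X"
    have "norm (z v) \<le> 1 * e" if e: "e > 0" for e
    proof -
      obtain \<psi> where \<psi>: "\<psi> \<in> unit_ball (dual X)" "norm (\<psi> v - z v) < e"
        using approx[of "{v}" e] e by auto
      then have "\<psi> v = 0" using v by (intro dual_outside) (auto simp: unit_ball_def)
      then show ?thesis using \<psi>(2) by simp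
    qed
    from small[OF this] show "z v = 0" .
  qed
qed

text \<open>Tychonoff's theorem, transferred from \<open>product_topology\<close> to the topology of
  the function type.\<close>

lemma compact_PiE_UNIV:
  fixes K :: "'i \<Rightarrow> 'b::topological_space set"
  assumes "\<And>i. compact (K i)" shows "compact (PiE UNIV K)"
proof -
  have "compactin (product_topology (\<lambda>_. euclidean) UNIV) (PiE UNIV K)"
    using assms by (simp add: compactin_PiE)
  then show ?thesis by (simp add: euclidean_product_topology)
qed

lemma open_finite_approx:
  fixes z :: "'c \<Rightarrow> 'k::real_or_complex" and y :: "'d \<Rightarrow> 'k"
  assumes "finite Q" "finite R"
  shows "open {p. (\<forall>f\<in>Q. norm (fst p f - z f) < e) \<and> (\<forall>b\<in>R. norm (snd p b - y b) < e)}"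
proof -
  have c1: "continuous_on UNIV (\<lambda>p :: ('c \<Rightarrow> 'k) \<times> ('d \<Rightarrow> 'k). fst p f)" for f
    by (rule continuous_on_compose2[OF continuous_on_product_coordinates continuous_on_fst[OF continuous_on_id] subset_UNIV])
  have c2: "continuous_on UNIV (\<lambda>p :: ('c \<Rightarrow> 'k) \<times> ('d \<Rightarrow> 'k). snd p b)" for b
    by (rule continuous_on_compose2[OF continuous_on_product_coordinates continuous_on_snd[OF continuous_on_id] subset_UNIV])
  have "open ((\<Inter>f\<in>Q. {p :: ('c \<Rightarrow> 'k) \<times> ('d \<Rightarrow> 'k). norm (fst p f - z f) < e})
      \<inter> (\<Inter>b\<in>R. {p. norm (snd p b - y b) < e}))"
    by (intro open_Int open_INT ballI assms open_Collect_less continuous_intros c1 c2)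
  moreover have "(\<Inter>f\<in>Q. {p. norm (fst p f - z f) < e}) \<inter> (\<Inter>b\<in>R. {p. norm (snd p b - y b) < e})
    = {p. (\<forall>f\<in>Q. norm (fst p f - z f) < e) \<and> (\<forall>b\<in>R. norm (snd p b - y b) < e)}" by auto
  ultimately show ?thesis by simp
qed

context normed_pair
begin

text \<open>Uniform weak continuity gives one neighbourhood V of z in the ball on which the polar
  form, as a function of all its arguments, varies by less than e. The estimate is uniform in y
  because y does not increase norms.\<close>

lemma aron_berner_approx:
  assumes P: "P \<in> weakly_cont_polys n sE sF" and n: "n \<ge> 1"
    and z: "z \<in> unit_ball (dual (dual_space sE))" and e: "e > 0"
  obtains F d where "finite F" "F \<subseteq> functionals sE" "d > 0"
    "\<forall>x\<in>{x. norm x \<le> 1 \<and> (\<forall>f\<in>F. norm (f x - z f) < d)}. \<forall>y\<in>unit_ball (dual_space sF).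
      norm (aron_berner n sE sF P z y - y (P x)) \<le> e"
    "\<forall>x\<in>{x. norm x \<le> 1 \<and> (\<forall>f\<in>F. norm (f x - z f) < d)}.
      \<forall>x'\<in>{x. norm x \<le> 1 \<and> (\<forall>f\<in>F. norm (f x - z f) < d)}. norm (P x - P x') \<le> e"
proof -
  let ?A = "\<lambda>v. polar_form n sE sF P (map v [0..<n])"
  have Pp: "P \<in> polys n sE sF" using P weakly_cont_polys_subset by blast
  then obtain A where A: "multilinear n sE sF A" "\<And>x. P x = A (replicate n x)" by (metis polyE)
  have diag: "P x = ?A (\<lambda>_. x)" for x
    using polar_form(2)[OF A, of x] by (simp add: map_replicate_const)
  obtain U where "U \<in> E.weak_nbhds" and Unif:
    "\<And>v w. (\<And>k. k < n \<Longrightarrow> norm (v k) \<le> 1 \<and> norm (w k) \<le> 1 \<and> v k - w k \<in> U) \<Longrightarrow> norm (?A v - ?A w) < e"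
    using polar_form_weakly_uniform[OF P e] by blast
  then obtain F d where F: "U = {u. \<forall>f\<in>F. norm (f u) < d}" "finite F" "F \<subseteq> functionals sE" "d > 0"
    unfolding E.weak_nbhds_def by blast
  \<comment> \<open>Two points within d / 2 of z on F differ by less than d there, so their
    difference lies in U.\<close>
  define V where "V = {x. norm x \<le> 1 \<and> (\<forall>f\<in>F. norm (f x - z f) < d / 2)}"
  have VU: "x - x' \<in> U" if "x \<in> V" "x' \<in> V" for x x'
  proof -
    have "norm (f (x - x')) < d" if f: "f \<in> F" for f
    proof -
      have "f (x - x') = (f x - z f) - (f x' - z f)" using F(3) f E.ws.dual_diff by auto
      then have "norm (f (x - x')) \<le> norm (f x - z f) + norm (f x' - z f)"
        by (simp only: norm_triangle_ineq4)
      moreover have "norm (f x - z f) < d / 2" "norm (f x' - z f) < d / 2"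
        using \<open>x \<in> V\<close> \<open>x' \<in> V\<close> f unfolding V_def by blast+
      ultimately show ?thesis by simp
    qed
    then show ?thesis by (simp add: F(1))
  qed
  have close: "norm (?A v - ?A w) < e" if "\<And>k. k < n \<Longrightarrow> v k \<in> V" "\<And>k. k < n \<Longrightarrow> w k \<in> V" for v w
    by (rule Unif) (use that VU in \<open>auto simp: V_def\<close>)
  show thesis
  proof (rule that[OF F(2,3), of "d / 2", folded V_def], safe)
    fix x y assume x: "x \<in> V" and y: "y \<in> unit_ball (dual_space sF)"
    have yd: "y \<in> functionals sF" using y by (simp add: unit_ball_def)
    obtain C where C: "E.bounded_form n C (\<lambda>xs. y (polar_form n sE sF P xs))"
      using polar_form_bounded[OF Pp n y] by blast
    have "norm (iterated_ext (replicate n z) (\<lambda>xs. y (polar_form n sE sF P xs)) - y (P x)) \<le> e"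
    proof (rule E.iterated_ext_approx[OF z F(2,3) _ V_def C])
      fix xs assume xs: "length xs = n" "set xs \<subseteq> V"
      then have m: "map ((!) xs) [0..<n] = xs" using map_nth by metis
      have "norm (y (polar_form n sE sF P xs) - y (P x)) = norm (y (?A ((!) xs) - ?A (\<lambda>_. x)))"
        by (simp only: m diag[of x, symmetric] F.ws.dual_diff[OF yd UNIV_I UNIV_I])
      also have "\<dots> \<le> norm (?A ((!) xs) - ?A (\<lambda>_. x))" by (rule F.ws.unit_ball_dual_bound[OF y UNIV_I])
      also have "\<dots> < e" by (rule close) (use xs x in auto)
      finally show "norm (y (polar_form n sE sF P xs) - y (P x)) \<le> e" by simp
    qed (use F(4) in simp)
    then show "norm (aron_berner n sE sF P z y - y (P x)) \<le> e" using yd by (simp add: aron_berner_def)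
  next
    fix x x' assume "x \<in> V" "x' \<in> V"
    then have "norm (?A (\<lambda>_. x) - ?A (\<lambda>_. x')) < e" by (intro close)
    then show "norm (P x - P x') \<le> e" unfolding diag[of x, symmetric] diag[of x', symmetric] by simp
  qed (use F(4) in simp)
qed

text \<open>Goldstine's theorem provides a point x of the unit ball with y (P x) within e of the
  extension. The factor \<open>nrm (dual_space sF) y\<close> is kept in order to prove later that y
  is a unit vector.\<close>

lemma aron_berner_bound:
  assumes P: "P \<in> weakly_cont_polys n sE sF" and n: "n \<ge> 1"
    and z: "z \<in> unit_ball (dual (dual_space sE))" and y: "y \<in> unit_ball (dual_space sF)"
  shows "norm (aron_berner n sE sF P z y) \<le> nrm (dual_space sF) y * poly_norm P"
proof (rule field_le_epsilon)
  fix e :: real assume e: "e > 0"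
  obtain F d where F: "finite F" "F \<subseteq> functionals sE" "d > 0"
    and ab: "\<forall>x\<in>{x. norm x \<le> 1 \<and> (\<forall>f\<in>F. norm (f x - z f) < d)}. \<forall>y\<in>unit_ball (dual_space sF).
      norm (aron_berner n sE sF P z y - y (P x)) \<le> e"
    by (rule aron_berner_approx[OF P n z e])
  obtain x where x: "norm x \<le> 1" "\<And>f. f \<in> F \<Longrightarrow> norm (f x - z f) < d"
    using E.Goldstine[OF z F] by blast
  have yd: "y \<in> functionals sF" using y by (simp add: unit_ball_def)
  have "norm (P x) \<le> poly_norm P" using P weakly_cont_polys_subset n x by (intro poly_norm_upper) auto
  then have "nrm (dual_space sF) y * norm (P x) \<le> nrm (dual_space sF) y * poly_norm P"
    using F.ws.nrm_dual_nonneg[OF yd] by (rule mult_left_mono)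
  moreover have "norm (y (P x)) \<le> nrm (dual_space sF) y * norm (P x)" by (rule F.ws.dual_bound[OF yd UNIV_I])
  moreover have "norm (aron_berner n sE sF P z y - y (P x)) \<le> e" using ab x y by blast
  ultimately show "norm (aron_berner n sE sF P z y) \<le> nrm (dual_space sF) y * poly_norm P + e"
    using norm_triangle_sub[of "aron_berner n sE sF P z y" "y (P x)"] by linarith
qed

text \<open>Apply \<open>aron_berner_bound\<close> to z / s and use homogeneity. Dividing by a
  positive bound s instead of the norm of z covers z = 0.\<close>

lemma aron_berner_bound_power:
  assumes P: "P \<in> weakly_cont_polys n sE sF" and n: "n \<ge> 1"
    and z: "z \<in> carr (dual (dual_space sE))" "nrm (dual (dual_space sE)) z \<le> s" "s > 0"
    and y: "y \<in> unit_ball (dual_space sF)"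
  shows "norm (aron_berner n sE sF P z y) \<le> s ^ n * poly_norm P"
proof -
  let ?w = "smul (dual (dual_space sE)) (of_real (1 / s)) z"
  have yd: "y \<in> functionals sF" using y by (simp add: unit_ball_def)
  have w: "?w \<in> unit_ball (dual (dual_space sE))"
    using z by (simp add: unit_ball_def E.dds.smul_mem E.dds.nrm_smul norm_divide)
  have Pp: "P \<in> polys n sE sF" using P weakly_cont_polys_subset by blast
  obtain C where C: "E.bounded_form n C (\<lambda>xs. y (polar_form n sE sF P xs))"
    using polar_form_bounded[OF Pp n y] by blast
  have "z f = of_real s * ?w f" for f using z(3) by (simp add: dual_def)
  then have "aron_berner n sE sF P z y = of_real (s ^ n) * aron_berner n sE sF P ?w y"
    using E.iterated_ext_scaleR[OF w _ C, of z s] yd by (simp only: aron_berner_def simp_thms if_True)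
  then have "norm (aron_berner n sE sF P z y) = s ^ n * norm (aron_berner n sE sF P ?w y)"
    using z(3) by (simp add: norm_mult norm_power)
  also have "\<dots> \<le> s ^ n * (nrm (dual_space sF) y * poly_norm P)"
    using z(3) by (intro mult_left_mono aron_berner_bound P n w y) simp
  also have "\<dots> \<le> s ^ n * (1 * poly_norm P)"
  proof (intro mult_left_mono mult_right_mono)
    show "nrm (dual_space sF) y \<le> 1" using y by (simp add: unit_ball_def)
    have "0 \<le> norm (P 0)" by simp
    also have "\<dots> \<le> poly_norm P" by (rule poly_norm_upper[OF Pp n]) simp
    finally show "0 \<le> poly_norm P" .
  qed (use z(3) in simp)
  finally show ?thesis by simp
qed

text \<open>The pairs live in a product of discs, compact by Tychonoff's theorem. The closures of
  the sets of pairs that approximate \<phi> on Q up to e have the finite intersection property, and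
  any common point serves as (z, y). Closeness to it and to \<phi> then holds for one and the same
  pair.\<close>

lemma extreme_functional_cluster_point:
  assumes J: "module.subspace (\<lambda>c P x. sF c (P x)) J" "J \<subseteq> polys n sE sF" and n: "n \<ge> 1"
    and nz: "\<exists>x::'a. x \<noteq> 0" "\<exists>y::'b. y \<noteq> 0"
    and ext: "\<phi> extreme_point_of unit_ball (dual (poly_space sF J))"
  obtains z y where "z \<in> unit_ball (dual (dual_space sE))" "y \<in> unit_ball (dual_space sF)"
    "\<And>Q F B e. finite Q \<Longrightarrow> Q \<subseteq> J \<Longrightarrow> finite F \<Longrightarrow> F \<subseteq> functionals sE \<Longrightarrow> finite B \<Longrightarrow> e > 0 \<Longrightarrow>
      \<exists>x v. norm x = 1 \<and> v \<in> unit_sphere (dual_space sF) \<and> (\<forall>P\<in>Q. norm (v (P x) - \<phi> P) < e)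
        \<and> (\<forall>f\<in>F. norm (f x - z f) < e) \<and> (\<forall>b\<in>B. norm (v b - y b) < e)"
proof -
  let ?ev = "\<lambda>x f. if f \<in> functionals sE then f x else 0"
  define S where "S Q e = {(x, v). norm x = 1 \<and> v \<in> unit_sphere (dual_space sF)
    \<and> (\<forall>P\<in>Q. norm (v (P x) - \<phi> P) < e)}" for Q e
  define G where "G = (\<lambda>(x, v :: 'b \<Rightarrow> 'k). (?ev x, v))"
  define I where "I = {(Q, e :: real). finite Q \<and> Q \<subseteq> J \<and> e > 0}"
  \<comment> \<open>Radius 0 outside the functionals matches the convention that elements of the
    bidual vanish there.\<close>
  let ?K = "PiE UNIV (\<lambda>f. cball (0::'k) (if f \<in> functionals sE then nrm (dual_space sE) f else 0))
    \<times> PiE UNIV (\<lambda>b :: 'b. cball (0::'k) (norm b))"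
  have K: "compact ?K" by (intro compact_Times compact_PiE_UNIV compact_cball_scalar)
  have GK: "G ` S Q e \<subseteq> ?K" for Q e
  proof
    fix p assume "p \<in> G ` S Q e"
    then obtain x v where p: "p = (?ev x, v)" and x: "norm x = 1" and v: "v \<in> unit_ball (dual_space sF)"
      by (auto simp: S_def G_def unit_ball_def unit_sphere_def)
    have "norm (f x) \<le> nrm (dual_space sE) f" if "f \<in> functionals sE" for f
      using E.ws.dual_bound[OF that, of x] x by simp
    moreover have "norm (v b) \<le> norm b" for b using F.ws.unit_ball_dual_bound[OF v] by simp
    ultimately show "p \<in> ?K" by (auto simp: p PiE_iff)
  qed
  have "?K \<inter> (\<Inter>((\<lambda>(Q, e). closure (G ` S Q e)) ` I)) \<noteq> {}"
  proof (rule compact_imp_fip_image[OF K])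
    fix I' assume I': "finite I'" "I' \<subseteq> I"
    \<comment> \<open>The inserted 1 makes the minimum meaningful when \<open>I'\<close> is
      empty.\<close>
    let ?Q = "\<Union>(fst ` I')" and ?e = "Min (insert 1 (snd ` I'))"
    have e: "?e > 0" using I' by (auto simp: I_def subset_iff)
    have Q: "finite ?Q" "?Q \<subseteq> J" using I' by (auto simp: I_def subset_iff)
    obtain x v where xv: "norm x = 1" "v \<in> unit_sphere (dual_space sF)" "\<And>P. P \<in> ?Q \<Longrightarrow> norm (v (P x) - \<phi> P) < ?e"
      using extreme_functional_approx[OF J n nz ext Q e] by blast
    have "G (x, v) \<in> closure (G ` S Q e)" if "(Q, e) \<in> I'" for Q e
    proof -
      have "?e \<le> e" using I'(1) that by (intro Min_le) force+
      moreover have "Q \<subseteq> ?Q" using that by force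
      ultimately have "norm (v (P x) - \<phi> P) < e" if "P \<in> Q" for P
        using xv(3)[of P] that by (meson order_less_le_trans subsetD)
      then have "(x, v) \<in> S Q e" using xv(1,2) by (simp add: S_def)
      then show ?thesis by (intro subsetD[OF closure_subset] imageI)
    qed
    then have "G (x, v) \<in> (\<Inter>i\<in>I'. (\<lambda>(Q, e). closure (G ` S Q e)) i)" by (intro INT_I) (auto split: prod.split)
    \<comment> \<open>With Q empty every pair of unit vectors qualifies, so \<open>GK\<close> places
      this one in ?K.\<close>
    moreover have "(x, v) \<in> S {} 1" using xv by (simp add: S_def)
    then have "G (x, v) \<in> ?K" by (intro subsetD[OF GK[of "{}" 1]] imageI)
    ultimately have "G (x, v) \<in> ?K \<inter> (\<Inter>i\<in>I'. (\<lambda>(Q, e). closure (G ` S Q e)) i)" by (rule IntI[rotated])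
    then show "?K \<inter> (\<Inter>i\<in>I'. (\<lambda>(Q, e). closure (G ` S Q e)) i) \<noteq> {}" by (metis empty_iff)
  qed auto
  then obtain z y where zy: "\<And>Q e. (Q, e) \<in> I \<Longrightarrow> (z, y) \<in> closure (G ` S Q e)" by force
  have approx: "\<exists>x v. norm x = 1 \<and> v \<in> unit_sphere (dual_space sF) \<and> (\<forall>P\<in>Q. norm (v (P x) - \<phi> P) < e)
        \<and> (\<forall>f\<in>F. norm (?ev x f - z f) < e) \<and> (\<forall>b\<in>B. norm (v b - y b) < e)"
    if "finite Q" "Q \<subseteq> J" "finite F" "finite B" "e > 0" for Q F B e
  proof -
    let ?O = "{p. (\<forall>f\<in>F. norm (fst p f - z f) < e) \<and> (\<forall>b\<in>B. norm (snd p b - y b) < e)}"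
    have "open ?O" by (rule open_finite_approx[OF that(3,4)])
    moreover have "(z, y) \<in> ?O" using that by simp
    moreover have "(z, y) \<in> closure (G ` S Q e)" using that by (intro zy) (simp add: I_def)
    ultimately have "G ` S Q e \<inter> ?O \<noteq> {}" using closure_iff_nhds_not_empty by blast
    then obtain q where "q \<in> S Q e" "G q \<in> ?O" by blast
    then obtain x v where "(x, v) \<in> S Q e" "G (x, v) \<in> ?O" by (cases q) blast
    then show ?thesis by (intro exI[of _ x] exI[of _ v]) (simp add: S_def G_def)
  qed
  show thesis
  proof (rule that)
    show "z \<in> unit_ball (dual (dual_space sE))"
    proof (rule E.ds.unit_ball_dual_limit)
      fix F :: "('a \<Rightarrow> 'k) set" and e :: real assume "finite F" "e > 0"
      from approx[OF finite.emptyI empty_subsetI this(1) finite.emptyI this(2)]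
      obtain x v where "norm x = 1" "\<forall>f\<in>F. norm (?ev x f - z f) < e" by blast
      then show "\<exists>\<psi>\<in>unit_ball (dual (dual_space sE)). \<forall>f\<in>F. norm (\<psi> f - z f) < e"
        using E.evaluation_unit_ball[of x] by (intro bexI[of _ "?ev x"]) auto
    qed
    show "y \<in> unit_ball (dual_space sF)"
    proof (rule F.ws.unit_ball_dual_limit)
      fix B :: "'b set" and e :: real assume "finite B" "e > 0"
      from approx[OF finite.emptyI empty_subsetI finite.emptyI this]
      obtain x v where "v \<in> unit_sphere (dual_space sF)" "\<forall>b\<in>B. norm (v b - y b) < e" by blast
      then show "\<exists>\<psi>\<in>unit_ball (dual_space sF). \<forall>b\<in>B. norm (\<psi> b - y b) < e"
        by (intro bexI[of _ v]) (auto simp: unit_ball_def unit_sphere_def)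
    qed
    fix Q :: "('a \<Rightarrow> 'b) set" and F :: "('a \<Rightarrow> 'k) set" and B :: "'b set" and e :: real
    assume "finite Q" "Q \<subseteq> J" "finite F" and F: "F \<subseteq> functionals sE" and "finite B" "e > 0"
    then obtain x v where xv: "norm x = 1" "v \<in> unit_sphere (dual_space sF)" "\<forall>P\<in>Q. norm (v (P x) - \<phi> P) < e"
      "\<forall>f\<in>F. norm (?ev x f - z f) < e" "\<forall>b\<in>B. norm (v b - y b) < e"
      using approx by metis
    moreover have "\<forall>f\<in>F. norm (f x - z f) < e" using xv(4) F by (auto simp: subset_iff)
    ultimately show "\<exists>x v. norm x = 1 \<and> v \<in> unit_sphere (dual_space sF) \<and> (\<forall>P\<in>Q. norm (v (P x) - \<phi> P) < e)
        \<and> (\<forall>f\<in>F. norm (f x - z f) < e) \<and> (\<forall>b\<in>B. norm (v b - y b) < e)" by blast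
  qed
qed

text \<open>If s < 1, then \<phi> plus and minus (1 - s) \<psi> stay in the unit ball for an
  evaluation functional \<psi>, and extremality forces \<psi> = 0. Both norms in (b) follow, with s
  coming from y or from z.\<close>

lemma extreme_functional_strict:
  assumes n: "n \<ge> 1" and nz: "\<exists>x::'a. x \<noteq> 0" "\<exists>y::'b. y \<noteq> 0"
    and ext: "\<phi> extreme_point_of unit_ball (dual (poly_space sF (weakly_cont_polys n sE sF)))"
    and le: "\<And>P. P \<in> weakly_cont_polys n sE sF \<Longrightarrow> norm (\<phi> P) \<le> s * poly_norm P"
  shows "s \<ge> 1"
proof (rule ccontr)
  assume "\<not> s \<ge> 1"
  then have s: "s < 1" by simp
  let ?J = "weakly_cont_polys n sE sF"
  note J = subspace_weakly_cont_polys weakly_cont_polys_subset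
  interpret X: nspace "poly_space sF ?J" by (rule nspace_poly_space[OF J n])
  obtain a :: 'a where a: "a \<noteq> 0" using nz by blast
  define x where "x = (1 / norm a) *\<^sub>R a"
  have x: "norm x = 1" using a by (simp add: x_def)
  then have "x \<noteq> 0" by auto
  then obtain f where f: "f \<in> unit_sphere (dual_space sE)" "re (f x) = norm x" by (rule E.norming_functional)
  obtain b :: 'b where b: "b \<noteq> 0" using nz by blast
  then obtain y where y: "y \<in> unit_sphere (dual_space sF)" "re (y b) = norm b" by (rule F.norming_functional)
  define \<psi> where "\<psi> = eval_tensor ?J x y"
  have \<psi>: "\<psi> \<in> unit_ball (dual (poly_space sF ?J))"
    unfolding \<psi>_def using x y by (intro eval_tensor_unit_ball[OF J n]) (auto simp: unit_ball_def unit_sphere_def)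
  have \<psi>d: "\<psi> \<in> carr (dual (poly_space sF ?J))" using \<psi> by (simp add: unit_ball_def)
  have \<phi>d: "\<phi> \<in> carr (dual (poly_space sF ?J))" using ext by (simp add: extreme_point_of_def unit_ball_def)
  have pert: "(\<lambda>P. \<phi> P + of_real r * \<psi> P) \<in> unit_ball (dual (poly_space sF ?J))" if r: "\<bar>r\<bar> = 1 - s" for r
  proof (rule X.unit_ball_dualI)
    fix P assume P: "P \<in> carr (poly_space sF ?J)"
    have "norm (\<phi> P + of_real r * \<psi> P) \<le> norm (\<phi> P) + \<bar>r\<bar> * norm (\<psi> P)"
      using norm_triangle_ineq[of "\<phi> P" "of_real r * \<psi> P"] by (simp add: norm_mult)
    also have "\<dots> \<le> s * poly_norm P + (1 - s) * poly_norm P"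
      using X.unit_ball_dual_bound[OF \<psi> P] le P s r by (intro add_mono mult_mono) auto
    finally show "norm (\<phi> P + of_real r * \<psi> P) \<le> nrm (poly_space sF ?J) P" by (simp add: algebra_simps)
  qed (auto simp: X.dual_add[OF \<psi>d] X.dual_add[OF \<phi>d] X.dual_smul[OF \<psi>d, simplified]
      X.dual_smul[OF \<phi>d, simplified] X.dual_outside[OF \<psi>d] X.dual_outside[OF \<phi>d] algebra_simps)
  have "(\<lambda>P. \<phi> P + of_real (1 - s) * \<psi> P) = (\<lambda>P. \<phi> P + of_real (s - 1) * \<psi> P)"
  proof (rule X.extreme_midpoint[OF ext pert pert, of _ _ "1 / 2"])
    show "\<phi> P = (1 - 1 / 2) *\<^sub>R (\<phi> P + of_real (1 - s) * \<psi> P) + (1 / 2) *\<^sub>R (\<phi> P + of_real (s - 1) * \<psi> P)" for P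
    proof -
      have "of_real (s - 1) * \<psi> P = - (of_real (1 - s) * \<psi> P)" by (simp add: algebra_simps)
      then have "(1 - 1 / 2) *\<^sub>R (\<phi> P + of_real (1 - s) * \<psi> P) + (1 / 2) *\<^sub>R (\<phi> P + of_real (s - 1) * \<psi> P)
          = (1 / 2) *\<^sub>R (\<phi> P + \<phi> P)"
        by (simp flip: scaleR_right_distrib)
      then show ?thesis by (simp flip: scaleR_2)
    qed
  qed (use s in auto)
  then have "of_real (1 - s) * \<psi> P = of_real (s - 1) * \<psi> P" for P
    by (metis add_left_cancel)
  then have "of_real (2 * (1 - s)) * \<psi> P = 0" for P
    by (simp add: algebra_simps) 
  then have zero: "\<psi> P = 0" for P using s by (metis less_numeral_extra(3) mult_eq_0_iff of_real_eq_0_iff diff_gt_0_iff_gt zero_neq_numeral)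
  \<comment> \<open>The functionals f and y norm x and b, so \<psi> takes the nonzero value f(x)^n
    y(b) at this polynomial.\<close>
  let ?P = "\<lambda>x. sF (f x ^ n) b"
  have "?P \<in> ?J" using f by (intro power_functional_weakly_cont) (simp add: unit_sphere_def)
  then have "\<psi> ?P = f x ^ n * y b"
    using y(1) by (simp add: \<psi>_def eval_tensor_def unit_sphere_def F.ws.dual_smul)
  moreover have "f x \<noteq> 0" "y b \<noteq> 0" using f(2) y(2) x b by auto
  ultimately show False using zero[of ?P] by simp
qed

lemma extreme_functionals_bidual:
  assumes n: "n \<ge> 1" and nz: "\<exists>x::'a. x \<noteq> 0" "\<exists>y::'b. y \<noteq> 0"
    and ext: "\<phi> extreme_point_of unit_ball (dual (poly_space sF (weakly_cont_polys n sE sF)))"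
  obtains z y where "z \<in> unit_sphere (dual (dual_space sE))" "y \<in> unit_sphere (dual_space sF)"
    "\<phi> = bidual_eval_tensor n sE sF (weakly_cont_polys n sE sF) z y"
proof -
  let ?J = "weakly_cont_polys n sE sF"
  note J = subspace_weakly_cont_polys weakly_cont_polys_subset
  interpret X: nspace "poly_space sF ?J" by (rule nspace_poly_space[OF J n])
  obtain z y where z: "z \<in> unit_ball (dual (dual_space sE))" and y: "y \<in> unit_ball (dual_space sF)"
    and approx: "\<And>Q F B e. finite Q \<Longrightarrow> Q \<subseteq> ?J \<Longrightarrow> finite F \<Longrightarrow> F \<subseteq> functionals sE \<Longrightarrow> finite B \<Longrightarrow> e > 0 \<Longrightarrow>
      \<exists>x v. norm x = 1 \<and> v \<in> unit_sphere (dual_space sF) \<and> (\<forall>P\<in>Q. norm (v (P x) - \<phi> P) < e)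
        \<and> (\<forall>f\<in>F. norm (f x - z f) < e) \<and> (\<forall>b\<in>B. norm (v b - y b) < e)"
    using extreme_functional_cluster_point[OF J n nz ext] by blast
  have eq: "\<phi> P = aron_berner n sE sF P z y" if P: "P \<in> ?J" for P
  proof -
    have "norm (\<phi> P - aron_berner n sE sF P z y) \<le> 0 + e" if e: "e > 0" for e
    proof -
      have "e / 4 > 0" using e by simp
      obtain F d where F: "finite F" "F \<subseteq> functionals sE" "d > 0"
        and ab: "\<forall>x\<in>{x. norm x \<le> 1 \<and> (\<forall>f\<in>F. norm (f x - z f) < d)}. \<forall>y\<in>unit_ball (dual_space sF).
          norm (aron_berner n sE sF P z y - y (P x)) \<le> e / 4"
        and osc: "\<forall>x\<in>{x. norm x \<le> 1 \<and> (\<forall>f\<in>F. norm (f x - z f) < d)}.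
          \<forall>x'\<in>{x. norm x \<le> 1 \<and> (\<forall>f\<in>F. norm (f x - z f) < d)}. norm (P x - P x') \<le> e / 4"
        by (rule aron_berner_approx[OF P n z \<open>e / 4 > 0\<close>])
      obtain x0 where x0: "norm x0 \<le> 1" "\<And>f. f \<in> F \<Longrightarrow> norm (f x0 - z f) < d"
        using E.Goldstine[OF z F] by blast
      obtain x v where x: "norm x = 1" and v: "v \<in> unit_sphere (dual_space sF)"
        and c: "norm (v (P x) - \<phi> P) < min d (e / 4)" "\<And>f. f \<in> F \<Longrightarrow> norm (f x - z f) < min d (e / 4)"
          "norm (v (P x0) - y (P x0)) < min d (e / 4)"
        using approx[of "{P}" F "{P x0}" "min d (e / 4)"] F P e by auto
      have vb: "v \<in> unit_ball (dual_space sF)" "v \<in> functionals sF" using v by (auto simp: unit_ball_def unit_sphere_def)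
      have "norm (v (P x) - v (P x0)) = norm (v (P x - P x0))" by (simp add: F.ws.dual_diff[OF vb(2)])
      also have "\<dots> \<le> norm (P x - P x0)" by (rule F.ws.unit_ball_dual_bound[OF vb(1) UNIV_I])
      also have "\<dots> \<le> e / 4" using x x0 c(2) osc by simp
      finally have d1: "norm (v (P x) - v (P x0)) \<le> e / 4" .
      have d2: "norm (aron_berner n sE sF P z y - y (P x0)) \<le> e / 4" using ab x0 y by blast
      let ?A = "aron_berner n sE sF P z y"
      \<comment> \<open>Four errors of at most e / 4: moving x to x0 under v, approximating \<phi>,
        passing from v to y at P x0, and comparing with the extension at z.\<close>
      have "\<phi> P - ?A = ((v (P x) - v (P x0)) - (v (P x) - \<phi> P)) + ((v (P x0) - y (P x0)) - (?A - y (P x0)))"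
        by simp
      also have "norm \<dots> \<le> (norm (v (P x) - v (P x0)) + norm (v (P x) - \<phi> P))
          + (norm (v (P x0) - y (P x0)) + norm (?A - y (P x0)))"
        by (intro order_trans[OF norm_triangle_ineq] add_mono norm_triangle_ineq4)
      finally show ?thesis using d1 d2 c by simp
    qed
    then have "norm (\<phi> P - aron_berner n sE sF P z y) \<le> 0" by (rule field_le_epsilon)
    then show ?thesis by simp
  qed
  have zd: "z \<in> carr (dual (dual_space sE))" "nrm (dual (dual_space sE)) z \<le> 1"
    and yd: "y \<in> functionals sF" "nrm (dual_space sF) y \<le> 1" using z y by (auto simp: unit_ball_def)
  \<comment> \<open>Here the norm of y itself is the bound s for \<phi>.\<close>
  have "nrm (dual_space sF) y \<ge> 1"
    by (rule extreme_functional_strict[OF n nz ext]) (simp add: eq aron_berner_bound[OF _ n z y])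
  moreover have "nrm (dual (dual_space sE)) z \<ge> 1"
  proof (rule ccontr)
    assume "\<not> ?thesis"
    then have "nrm (dual (dual_space sE)) z < 1" by simp
    \<comment> \<open>A strictly larger s is positive even when z = 0, and s < 1 still gives s ^ n <
      1 because n \<ge> 1.\<close>
    then obtain s where s: "nrm (dual (dual_space sE)) z < s" "s < 1" using dense by blast
    then have "s > 0" using E.dds.nrm_nonneg[OF zd(1)] by linarith
    have "s ^ n \<ge> 1"
      by (rule extreme_functional_strict[OF n nz ext])
        (use s \<open>s > 0\<close> in \<open>simp add: eq aron_berner_bound_power[OF _ n zd(1) _ _ y]\<close>)
    moreover have "s ^ n < 1" using s(2) \<open>s > 0\<close> n power_strict_mono[of s 1 n] by simp
    ultimately show False by simp
  qed
  ultimately show thesis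
  proof (intro that[of z y])
    show "\<phi> = bidual_eval_tensor n sE sF ?J z y"
    proof
      fix P
      have "\<phi> \<in> carr (dual (poly_space sF ?J))" using ext by (simp add: extreme_point_of_def unit_ball_def)
      then show "\<phi> P = bidual_eval_tensor n sE sF ?J z y P"
        using X.dual_outside[of \<phi> P] by (simp add: bidual_eval_tensor_def eq)
    qed
  qed (use zd yd in \<open>auto simp: unit_sphere_def\<close>)
qed

end

theorem proposition1p2:
  fixes sE :: "'k::real_or_complex \<Rightarrow> 'a::banach \<Rightarrow> 'a"
    and sF :: "'k \<Rightarrow> 'b::banach \<Rightarrow> 'b"
    and n :: nat
  assumes "normed_space_over sE" and "normed_space_over sF"
    and "\<exists>x::'a. x \<noteq> 0" and "\<exists>y::'b. y \<noteq> 0"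
    and "n \<ge> 1"
  shows
    "(\<forall>J. module.subspace (\<lambda>c P x. sF c (P x)) J \<and> J \<subseteq> polys n sE sF \<and> finite_type_polys n sE sF \<subseteq> J
        \<longrightarrow> {\<phi>. \<phi> extreme_point_of unit_ball (dual (poly_space sF J))}
            \<subseteq> weak_star (poly_space sF J) closure_of
                {eval_tensor J x y | x y. x \<in> sphere 0 1 \<and> y \<in> unit_sphere (dual (whole_space sF))})
     \<and> {\<phi>. \<phi> extreme_point_of unit_ball (dual (poly_space sF (weakly_cont_polys n sE sF)))}
         \<subseteq> {bidual_eval_tensor n sE sF (weakly_cont_polys n sE sF) z y | z y.
              z \<in> unit_sphere (dual (dual (whole_space sE))) \<and> y \<in> unit_sphere (dual (whole_space sF))}"
proof -
  interpret normed_pair sE sF using assms(1,2) by (simp add: normed_pair_def)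
  show ?thesis
  proof (intro conjI allI impI subsetI; clarsimp)
    fix J \<phi> assume "module.subspace (\<lambda>c P x. sF c (P x)) J" "J \<subseteq> polys n sE sF"
      "\<phi> extreme_point_of unit_ball (dual (poly_space sF J))"
    then show "\<phi> \<in> weak_star (poly_space sF J) closure_of
        {eval_tensor J x y | x y. norm x = 1 \<and> y \<in> unit_sphere (dual (whole_space sF))}"
      using extreme_functionals_subset_closure[of J n \<phi>] assms(3-5) by simp
  next
    fix \<phi> assume "\<phi> extreme_point_of unit_ball (dual (poly_space sF (weakly_cont_polys n sE sF)))"
    then obtain z y where "z \<in> unit_sphere (dual (dual_space sE))" "y \<in> unit_sphere (dual_space sF)"
      "\<phi> = bidual_eval_tensor n sE sF (weakly_cont_polys n sE sF) z y"
      using extreme_functionals_bidual[OF assms(5,3,4)] by blast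
    then show "\<exists>z y. \<phi> = bidual_eval_tensor n sE sF (weakly_cont_polys n sE sF) z y
      \<and> z \<in> unit_sphere (dual (dual (whole_space sE))) \<and> y \<in> unit_sphere (dual (whole_space sF))"
      by blast
  qed
qed

end
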